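(* Let $G = SL(n+1)$ (over $\mathbb{C}$), and let $P$ and $Q$ be parabolic subgroups of $G$. Suppose that the double flag variety $X = G/P \times G/Q$ is spherical for the diagonal action of $G$, i.e. a Borel subgroup of $G$ has an open orbit in $X$. Then the set of $G$-orbit closures in $X$ (Zariski closures of the $G$-orbits), partially ordered by inclusion, is a lattice.
   Context: $G$ acts on $X=G/P\times G/Q$ diagonally: $g\cdot(xP,yQ)=(gxP,gyQ)$. A normal $G$-variety is called spherical if a Borel subgroup of $G$ has an open orbit in it. The variety $G/P\times G/Q$ has finitely many $G$-orbits when it is spherical. *)

theory Defs
  imports
    "HOL-Analysis.Determinants"
    "HOL-Analysis.Abstract_Topology"
    "HOL-Algebra.Group_Action"
    "HOL-Algebra.Left_Coset"
    "HOL-Algebra.Solvable_Groups"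
    "HOL-Algebra.Lattice"
begin

subsection \<open>The Zariski topology on an affine space\<close>

text \<open>An affine space is presented by its set \<open>C\<close> of coordinate functions; its polynomial functions
  are the \<open>\<complex>\<close>-algebra generated by \<open>C\<close>, and its closed sets are the common zero loci of
  arbitrary families of polynomial functions.\<close>

inductive_set poly_funs :: "('a \<Rightarrow> complex) set \<Rightarrow> ('a \<Rightarrow> complex) set"
  for C :: "('a \<Rightarrow> complex) set"
where
  coord: "f \<in> C \<Longrightarrow> f \<in> poly_funs C"
| const: "(\<lambda>_. c) \<in> poly_funs C"
| add: "f \<in> poly_funs C \<Longrightarrow> g \<in> poly_funs C \<Longrightarrow> (\<lambda>x. f x + g x) \<in> poly_funs C"
| mult: "f \<in> poly_funs C \<Longrightarrow> g \<in> poly_funs C \<Longrightarrow> (\<lambda>x. f x * g x) \<in> poly_funs C"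

definition zariski :: "('a \<Rightarrow> complex) set \<Rightarrow> 'a topology" where
  "zariski C = topology (\<lambda>U. \<exists>F \<subseteq> poly_funs C. U = - {x. \<forall>f\<in>F. f x = 0})"

lemma openin_zariski:
  "openin (zariski C) U \<longleftrightarrow> (\<exists>F \<subseteq> poly_funs C. U = - {x. \<forall>f\<in>F. f x = 0})"
proof -
  let ?D = "\<lambda>F. - {x. \<forall>f\<in>F. f x = 0}"
  let ?L = "\<lambda>U. \<exists>F \<subseteq> poly_funs C. U = ?D F"
  have "istopology ?L"
    unfolding istopology_def
  proof (intro conjI allI impI)
    fix S T
    assume "?L S" "?L T"
    then obtain F F' where F: "F \<subseteq> poly_funs C" "S = ?D F"
      and F': "F' \<subseteq> poly_funs C" "T = ?D F'" by (elim exE conjE)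
    let ?H = "(\<lambda>(f, g) x. f x * g x) ` (F \<times> F')"
    have "?H \<subseteq> poly_funs C"
      using F(1) F'(1) by (auto intro: poly_funs.mult)
    moreover have "S \<inter> T = ?D ?H"
      unfolding F(2) F'(2) by auto
    ultimately show "?L (S \<inter> T)"
      by (intro exI[of _ ?H] conjI)
  next
    fix K
    assume K: "\<forall>S\<in>K. ?L S"
    define F where "F = {f \<in> poly_funs C. \<forall>x. f x \<noteq> 0 \<longrightarrow> x \<in> \<Union>K}"
    have "x \<in> ?D F" if S: "S \<in> K" and x: "x \<in> S" for x S
    proof -
      from K S obtain F' where F': "F' \<subseteq> poly_funs C" "S = ?D F'" by (elim ballE exE conjE) auto
      from x F'(2) obtain f where f: "f \<in> F'" "f x \<noteq> 0" by auto
      have "y \<in> S" if "f y \<noteq> 0" for y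
        unfolding F'(2) using f(1) that by auto
      with S F'(1) f(1) have "f \<in> F"
        by (auto simp: F_def)
      with f(2) show ?thesis by auto
    qed
    then have "\<Union>K = ?D F"
      by (auto simp: F_def)
    moreover have "F \<subseteq> poly_funs C"
      by (auto simp: F_def)
    ultimately show "?L (\<Union>K)"
      by (intro exI[of _ F] conjI)
  qed
  then show ?thesis
    unfolding zariski_def by (subst topology_inverse') (assumption, rule refl)
qed

lemma topspace_zariski [simp]: "topspace (zariski C) = UNIV"
proof -
  have "openin (zariski C) UNIV"
    unfolding openin_zariski
    by (rule exI[of _ "{\<lambda>_. 1}"]) (auto intro: poly_funs.const)
  then show ?thesis
    by (rule openin_subset[THEN top.extremum_uniqueI])
qed

subsection \<open>The quotient topology\<close>

definition quotient_topology :: "'a topology \<Rightarrow> ('a \<Rightarrow> 'b) \<Rightarrow> 'b topology" where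
  "quotient_topology T q =
     topology (\<lambda>U. U \<subseteq> q ` topspace T \<and> openin T {x \<in> topspace T. q x \<in> U})"

lemma openin_quotient_topology:
  "openin (quotient_topology T q) U \<longleftrightarrow>
     U \<subseteq> q ` topspace T \<and> openin T {x \<in> topspace T. q x \<in> U}"
proof -
  let ?L = "\<lambda>U. U \<subseteq> q ` topspace T \<and> openin T {x \<in> topspace T. q x \<in> U}"
  have "istopology ?L"
    unfolding istopology_def
  proof (intro conjI[of "\<forall>S T. _ S T"] allI impI)
    fix S S'
    assume *: "?L S" "?L S'"
    have "{x \<in> topspace T. q x \<in> S \<inter> S'} =
        {x \<in> topspace T. q x \<in> S} \<inter> {x \<in> topspace T. q x \<in> S'}" by blast
    with * show "?L (S \<inter> S')"
      by (metis (no_types, lifting) le_infI1 openin_Int)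
  next
    fix K
    assume *: "\<forall>S\<in>K. ?L S"
    have "{x \<in> topspace T. q x \<in> \<Union>K} = (\<Union>S\<in>K. {x \<in> topspace T. q x \<in> S})" by blast
    moreover have "openin T (\<Union>S\<in>K. {x \<in> topspace T. q x \<in> S})"
      using * by (intro openin_Union) auto
    moreover have "\<Union>K \<subseteq> q ` topspace T"
      using * by (intro Union_least) auto
    ultimately show "?L (\<Union>K)" by (simp only: simp_thms)
  qed
  then show ?thesis
    unfolding quotient_topology_def by (subst topology_inverse') (assumption, rule refl)
qed

lemma topspace_quotient_topology [simp]: "topspace (quotient_topology T q) = q ` topspace T"
proof (rule subset_antisym)
  show "topspace (quotient_topology T q) \<subseteq> q ` topspace T"
    using openin_topspace[of "quotient_topology T q"] unfolding openin_quotient_topology by (rule conjunct1)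
  have "{x \<in> topspace T. q x \<in> q ` topspace T} = topspace T" by blast
  then have "openin (quotient_topology T q) (q ` topspace T)"
    unfolding openin_quotient_topology by simp
  then show "q ` topspace T \<subseteq> topspace (quotient_topology T q)"
    by (rule openin_subset)
qed

subsection \<open>The special linear group, Borel and parabolic subgroups\<close>

definition SL :: "(complex^'n^'n) monoid" where
  "SL = \<lparr>carrier = {A. det A = 1}, mult = (**), one = mat 1\<rparr>"

lemma group_SL: "group (SL :: (complex^'n^'n) monoid)"
proof (rule groupI)
  fix A :: "complex^'n^'n"
  assume "A \<in> carrier SL"
  then have "det A = 1" by (simp add: SL_def)
  then have "invertible A" by (simp add: invertible_det_nz)
  then obtain B where B: "B ** A = mat 1" by (auto simp: invertible_def)
  then have "det B * det A = 1" by (metis det_I det_mul)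
  with \<open>det A = 1\<close> B show "\<exists>B\<in>carrier SL. B \<otimes>\<^bsub>SL\<^esub> A = \<one>\<^bsub>SL\<^esub>"
    by (auto simp: SL_def)
qed (auto simp: SL_def det_mul matrix_mul_assoc)

definition mat_coords :: "(complex^'n^'n \<Rightarrow> complex) set" where
  "mat_coords = {(\<lambda>A. A $ i $ j) | i j. True}"

definition SL_topology :: "(complex^'n^'n) topology" where
  "SL_topology = subtopology (zariski mat_coords) (carrier SL)"

definition conn_solv_subgroup :: "(complex^'n^'n) set \<Rightarrow> bool" where
  "conn_solv_subgroup H \<longleftrightarrow>
     subgroup H SL \<and> closedin SL_topology H \<and> connectedin SL_topology H \<and>
     solvable (SL\<lparr>carrier := H\<rparr>)"

definition borel_subgroup :: "(complex^'n^'n) set \<Rightarrow> bool" where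
  "borel_subgroup B \<longleftrightarrow>
     conn_solv_subgroup B \<and> (\<forall>H. conn_solv_subgroup H \<longrightarrow> B \<subseteq> H \<longrightarrow> H = B)"

definition parabolic_subgroup :: "(complex^'n^'n) set \<Rightarrow> bool" where
  "parabolic_subgroup P \<longleftrightarrow>
     subgroup P SL \<and> closedin SL_topology P \<and> (\<exists>B. borel_subgroup B \<and> B \<subseteq> P)"

subsection \<open>The double flag variety\<close>

definition mat_pair_coords :: "((complex^'n^'n) \<times> (complex^'n^'n) \<Rightarrow> complex) set" where
  "mat_pair_coords = (\<lambda>f. f \<circ> fst) ` mat_coords \<union> (\<lambda>f. f \<circ> snd) ` mat_coords"

text \<open>The Zariski topology of the variety \<open>G/P \<times> G/Q = (G \<times> G)/(P \<times> Q)\<close> is the quotient of the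
  Zariski topology of \<open>G \<times> G\<close>: the quotient of an algebraic group by a closed subgroup is a
  geometric quotient. (It is not the product of the Zariski topologies of the factors.)\<close>

definition double_flag_topology ::
    "(complex^'n^'n) set \<Rightarrow> (complex^'n^'n) set
      \<Rightarrow> ((complex^'n^'n) set \<times> (complex^'n^'n) set) topology" where
  "double_flag_topology P Q =
     quotient_topology (subtopology (zariski mat_pair_coords) (carrier SL \<times> carrier SL))
       (\<lambda>(x, y). (l_coset SL x P, l_coset SL y Q))"

definition double_flag ::
    "(complex^'n^'n) set \<Rightarrow> (complex^'n^'n) set
      \<Rightarrow> ((complex^'n^'n) set \<times> (complex^'n^'n) set) set" where
  "double_flag P Q = (lcosets\<^bsub>SL\<^esub> P) \<times> (lcosets\<^bsub>SL\<^esub> Q)"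

lemma topspace_double_flag_topology: "topspace (double_flag_topology P Q) = double_flag P Q"
  by (auto simp: double_flag_topology_def double_flag_def LCOSETS_def)

definition diag_act ::
    "complex^'n^'n \<Rightarrow> (complex^'n^'n) set \<times> (complex^'n^'n) set
      \<Rightarrow> (complex^'n^'n) set \<times> (complex^'n^'n) set" where
  "diag_act g = (\<lambda>(S, T). (l_coset SL g S, l_coset SL g T))"

lemma diag_act_cosets:
  "diag_act g (l_coset SL x P, l_coset SL y Q) =
     (l_coset SL (g \<otimes>\<^bsub>SL\<^esub> x) P, l_coset SL (g \<otimes>\<^bsub>SL\<^esub> y) Q)"
  by (auto simp: diag_act_def l_coset_def SL_def matrix_mul_assoc)

text \<open>Normality, which is part of the notion of a spherical variety, is not listed: homogeneous
  varieties are smooth, so \<open>G/P \<times> G/Q\<close> is always normal.\<close>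

definition spherical_double_flag :: "(complex^'n^'n) set \<Rightarrow> (complex^'n^'n) set \<Rightarrow> bool" where
  "spherical_double_flag P Q \<longleftrightarrow>
     (\<exists>B. borel_subgroup B \<and>
       (\<exists>Y\<in>orbits (SL\<lparr>carrier := B\<rparr>) (double_flag P Q) diag_act.
          openin (double_flag_topology P Q) Y))"

definition orbit_closures ::
    "(complex^'n^'n) set \<Rightarrow> (complex^'n^'n) set
      \<Rightarrow> ((complex^'n^'n) set \<times> (complex^'n^'n) set) set set" where
  "orbit_closures P Q =
     Abstract_Topology.closure_of (double_flag_topology P Q) ` orbits SL (double_flag P Q) diag_act"

end

theory Submission
  imports Defs "HOL-Computational_Algebra.Fundamental_Theorem_Algebra"
begin

text \<open>By the Lie--Kolchin theorem the Borel subgroups are the stabilizers of full flags, and by the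
  Bruhat decomposition a parabolic subgroup is the stabilizer of a partial flag. If both partial
  flags have at least two proper steps, then no Borel subgroup has an open orbit: once a generic
  first flag is fixed, the remaining group consists of block diagonal upper triangular matrices, and
  two products of two minors of the second flag have the same weight under it without being
  proportional. The two factors may be exchanged, so it suffices to treat the case where the middle
  step of the first flag is the wider one.

  Hence one of the subgroups, say \<open>P\<close>, stabilizes a single subspace \<open>A\<close>. The orbit of \<open>(xP, yQ)\<close> is
  then determined by the dimensions \<open>d j\<close> of the intersections of \<open>xA\<close> with the steps of the flag of
  \<open>yQ\<close>, its closure consists of the orbits with \<open>d' \<ge> d\<close>, and the possible \<open>d\<close> are the restrictions
  of the functions with increments 0 or 1 and prescribed end points. These are closed under
  pointwise minimum and maximum, which gives the lattice operations.\<close>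

section \<open>Irreducible and connected sets\<close>

definition irreduciblein :: "'a topology \<Rightarrow> 'a set \<Rightarrow> bool" where
  "irreduciblein T S \<longleftrightarrow> S \<subseteq> topspace T \<and>
     (\<forall>U V. openin T U \<longrightarrow> openin T V \<longrightarrow> S \<inter> U \<noteq> {} \<longrightarrow> S \<inter> V \<noteq> {} \<longrightarrow> S \<inter> U \<inter> V \<noteq> {})"

lemma irreduciblein_imp_connectedin: "irreduciblein T S \<Longrightarrow> connectedin T S"
  unfolding irreduciblein_def connectedin by (metis inf.commute inf_assoc)

lemma connectedin_finite_valued_constant:
  assumes "connectedin T H" and "finite (c ` H)"
    and closed_fibre: "\<And>z. closedin (subtopology T H) {h\<in>H. c h = z}"
    and "x \<in> H" "y \<in> H"
  shows "c x = c y"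
proof -
  let ?T = "subtopology T H"
  have top: "topspace ?T = H" and conn: "connected_space ?T"
    using assms(1) by (auto simp: connectedin_def)
  have "closedin ?T (\<Union>z\<in>c ` H - {c x}. {h\<in>H. c h = z})"
    using assms(2) closed_fibre by (intro closedin_Union) auto
  moreover have "(\<Union>z\<in>c ` H - {c x}. {h\<in>H. c h = z}) = H - {h\<in>H. c h = c x}" by auto
  ultimately have "openin ?T {h\<in>H. c h = c x}"
    by (subst openin_closedin) (simp_all only: top, blast)
  then have "{h\<in>H. c h = c x} = H"
    using conn closed_fibre[of "c x"] \<open>x \<in> H\<close> unfolding connected_space_clopen_in top by blast
  then have "y \<in> {h\<in>H. c h = c x}" using \<open>y \<in> H\<close> by (simp only:)
  then show ?thesis by simp
qed

section \<open>Polynomial functions and the Zariski topology\<close>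

lemma poly_funs_cmult: "f \<in> poly_funs C \<Longrightarrow> (\<lambda>x. c * f x) \<in> poly_funs C"
  using poly_funs.mult[OF poly_funs.const[of c]] .

lemma poly_funs_diff:
  assumes "f \<in> poly_funs C" "g \<in> poly_funs C"
  shows "(\<lambda>x. f x - g x) \<in> poly_funs C"
  using poly_funs.add[OF assms(1) poly_funs_cmult[OF assms(2), of "-1"]] by simp

lemma poly_funs_sum:
  "(\<And>i. i \<in> I \<Longrightarrow> f i \<in> poly_funs C) \<Longrightarrow> (\<lambda>x. \<Sum>i\<in>I. f i x) \<in> poly_funs C"
  by (induction I rule: infinite_finite_induct) (auto intro: poly_funs.const poly_funs.add)

lemma poly_funs_prod:
  "(\<And>i. i \<in> I \<Longrightarrow> f i \<in> poly_funs C) \<Longrightarrow> (\<lambda>x. \<Prod>i\<in>I. f i x) \<in> poly_funs C"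
  by (induction I rule: infinite_finite_induct) (auto intro: poly_funs.const poly_funs.mult)

lemma poly_funs_det:
  fixes M :: "'a \<Rightarrow> complex^'n^'n"
  assumes "\<And>i j. (\<lambda>x. M x $ i $ j) \<in> poly_funs C"
  shows "(\<lambda>x. det (M x)) \<in> poly_funs C"
  unfolding det_def
  by (intro poly_funs_sum poly_funs.mult poly_funs.const poly_funs_prod assms)

lemma poly_funs_matrix_mult:
  fixes M :: "'a \<Rightarrow> complex^'k^'m" and N :: "'a \<Rightarrow> complex^'n^'k"
  assumes "\<And>i j. (\<lambda>x. M x $ i $ j) \<in> poly_funs C" "\<And>i j. (\<lambda>x. N x $ i $ j) \<in> poly_funs C"
  shows "(\<lambda>x. (M x ** N x) $ i $ j) \<in> poly_funs C"
  unfolding matrix_matrix_mult_def using assms by (auto intro!: poly_funs_sum poly_funs.mult)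

lemma poly_funs_matrix_vector_mult:
  fixes M :: "'a \<Rightarrow> complex^'n^'m"
  assumes "\<And>i j. (\<lambda>x. M x $ i $ j) \<in> poly_funs C" "\<And>j. (\<lambda>x. v x $ j) \<in> poly_funs C"
  shows "(\<lambda>x. (M x *v v x) $ i) \<in> poly_funs C"
  unfolding matrix_vector_mult_def using assms by (auto intro!: poly_funs_sum poly_funs.mult)

lemma poly_funs_compose_on:
  assumes "f \<in> poly_funs C" and "\<And>c. c \<in> C \<Longrightarrow> \<exists>g\<in>poly_funs D. \<forall>x\<in>S. c (\<phi> x) = g x"
  shows "\<exists>g\<in>poly_funs D. \<forall>x\<in>S. f (\<phi> x) = g x"
  using assms(1)
proof induction
  case (const c)
  show ?case by (rule bexI[OF _ poly_funs.const[of c]]) auto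
next
  case (add f g)
  then obtain f' g' where "f' \<in> poly_funs D" "g' \<in> poly_funs D"
    "\<forall>x\<in>S. f (\<phi> x) = f' x" "\<forall>x\<in>S. g (\<phi> x) = g' x" by blast
  then show ?case by (intro bexI[OF _ poly_funs.add[of f' _ g']]) auto
next
  case (mult f g)
  then obtain f' g' where "f' \<in> poly_funs D" "g' \<in> poly_funs D"
    "\<forall>x\<in>S. f (\<phi> x) = f' x" "\<forall>x\<in>S. g (\<phi> x) = g' x" by blast
  then show ?case by (intro bexI[OF _ poly_funs.mult[of f' _ g']]) auto
qed (use assms(2) in blast)

lemma openin_subtopology_zariski:
  "openin (subtopology (zariski C) S) U \<longleftrightarrow>
     U \<subseteq> S \<and> (\<forall>x\<in>U. \<exists>f\<in>poly_funs C. f x \<noteq> 0 \<and> {y\<in>S. f y \<noteq> 0} \<subseteq> U)"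
proof
  assume "openin (subtopology (zariski C) S) U"
  then obtain F where "F \<subseteq> poly_funs C" "U = - {x. \<forall>f\<in>F. f x = 0} \<inter> S"
    by (auto simp: openin_subtopology openin_zariski)
  then show "U \<subseteq> S \<and> (\<forall>x\<in>U. \<exists>f\<in>poly_funs C. f x \<noteq> 0 \<and> {y\<in>S. f y \<noteq> 0} \<subseteq> U)"
    by auto
next
  assume nbhd: "U \<subseteq> S \<and> (\<forall>x\<in>U. \<exists>f\<in>poly_funs C. f x \<noteq> 0 \<and> {y\<in>S. f y \<noteq> 0} \<subseteq> U)"
  define F where "F = {f\<in>poly_funs C. {y\<in>S. f y \<noteq> 0} \<subseteq> U}"
  have "U = - {x. \<forall>f\<in>F. f x = 0} \<inter> S"
    using nbhd by (auto simp: F_def)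
  moreover have "F \<subseteq> poly_funs C" by (auto simp: F_def)
  ultimately show "openin (subtopology (zariski C) S) U"
    unfolding openin_subtopology openin_zariski by blast
qed

lemma closedin_subtopology_zariski_zeros:
  assumes "F \<subseteq> poly_funs C"
  shows "closedin (subtopology (zariski C) S) {x\<in>S. \<forall>f\<in>F. f x = 0}"
  unfolding closedin_def openin_subtopology_zariski using assms by auto

lemma continuous_map_zariski:
  assumes "\<phi> \<in> S \<rightarrow> T" and "\<And>c. c \<in> C \<Longrightarrow> \<exists>g\<in>poly_funs D. \<forall>x\<in>S. c (\<phi> x) = g x"
  shows "continuous_map (subtopology (zariski D) S) (subtopology (zariski C) T) \<phi>"
  unfolding continuous_map_def
proof (intro conjI allI impI)
  show "\<phi> \<in> topspace (subtopology (zariski D) S) \<rightarrow> topspace (subtopology (zariski C) T)"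
    using assms(1) by auto
next
  fix U assume U: "openin (subtopology (zariski C) T) U"
  have "\<exists>f\<in>poly_funs D. f x \<noteq> 0 \<and> {y\<in>S. f y \<noteq> 0} \<subseteq> {x\<in>S. \<phi> x \<in> U}" if x: "x \<in> S" "\<phi> x \<in> U" for x
  proof -
    from U x(2) obtain f where f: "f \<in> poly_funs C" "f (\<phi> x) \<noteq> 0" "{y\<in>T. f y \<noteq> 0} \<subseteq> U"
      unfolding openin_subtopology_zariski by blast
    obtain g where "g \<in> poly_funs D" "\<forall>x\<in>S. f (\<phi> x) = g x"
      using poly_funs_compose_on[OF f(1), of D S \<phi>] assms(2) by blast
    then show ?thesis using f x assms(1) by (intro bexI[of _ g]) auto
  qed
  then show "openin (subtopology (zariski D) S) {x \<in> topspace (subtopology (zariski D) S). \<phi> x \<in> U}"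
    unfolding openin_subtopology_zariski by simp
qed

lemma irreduciblein_zariskiI:
  assumes "H \<subseteq> S"
    and common_nonzero: "\<And>f g x y. f \<in> poly_funs C \<Longrightarrow> g \<in> poly_funs C \<Longrightarrow> x \<in> H \<Longrightarrow> y \<in> H
      \<Longrightarrow> f x \<noteq> 0 \<Longrightarrow> g y \<noteq> 0 \<Longrightarrow> \<exists>z\<in>H. f z \<noteq> 0 \<and> g z \<noteq> 0"
  shows "irreduciblein (subtopology (zariski C) S) H"
  unfolding irreduciblein_def openin_subtopology_zariski
proof (intro conjI allI impI)
  fix U V
  assume U: "U \<subseteq> S \<and> (\<forall>x\<in>U. \<exists>f\<in>poly_funs C. f x \<noteq> 0 \<and> {y \<in> S. f y \<noteq> 0} \<subseteq> U)" "H \<inter> U \<noteq> {}"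
    and V: "V \<subseteq> S \<and> (\<forall>x\<in>V. \<exists>f\<in>poly_funs C. f x \<noteq> 0 \<and> {y \<in> S. f y \<noteq> 0} \<subseteq> V)" "H \<inter> V \<noteq> {}"
  from U(2) V(2) obtain x y where xy: "x \<in> H" "x \<in> U" "y \<in> H" "y \<in> V" by blast
  from U(1) xy(2) obtain f where f: "f \<in> poly_funs C" "f x \<noteq> 0" "{z\<in>S. f z \<noteq> 0} \<subseteq> U" by blast
  from V(1) xy(4) obtain g where g: "g \<in> poly_funs C" "g y \<noteq> 0" "{z\<in>S. g z \<noteq> 0} \<subseteq> V" by blast
  obtain z where "z \<in> H" "f z \<noteq> 0" "g z \<noteq> 0"
    using common_nonzero[OF f(1) g(1) xy(1,3) f(2) g(2)] by blast
  then show "H \<inter> U \<inter> V \<noteq> {}" using f(3) g(3) assms(1) by auto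
qed (use assms(1) in simp)

lemma poly_fun_eq_0_of_open:
  assumes irr: "irreduciblein (subtopology (zariski C) S) S" and h: "h \<in> poly_funs C"
    and U: "openin (subtopology (zariski C) S) U" "U \<noteq> {}" "\<And>x. x \<in> U \<Longrightarrow> h x = 0"
    and y: "y \<in> S"
  shows "h y = 0"
proof (rule ccontr)
  assume "h y \<noteq> 0"
  have "openin (subtopology (zariski C) S) {x\<in>S. h x \<noteq> 0}"
    unfolding openin_subtopology_zariski using h by auto
  moreover have "S \<inter> U \<noteq> {}" "S \<inter> {x\<in>S. h x \<noteq> 0} \<noteq> {}"
    using openin_subset[OF U(1)] U(2) y \<open>h y \<noteq> 0\<close> by auto
  ultimately have "S \<inter> U \<inter> {x\<in>S. h x \<noteq> 0} \<noteq> {}" using irr U(1) unfolding irreduciblein_def by metis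
  then show False using U(3) by blast
qed

lemma proportional_of_proportional_on_open:
  assumes irr: "irreduciblein (subtopology (zariski C) S) S"
    and U: "openin (subtopology (zariski C) S) U" "U \<noteq> {}"
    and fg: "f \<in> poly_funs C" "g \<in> poly_funs C"
    and proportional: "\<And>x y. x \<in> U \<Longrightarrow> y \<in> U \<Longrightarrow> f x * g y = f y * g x"
    and xy: "x \<in> S" "y \<in> S"
  shows "f x * g y = f y * g x"
proof -
  have poly: "(\<lambda>v. f u * g v - f v * g u) \<in> poly_funs C" for u
    by (intro poly_funs_diff poly_funs.mult poly_funs.const fg)
  have "f u * g v - f v * g u = 0" if "u \<in> U" "v \<in> S" for u v
    by (rule poly_fun_eq_0_of_open[OF irr poly U _ that(2)]) (simp add: proportional[OF that(1)])
  then have "f y * g u - f u * g y = 0" if "u \<in> U" for u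
    using that xy(2) by (metis eq_iff_diff_eq_0)
  then have "f y * g x - f x * g y = 0" by (rule poly_fun_eq_0_of_open[OF irr poly U _ xy(1)])
  then show ?thesis by simp
qed

section \<open>Polynomial and rational curves\<close>

definition rational_curve :: "('a \<Rightarrow> complex) set \<Rightarrow> complex poly \<Rightarrow> (complex \<Rightarrow> 'a) \<Rightarrow> bool" where
  "rational_curve C d \<phi> \<longleftrightarrow>
     (\<forall>c\<in>C. \<exists>p k. \<forall>t. poly d t \<noteq> 0 \<longrightarrow> c (\<phi> t) * poly d t ^ k = poly p t)"

definition polynomial_curve :: "('a \<Rightarrow> complex) set \<Rightarrow> (complex \<Rightarrow> 'a) \<Rightarrow> bool" where
  "polynomial_curve C \<phi> \<longleftrightarrow> (\<forall>c\<in>C. \<exists>p. \<forall>t. c (\<phi> t) = poly p t)"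

lemma poly_funs_rational_curve:
  assumes "f \<in> poly_funs C" and "rational_curve C d \<phi>"
  shows "\<exists>p k. \<forall>t. poly d t \<noteq> 0 \<longrightarrow> f (\<phi> t) * poly d t ^ k = poly p t"
  using assms(1)
proof induction
  case (const c)
  show ?case by (rule exI[of _ "[:c:]"], rule exI[of _ 0]) simp
next
  case (add f g)
  then obtain p k q l where p: "\<forall>t. poly d t \<noteq> 0 \<longrightarrow> f (\<phi> t) * poly d t ^ k = poly p t"
    and q: "\<forall>t. poly d t \<noteq> 0 \<longrightarrow> g (\<phi> t) * poly d t ^ l = poly q t" by blast
  have "(f (\<phi> t) + g (\<phi> t)) * poly d t ^ (k + l) = poly (p * d ^ l + q * d ^ k) t"
    if "poly d t \<noteq> 0" for t
    using p[rule_format, OF that] q[rule_format, OF that]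
    by (simp add: algebra_simps power_add flip: p q)
  then show ?case by blast
next
  case (mult f g)
  then obtain p k q l where p: "\<forall>t. poly d t \<noteq> 0 \<longrightarrow> f (\<phi> t) * poly d t ^ k = poly p t"
    and q: "\<forall>t. poly d t \<noteq> 0 \<longrightarrow> g (\<phi> t) * poly d t ^ l = poly q t" by blast
  have "(f (\<phi> t) * g (\<phi> t)) * poly d t ^ (k + l) = poly (p * q) t"
    if "poly d t \<noteq> 0" for t
    using p[rule_format, OF that] q[rule_format, OF that]
    by (simp add: algebra_simps power_add flip: p q)
  then show ?case by blast
qed (use assms(2) in \<open>auto simp: rational_curve_def\<close>)

lemma poly_funs_polynomial_curve:
  assumes "f \<in> poly_funs C" and "polynomial_curve C \<phi>"
  shows "\<exists>p. \<forall>t. f (\<phi> t) = poly p t"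
proof -
  have "rational_curve C 1 \<phi>" using assms(2) by (simp add: rational_curve_def polynomial_curve_def)
  from poly_funs_rational_curve[OF assms(1) this] show ?thesis by simp
qed

lemma rational_curve_common_nonzero:
  assumes fg: "f \<in> poly_funs C" "g \<in> poly_funs C" and curve: "rational_curve C d \<phi>"
    and nz: "poly d s \<noteq> 0" "poly d t \<noteq> 0" "f (\<phi> s) \<noteq> 0" "g (\<phi> t) \<noteq> 0"
  shows "\<exists>u. poly d u \<noteq> 0 \<and> f (\<phi> u) \<noteq> 0 \<and> g (\<phi> u) \<noteq> 0"
proof -
  obtain p k where p: "\<forall>t. poly d t \<noteq> 0 \<longrightarrow> f (\<phi> t) * poly d t ^ k = poly p t"
    using poly_funs_rational_curve[OF fg(1) curve] by blast
  obtain q l where q: "\<forall>t. poly d t \<noteq> 0 \<longrightarrow> g (\<phi> t) * poly d t ^ l = poly q t"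
    using poly_funs_rational_curve[OF fg(2) curve] by blast
  have "poly p s \<noteq> 0" "poly q t \<noteq> 0" using p q nz by (metis mult_eq_0_iff power_eq_0_iff)+
  then have "d * p * q \<noteq> 0" using nz by auto
  then have "finite {u. poly (d * p * q) u = 0}" by (rule poly_roots_finite)
  then obtain u where "u \<notin> {u. poly (d * p * q) u = 0}"
    using ex_new_if_finite[OF infinite_UNIV_char_0] by blast
  then have u: "poly d u \<noteq> 0" "poly p u \<noteq> 0" "poly q u \<noteq> 0" by auto
  then have "f (\<phi> u) \<noteq> 0" "g (\<phi> u) \<noteq> 0" using p q by (metis mult_zero_left)+
  with u show ?thesis by blast
qed

lemma polynomial_curve_in_closure_of:
  assumes curve: "polynomial_curve C \<phi>" and S: "\<And>t. \<phi> t \<in> S"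
    and A: "\<And>t. t \<noteq> 0 \<Longrightarrow> \<phi> t \<in> A"
  shows "\<phi> 0 \<in> subtopology (zariski C) S closure_of A"
  unfolding in_closure_of
proof (intro conjI allI impI)
  show "\<phi> 0 \<in> topspace (subtopology (zariski C) S)" using S by simp
  fix U assume "\<phi> 0 \<in> U \<and> openin (subtopology (zariski C) S) U"
  then obtain f where f: "f \<in> poly_funs C" "f (\<phi> 0) \<noteq> 0" "{y\<in>S. f y \<noteq> 0} \<subseteq> U"
    unfolding openin_subtopology_zariski by blast
  obtain p where p: "\<And>t. f (\<phi> t) = poly p t"
    using poly_funs_polynomial_curve[OF f(1) curve] by blast
  have "p \<noteq> 0" using f(2) p by auto
  then have "finite (insert 0 {t. poly p t = 0})" by (simp add: poly_roots_finite)
  then obtain t where "t \<notin> insert 0 {t. poly p t = 0}"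
    using ex_new_if_finite[OF infinite_UNIV_char_0] by blast
  then have "\<phi> t \<in> A" "\<phi> t \<in> U" using A[of t] S[of t] f(3) by (auto simp: p)
  then show "\<exists>y. y \<in> A \<and> y \<in> U" by blast
qed

definition polynomial_matrix :: "('a::comm_ring_1 \<Rightarrow> 'a^'n^'m) \<Rightarrow> bool" where
  "polynomial_matrix M \<longleftrightarrow> (\<forall>i j. \<exists>p. \<forall>t. M t $ i $ j = poly p t)"

lemma polynomial_matrixE:
  fixes M :: "'a::comm_ring_1 \<Rightarrow> 'a^'n^'m"
  assumes "polynomial_matrix M"
  obtains p :: "'m \<Rightarrow> 'n \<Rightarrow> 'a poly" where "\<And>t i j. M t $ i $ j = poly (p i j) t"
  using assms unfolding polynomial_matrix_def by metis

lemma polynomial_matrix_const: "polynomial_matrix (\<lambda>t. A)"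
  unfolding polynomial_matrix_def by (intro allI exI[of _ "[:_:]"]) simp

lemma polynomial_matrix_mult:
  assumes "polynomial_matrix M" "polynomial_matrix N"
  shows "polynomial_matrix (\<lambda>t. M t ** N t)"
proof -
  obtain p where p: "\<And>t i j. M t $ i $ j = poly (p i j) t"
    using assms(1) by (rule polynomial_matrixE) blast
  obtain q where q: "\<And>t i j. N t $ i $ j = poly (q i j) t"
    using assms(2) by (rule polynomial_matrixE) blast
  have "(M t ** N t) $ i $ j = poly (\<Sum>k\<in>UNIV. p i k * q k j) t" for t i j
    by (simp add: matrix_matrix_mult_def p q poly_sum)
  then show ?thesis unfolding polynomial_matrix_def by blast
qed

lemma polynomial_matrix_det:
  fixes M :: "'a::comm_ring_1 \<Rightarrow> 'a^'n^'n"
  assumes "polynomial_matrix M"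
  obtains p where "\<And>t. det (M t) = poly p t"
proof -
  obtain p where p: "\<And>t i j. M t $ i $ j = poly (p i j) t"
    using assms by (rule polynomial_matrixE) blast
  have "det (M t) = poly (\<Sum>\<pi> | \<pi> permutes UNIV. of_int (sign \<pi>) * (\<Prod>i\<in>UNIV. p i (\<pi> i))) t" for t
    by (simp add: det_def p poly_sum poly_prod)
  then show ?thesis by (rule that)
qed

section \<open>Square matrices over a field\<close>

lemma matrix_inv_mult [simp]:
  fixes A :: "'a::field^'n^'n"
  assumes "det A \<noteq> 0"
  shows "A ** matrix_inv A = mat 1" "matrix_inv A ** A = mat 1"
proof -
  have "\<exists>B. A ** B = mat 1 \<and> B ** A = mat 1"
    using assms invertible_det_nz[of A] by (simp add: invertible_def)
  then have "A ** matrix_inv A = mat 1 \<and> matrix_inv A ** A = mat 1"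
    unfolding matrix_inv_def by (rule someI_ex)
  then show "A ** matrix_inv A = mat 1" "matrix_inv A ** A = mat 1" by simp_all
qed

lemma matrix_inv_cancel [simp]:
  fixes A :: "'a::field^'n^'n"
  assumes "det A \<noteq> 0"
  shows "A ** (matrix_inv A ** B) = B" "matrix_inv A ** (A ** B) = B"
    "A *v (matrix_inv A *v v) = v" "matrix_inv A *v (A *v v) = v"
  using assms by (simp_all add: matrix_mul_assoc matrix_vector_mul_assoc)

lemma det_matrix_inv [simp]:
  fixes A :: "'a::field^'n^'n"
  assumes "det A \<noteq> 0"
  shows "det (matrix_inv A) = inverse (det A)"
proof -
  have "det A * det (matrix_inv A) = 1" using assms by (simp flip: det_mul)
  then show ?thesis by (simp add: inverse_unique)
qed

lemma matrix_inv_unique: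
  fixes A B :: "'a::field^'n^'n"
  assumes "A ** B = mat 1"
  shows "matrix_inv A = B"
proof -
  have "det A * det B = 1" by (simp flip: det_mul add: assms)
  then have "det A \<noteq> 0" by auto
  then show ?thesis using matrix_inv_cancel(2)[of A B] assms by simp
qed

lemma matrix_inv_mat_1 [simp]: "matrix_inv (mat 1 :: 'a::field^'n^'n) = mat 1"
  by (rule matrix_inv_unique) simp

lemma matrix_inv_matrix_inv [simp]: "det A \<noteq> 0 \<Longrightarrow> matrix_inv (matrix_inv A) = (A :: 'a::field^'n^'n)"
  by (rule matrix_inv_unique) simp

lemmas matrix_mul_rassoc = matrix_mul_assoc[symmetric]

lemma matrix_image_mult: "(*v) (A ** B) ` S = (*v) A ` (*v) B ` S"
  for A :: "'a::comm_semiring_1^'n^'m" and B :: "'a^'k^'n"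
  by (simp add: image_image flip: matrix_vector_mul_assoc)

lemma matrix_inv_image_cancel [simp]:
  fixes A :: "'a::field^'n^'n"
  assumes "det A \<noteq> 0"
  shows "(*v) A ` (*v) (matrix_inv A) ` S = S" "(*v) (matrix_inv A) ` (*v) A ` S = S"
  using assms by (simp_all add: image_image)

lemma axis_nth_if: "axis k x $ i = (if i = k then x else 0)"
  by (simp add: axis_def)

lemma matrix_vector_mult_axis:
  fixes A :: "'a::comm_semiring_1^'n^'m"
  shows "(A *v axis j c) $ i = A $ i $ j * c"
  by (simp add: matrix_vector_mult_def axis_nth_if if_distrib[of "(*) _"] cong: if_cong)

lemma matrix_eq_axisI:
  fixes A B :: "'a::comm_semiring_1^'n^'m"
  assumes "\<And>j. A *v axis j 1 = B *v axis j 1"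
  shows "A = B"
proof -
  have "A $ i $ j = B $ i $ j" for i j
    using arg_cong[OF assms[of j], of "\<lambda>v. v $ i"] by (simp add: matrix_vector_mult_axis)
  then show ?thesis by (simp add: vec_eq_iff)
qed

lemma mat_matrix_mult_nth [simp]: "(mat c ** A) $ i $ j = c * A $ i $ j"
  for A :: "'a::comm_semiring_1^'n^'m"
  by (simp add: matrix_matrix_mult_def mat_def if_distrib[of "\<lambda>x. x * _"] cong: if_cong)

lemma mat_matrix_vector_mult [simp]: "mat c *v v = c *s v" for v :: "'a::comm_semiring_1^'n"
  by (simp add: vec_eq_iff matrix_vector_mult_def mat_def if_distrib[of "\<lambda>x. x * _"] cong: if_cong)

lemma det_eq_0_iff_kernel:
  fixes A :: "'a::field^'n^'n"
  shows "det A = 0 \<longleftrightarrow> (\<exists>v. v \<noteq> 0 \<and> A *v v = 0)"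
  using invertible_det_nz[of A] by (auto simp: invertible_left_inverse matrix_left_invertible_ker)

lemma dim_matrix_image [simp]:
  fixes A :: "'a::field^'n^'n"
  assumes "det A \<noteq> 0"
  shows "vec.dim ((*v) A ` S) = vec.dim S"
proof -
  have "inj ((*v) A)" using assms by (simp add: inj_matrix_vector_mult invertible_det_nz)
  then have "inj_on ((*v) A) (vec.span S)" by (rule inj_on_subset) simp
  then show ?thesis by (rule vec.dim_image_eq[OF matrix_vector_mul_linear_gen])
qed

lemma subspace_matrix_image [simp]: "vec.subspace S \<Longrightarrow> vec.subspace ((*v) A ` S)"
  for A :: "'a::field^'n^'m"
  by (rule vec.subspace_image)

lemma matrix_image_Int:
  fixes A :: "'a::field^'n^'n"
  assumes "det A \<noteq> 0"
  shows "(*v) A ` (S \<inter> T) = (*v) A ` S \<inter> (*v) A ` T"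
  using assms by (intro image_Int inj_matrix_vector_mult) (simp add: invertible_det_nz)

lemma matrix_image_eq_of_subset:
  fixes A :: "'a::field^'n^'n"
  assumes "det A \<noteq> 0" "vec.subspace S" "vec.subspace T" "vec.dim S = vec.dim T" "(*v) A ` S \<subseteq> T"
  shows "(*v) A ` S = T"
  using assms vec.subspace_dim_equal[of "(*v) A ` S" T] by simp

lemma matrix_image_UNIV [simp]:
  fixes A :: "'a::field^'n^'n"
  assumes "det A \<noteq> 0"
  shows "range ((*v) A) = UNIV"
  using assms by (intro matrix_image_eq_of_subset) auto

definition scale_column :: "'n \<Rightarrow> 'a \<Rightarrow> 'a::comm_ring_1^'n^'m \<Rightarrow> 'a^'n^'m" where
  "scale_column k c A = (\<chi> i j. if j = k then c * A $ i $ j else A $ i $ j)"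

lemma scale_column_nth [simp]:
  "scale_column k c A $ i $ j = (if j = k then c * A $ i $ j else A $ i $ j)"
  by (simp add: scale_column_def)

lemma scale_column_eq_mult: "scale_column k c A = A ** scale_column k c (mat 1)"
  by (simp add: vec_eq_iff matrix_matrix_mult_def mat_def if_distrib[of "(*) _"] cong: if_cong)

lemma scale_column_1 [simp]: "scale_column k 1 A = A"
  by (simp add: vec_eq_iff)

lemma det_scale_column [simp]: "det (scale_column k c A) = c * det A"
proof -
  have "det (scale_column k c (mat 1 :: 'a^'b^'b)) = c"
    by (subst det_diagonal) (auto simp: mat_def cong: if_cong)
  then show ?thesis by (subst scale_column_eq_mult) (simp add: det_mul)
qed

lemma scale_column_mult_axis:
  fixes A :: "'a::comm_ring_1^'n^'m"
  shows "scale_column k c A *v axis j 1 = (if j = k then c else 1) *s (A *v axis j 1)"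
  by (simp add: vec_eq_iff matrix_vector_mult_axis)

definition adjugate :: "'a::comm_ring_1^'n^'n \<Rightarrow> 'a^'n^'n" where
  "adjugate A = (\<chi> i j. det (\<chi> r s. if s = i then axis j 1 $ r else A $ r $ s))"

lemma matrix_inv_eq_adjugate:
  fixes A :: "'a::field^'n^'n"
  assumes "det A \<noteq> 0"
  shows "matrix_inv A $ i $ j = adjugate A $ i $ j / det A"
proof -
  have "A *v (matrix_inv A *v axis j 1) = axis j 1" using assms by simp
  then have "matrix_inv A *v axis j 1
    = (\<chi> k. det (\<chi> r s. if s = k then axis j 1 $ r else A $ r $ s) / det A)"
    by (subst (asm) cramer) (use assms in auto)
  then have "(matrix_inv A *v axis j 1) $ i = adjugate A $ i $ j / det A"
    by (simp add: adjugate_def)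
  then show ?thesis by (simp add: matrix_vector_mult_axis)
qed

lemma polynomial_matrix_line:
  fixes x y :: "'a::comm_ring_1^'n^'m"
  shows "polynomial_matrix (\<lambda>t. x + mat t ** y)"
proof -
  have "(x + mat t ** y) $ i $ j = poly [:x $ i $ j, y $ i $ j:] t" for t i j by simp
  then show ?thesis unfolding polynomial_matrix_def by blast
qed

section \<open>The Zariski topology on the special linear group\<close>

lemma carrier_SL [simp]: "A \<in> carrier SL \<longleftrightarrow> det A = 1"
  and mult_SL [simp]: "A \<otimes>\<^bsub>SL\<^esub> B = A ** B"
  and one_SL [simp]: "\<one>\<^bsub>SL\<^esub> = mat 1"
  by (simp_all add: SL_def)

interpretation SL: group SL by (rule group_SL)

lemma inv_SL [simp]:
  assumes "det A = 1"
  shows "inv\<^bsub>SL\<^esub> A = matrix_inv A"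
proof -
  have "A ** inv\<^bsub>SL\<^esub> A = mat 1" using SL.r_inv[of A] assms by simp
  then show ?thesis by (rule matrix_inv_unique[symmetric])
qed

lemma topspace_SL_topology [simp]: "topspace SL_topology = carrier SL"
  by (simp add: SL_topology_def)

lemma poly_funs_mat_coord: "(\<lambda>A. A $ i $ j) \<in> poly_funs mat_coords"
  by (rule poly_funs.coord) (auto simp: mat_coords_def)

lemma poly_funs_adjugate: "(\<lambda>A. adjugate A $ i $ j) \<in> poly_funs mat_coords"
proof -
  have "(\<lambda>A. (\<chi> r s. if s = i then axis j 1 $ r else A $ r $ s) $ r $ s)
    \<in> poly_funs mat_coords" for r s
    by (cases "s = i") (simp_all add: poly_funs_mat_coord poly_funs.const)
  from poly_funs_det[OF this] show ?thesis by (simp add: adjugate_def)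
qed

lemma closedin_SL_vanishing:
  fixes \<phi> :: "complex^'n^'n \<Rightarrow> complex^'m"
  assumes "\<And>i. (\<lambda>A. \<phi> A $ i) \<in> poly_funs mat_coords"
  shows "closedin SL_topology {A \<in> carrier SL. \<phi> A = 0}"
proof -
  have "closedin SL_topology {A \<in> carrier SL. \<forall>f\<in>range (\<lambda>i A. \<phi> A $ i). f A = 0}"
    unfolding SL_topology_def by (rule closedin_subtopology_zariski_zeros) (use assms in blast)
  then show ?thesis by (simp add: vec_eq_iff)
qed

lemma continuous_map_SL:
  fixes \<phi> :: "complex^'n^'n \<Rightarrow> complex^'n^'n"
  assumes "\<phi> \<in> carrier SL \<rightarrow> carrier SL"
    and "\<And>i j. \<exists>g\<in>poly_funs mat_coords. \<forall>A\<in>carrier SL. \<phi> A $ i $ j = g A"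
  shows "continuous_map SL_topology SL_topology \<phi>"
  unfolding SL_topology_def using assms
  by (intro continuous_map_zariski) (auto simp: mat_coords_def)

lemma continuous_map_SL_sandwich:
  fixes x y :: "complex^'n^'n"
  assumes "det x = 1" "det y = 1"
  shows "continuous_map SL_topology SL_topology (\<lambda>A. x ** A ** y)"
proof (rule continuous_map_SL)
  fix i j
  have "(\<lambda>A. (x ** A ** y) $ i $ j) \<in> poly_funs mat_coords"
    by (intro poly_funs_matrix_mult poly_funs.const poly_funs_mat_coord)
  then show "\<exists>g\<in>poly_funs mat_coords. \<forall>A\<in>carrier SL. (x ** A ** y) $ i $ j = g A"
    by (rule bexI[rotated]) simp
qed (auto simp: det_mul assms)

lemma continuous_map_SL_commutator:
  fixes y :: "complex^'n^'n"
  assumes "det y = 1"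
  shows "continuous_map SL_topology SL_topology (\<lambda>A. A ** y ** matrix_inv A ** matrix_inv y)"
proof (rule continuous_map_SL)
  fix i j :: 'n
  have "(\<lambda>A. (A ** y ** adjugate A ** matrix_inv y) $ i $ j) \<in> poly_funs mat_coords"
    by (intro poly_funs_matrix_mult poly_funs.const poly_funs_mat_coord poly_funs_adjugate)
  moreover have "matrix_inv A = adjugate A" if "A \<in> carrier SL" for A :: "complex^'n^'n"
    using that by (simp add: vec_eq_iff matrix_inv_eq_adjugate)
  ultimately show "\<exists>g\<in>poly_funs mat_coords. \<forall>A\<in>carrier SL.
      (A ** y ** matrix_inv A ** matrix_inv y) $ i $ j = g A"
    by (intro bexI) auto
qed (auto simp: det_mul assms)

lemma rational_curve_scale_column:
  fixes M :: "complex \<Rightarrow> complex^'n^'n"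
  assumes "polynomial_matrix M"
  shows "rational_curve mat_coords d (\<lambda>t. scale_column k (inverse (poly d t)) (M t))"
  unfolding rational_curve_def
proof
  fix c :: "complex^'n^'n \<Rightarrow> complex" assume "c \<in> mat_coords"
  then obtain i j where c: "c = (\<lambda>A. A $ i $ j)" by (auto simp: mat_coords_def)
  obtain p where p: "\<And>t. M t $ i $ j = poly p t" using assms
    unfolding polynomial_matrix_def by blast
  show "\<exists>p m. \<forall>t. poly d t \<noteq> 0 \<longrightarrow>
      c (scale_column k (inverse (poly d t)) (M t)) * poly d t ^ m = poly p t"
    by (rule exI[of _ p], rule exI[of _ "if j = k then 1 else 0"]) (simp add: c flip: p)
qed

text \<open>The rational curve joining \<open>x\<close> to \<open>y\<close> is the segment between them, with one column
  divided by the determinant.\<close>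

lemma irreduciblein_SL_linear_section:
  fixes L :: "(complex^'n^'n) set"
  assumes line: "\<And>x y t. x \<in> L \<Longrightarrow> y \<in> L \<Longrightarrow> x + mat t ** (y - x) \<in> L"
    and scale: "\<And>x c. x \<in> L \<Longrightarrow> scale_column k c x \<in> L"
  shows "irreduciblein SL_topology {x\<in>L. det x = 1}"
  unfolding SL_topology_def
proof (rule irreduciblein_zariskiI)
  fix f g x y
  assume fg: "f \<in> poly_funs mat_coords" "g \<in> poly_funs mat_coords" "f x \<noteq> 0" "g y \<noteq> 0"
    and xy: "x \<in> {x\<in>L. det x = 1}" "y \<in> {x\<in>L. det x = 1}"
  define M where "M t = x + mat t ** (y - x)" for t
  have M: "polynomial_matrix M" unfolding M_def by (rule polynomial_matrix_line)
  then obtain d where d: "\<And>t. det (M t) = poly d t" by (rule polynomial_matrix_det) blast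
  define \<phi> where "\<phi> t = scale_column k (inverse (poly d t)) (M t)" for t
  have M01: "M 0 = x" "M 1 = y" by (simp_all add: M_def vec_eq_iff)
  then have d01: "poly d 0 = 1" "poly d 1 = 1" using d[of 0] d[of 1] xy by auto
  then have "\<phi> 0 = x" "\<phi> 1 = y" by (simp_all add: \<phi>_def M01)
  moreover have "rational_curve mat_coords d \<phi>"
    unfolding \<phi>_def using M by (rule rational_curve_scale_column)
  ultimately obtain u where u: "poly d u \<noteq> 0" "f (\<phi> u) \<noteq> 0" "g (\<phi> u) \<noteq> 0"
    using rational_curve_common_nonzero[OF fg(1,2), of d \<phi> 0 1] d01 fg(3,4) by auto
  have "M u \<in> L" unfolding M_def using xy by (intro line) auto
  then have "\<phi> u \<in> {x\<in>L. det x = 1}" using u(1) by (simp add: \<phi>_def d scale)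
  then show "\<exists>z\<in>{x\<in>L. det x = 1}. f z \<noteq> 0 \<and> g z \<noteq> 0" using u by blast
qed auto

lemma irreduciblein_SL: "irreduciblein SL_topology (carrier SL :: (complex^'n^'n) set)"
proof -
  have "carrier SL = {x::complex^'n^'n. x \<in> UNIV \<and> det x = 1}" by auto
  then show ?thesis using irreduciblein_SL_linear_section[of UNIV] by simp
qed

lemma SL_open_Int_nonempty:
  fixes U V :: "(complex^'n^'n) set"
  assumes "openin SL_topology U" "openin SL_topology V" "U \<noteq> {}" "V \<noteq> {}"
  shows "U \<inter> V \<noteq> {}"
proof -
  have "U \<subseteq> carrier SL" "V \<subseteq> carrier SL" using assms(1,2) openin_subset by fastforce+
  then have "carrier SL \<inter> U \<inter> V \<noteq> {}"
    using irreduciblein_SL assms unfolding irreduciblein_def by (metis inf.absorb2)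
  then show ?thesis by blast
qed

section \<open>Triangular matrices and flags\<close>

definition idx :: "'n::finite \<Rightarrow> nat" where
  "idx = (SOME f. bij_betw f UNIV {..<CARD('n)})"

lemma bij_betw_idx: "bij_betw (idx :: 'n::finite \<Rightarrow> nat) UNIV {..<CARD('n)}"
proof -
  have "\<exists>f::'n \<Rightarrow> nat. bij_betw f UNIV {..<CARD('n)}"
    using ex_bij_betw_finite_nat[of "UNIV::'n set"] by (auto simp: atLeast0LessThan)
  then show ?thesis unfolding idx_def by (rule someI_ex)
qed

lemma inj_idx: "inj (idx :: 'n::finite \<Rightarrow> nat)"
  using bij_betw_idx by (auto simp: bij_betw_def)

lemma idx_eq_iff [simp]: "idx i = idx j \<longleftrightarrow> i = j"
  using inj_idx by (auto dest: injD)

lemma idx_less [simp]: "idx (i::'n::finite) < CARD('n)"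
  using bij_betw_idx by (auto simp: bij_betw_def)

lemma idx_surj:
  assumes "k < CARD('n)"
  obtains i :: "'n::finite" where "idx i = k"
  using assms bij_betw_idx[where 'n='n]
  by (metis (no_types, opaque_lifting) bij_betw_def imageE lessThan_iff)

lemma card_idx_less [simp]:
  assumes "k \<le> CARD('n)"
  shows "card {i::'n::finite. idx i < k} = k"
proof -
  have "m \<in> idx ` {i::'n. idx i < k}" if "m < k" for m
    using idx_surj[where 'n='n, of m] that assms by (metis imageI less_le_trans mem_Collect_eq)
  then have "idx ` {i::'n. idx i < k} = {..<k}" by auto
  then show ?thesis by (metis card_image card_lessThan inj_idx inj_on_subset subset_UNIV)
qed

lemma card_le_idx:
  assumes "k \<le> CARD('n)"
  shows "card {i::'n::finite. k \<le> idx i} = CARD('n) - k"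
proof -
  have "{i::'n. k \<le> idx i} = - {i. idx i < k}" by auto
  then show ?thesis using assms by (simp add: Compl_eq_Diff_UNIV card_Diff_subset)
qed

lemma bij_increasing_imp_eq:
  fixes \<tau> :: "'n::finite \<Rightarrow> 'n" and f :: "'n \<Rightarrow> 'b::ordered_cancel_comm_monoid_add"
  assumes "bij \<tau>" "\<And>i. f i \<le> f (\<tau> i)"
  shows "f (\<tau> i) = f i"
proof -
  have "(\<Sum>i\<in>UNIV. f i) = (\<Sum>i\<in>UNIV. f (\<tau> i))"
    using sum.reindex_bij_betw[OF assms(1), of f] by simp
  from sum_mono_inv[OF this] show ?thesis using assms(2) by simp
qed

lemma det_triangular:
  fixes A :: "'a::comm_ring_1^'n^'n" and e :: "'n \<Rightarrow> 'b::{linorder, ordered_cancel_comm_monoid_add}"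
  assumes "inj e" and zero: "\<And>i j. e j < e i \<Longrightarrow> A $ i $ j = 0"
  shows "det A = (\<Prod>i\<in>UNIV. A $ i $ i)"
proof -
  have "of_int (sign p) * (\<Prod>i\<in>UNIV. A $ i $ p i) = 0"
    if p: "p permutes (UNIV::'n set)" and "p \<noteq> id" for p
  proof -
    have "\<exists>i. e (p i) < e i"
    proof (rule ccontr)
      assume "\<not> ?thesis"
      then have "e (p i) = e i" for i
        using bij_increasing_imp_eq[OF permutes_bij[OF p], of e] by (simp add: not_less)
      then show False using \<open>inj e\<close> \<open>p \<noteq> id\<close> by (auto simp: fun_eq_iff dest: injD)
    qed
    then obtain i where "A $ i $ p i = 0" using zero by blast
    then have "(\<Prod>i\<in>UNIV. A $ i $ p i) = 0" by (meson UNIV_I finite prod_zero)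
    then show ?thesis by simp
  qed
  then have "det A = (\<Sum>p\<in>{id}. of_int (sign p) * (\<Prod>i\<in>UNIV. A $ i $ p i))"
    unfolding det_def by (intro sum.mono_neutral_right) auto
  then show ?thesis by simp
qed

definition upper :: "'a::zero^'n^'n \<Rightarrow> bool" where
  "upper A \<longleftrightarrow> (\<forall>i j. idx j < idx i \<longrightarrow> A $ i $ j = 0)"

lemma upperD: "upper A \<Longrightarrow> idx j < idx i \<Longrightarrow> A $ i $ j = 0"
  by (simp add: upper_def)

lemma det_upper: "upper A \<Longrightarrow> det A = (\<Prod>i\<in>UNIV. A $ i $ i)" for A :: "'a::comm_ring_1^'n^'n"
  by (rule det_triangular[OF inj_idx]) (rule upperD)

definition coord_space :: "'n set \<Rightarrow> ('a::field^'n) set" where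
  "coord_space I = {v. \<forall>i. i \<notin> I \<longrightarrow> v $ i = 0}"

lemma subspace_coord_space [simp]: "vec.subspace (coord_space I)"
  by (auto simp: coord_space_def vec.subspace_def)

lemma dim_coord_space [simp]: "vec.dim (coord_space I :: ('a::field^'n) set) = card I"
  unfolding coord_space_def by (rule dim_substandard_cart)

lemma axis_in_coord_space [simp]: "axis i c \<in> coord_space I \<longleftrightarrow> i \<in> I \<or> c = 0"
  by (auto simp: coord_space_def axis_nth_if)

lemma coord_space_Int: "coord_space I \<inter> coord_space J = coord_space (I \<inter> J)"
  by (auto simp: coord_space_def)

lemma coord_space_mono: "I \<subseteq> J \<Longrightarrow> coord_space I \<subseteq> coord_space J"
  by (auto simp: coord_space_def)

lemma coord_space_eq_span: "coord_space I = vec.span ((\<lambda>i. axis i 1) ` I)"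
proof
  show "coord_space I \<subseteq> vec.span ((\<lambda>i. axis i (1::'a)) ` I)"
  proof
    fix v :: "'a^'b" assume v: "v \<in> coord_space I"
    have "v $ i *s axis i 1 \<in> vec.span ((\<lambda>i. axis i (1::'a)) ` I)" for i
      using v by (cases "i \<in> I")
        (auto simp: coord_space_def vec.span_zero intro: vec.span_scale vec.span_base)
    then have "(\<Sum>i\<in>UNIV. v $ i *s axis i 1) \<in> vec.span ((\<lambda>i. axis i (1::'a)) ` I)"
      by (rule vec.span_sum)
    then show "v \<in> vec.span ((\<lambda>i. axis i (1::'a)) ` I)" by (simp only: basis_expansion)
  qed
qed (rule vec.span_minimal, auto)

lemma matrix_image_coord_space_subset_iff:
  "(*v) A ` coord_space I \<subseteq> coord_space J \<longleftrightarrow> (\<forall>r c. r \<notin> J \<longrightarrow> c \<in> I \<longrightarrow> A $ r $ c = 0)"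
proof (intro iffI allI impI)
  fix r c assume sub: "(*v) A ` coord_space I \<subseteq> coord_space J" and rc: "r \<notin> J" "c \<in> I"
  have "A *v axis c 1 \<in> coord_space J" using sub rc(2) by (intro subsetD[OF sub] imageI) simp
  then show "A $ r $ c = 0" using rc(1) by (simp add: coord_space_def matrix_vector_mult_axis)
next
  assume "\<forall>r c. r \<notin> J \<longrightarrow> c \<in> I \<longrightarrow> A $ r $ c = 0"
  then have "A $ r $ c * v $ c = 0" if "v \<in> coord_space I" "r \<notin> J" for r c v
    using that by (cases "c \<in> I") (auto simp: coord_space_def)
  then show "(*v) A ` coord_space I \<subseteq> coord_space J"
    by (auto simp: coord_space_def[of J] matrix_vector_mult_def intro!: sum.neutral)
qed

definition std_flag :: "nat \<Rightarrow> ('a::field^'n) set" where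
  "std_flag k = coord_space {i. idx i < k}"

lemma mem_std_flag: "v \<in> std_flag k \<longleftrightarrow> (\<forall>i. k \<le> idx i \<longrightarrow> v $ i = 0)"
  by (auto simp: std_flag_def coord_space_def not_less)

lemma subspace_std_flag [simp]: "vec.subspace (std_flag k)"
  by (simp add: std_flag_def)

lemma dim_std_flag [simp]: "k \<le> CARD('n) \<Longrightarrow> vec.dim (std_flag k :: ('a::field^'n) set) = k"
  by (simp add: std_flag_def)

lemma std_flag_mono: "k \<le> l \<Longrightarrow> std_flag k \<subseteq> std_flag l"
  unfolding std_flag_def by (rule coord_space_mono) auto

lemma std_flag_0 [simp]: "std_flag 0 = {0}"
  by (auto simp: mem_std_flag vec_eq_iff)

lemma std_flag_top [simp]: "CARD('n) \<le> k \<Longrightarrow> (std_flag k :: ('a::field^'n) set) = UNIV"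
  by (auto simp: mem_std_flag) (metis idx_less leD le_trans)

lemma axis_in_std_flag [simp]: "axis i c \<in> std_flag k \<longleftrightarrow> idx i < k \<or> c = 0"
  by (simp add: std_flag_def)

lemma std_flag_add: "u \<in> std_flag k \<Longrightarrow> v \<in> std_flag k \<Longrightarrow> u + v \<in> std_flag k"
  and std_flag_diff: "u \<in> std_flag k \<Longrightarrow> v \<in> std_flag k \<Longrightarrow> u - v \<in> std_flag k"
  by (simp_all add: vec.subspace_add vec.subspace_diff)

lemma in_std_flag_idx_iff:
  fixes v :: "'a::field^'n" and i :: 'n
  assumes "v \<in> std_flag (Suc (idx i))"
  shows "v \<in> std_flag (idx i) \<longleftrightarrow> v $ i = 0"
  proof
  assume "v $ i = 0"
  then show "v \<in> std_flag (idx i)"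
    using assms unfolding mem_std_flag by (metis Suc_leI idx_eq_iff le_neq_implies_less)
qed (simp add: mem_std_flag)

lemma upper_iff_std_flag:
  fixes A :: "'a::field^'n^'n"
  shows "upper A \<longleftrightarrow> (\<forall>k. (*v) A ` std_flag k \<subseteq> std_flag k)"
proof -
  have "upper A \<longleftrightarrow> (\<forall>k r c. k \<le> idx r \<longrightarrow> idx c < k \<longrightarrow> A $ r $ c = 0)"
    unfolding upper_def using less_le_trans by blast
  then show ?thesis by (simp add: std_flag_def matrix_image_coord_space_subset_iff not_less)
qed

lemma upper_vec_in_std_flag: "upper A \<Longrightarrow> v \<in> std_flag k \<Longrightarrow> A *v v \<in> std_flag k"
  by (auto simp: upper_iff_std_flag)

lemma upper_mat_1 [simp]: "upper (mat 1)"
  by (auto simp: upper_def mat_def)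

lemma upper_scale_column: "upper A \<Longrightarrow> upper (scale_column k c A)"
  by (simp add: upper_def)

lemma upper_mult: "upper A \<Longrightarrow> upper B \<Longrightarrow> upper (A ** B)" for A B :: "'a::field^'n^'n"
  unfolding upper_iff_std_flag matrix_image_mult by blast

lemma upper_mult_diag:
  fixes A B :: "'a::field^'n^'n"
  assumes "upper A" "upper B"
  shows "(A ** B) $ i $ i = A $ i $ i * B $ i $ i"
proof -
  have "A $ i $ k * B $ k $ i = (if k = i then A $ i $ i * B $ i $ i else 0)" for k
  proof -
    consider "k = i" | "idx k < idx i" | "idx i < idx k" by (metis idx_eq_iff linorder_less_linear)
    then show ?thesis by cases (use assms in \<open>auto simp: upperD\<close>)
  qed
  then have "(\<Sum>k\<in>UNIV. A $ i $ k * B $ k $ i)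
    = (\<Sum>k\<in>UNIV. if k = i then A $ i $ i * B $ i $ i else 0)"
    by (rule sum.cong[OF refl])
  then show ?thesis by (simp add: matrix_matrix_mult_def)
qed

definition flag_space :: "'a::field^'n^'n \<Rightarrow> nat \<Rightarrow> ('a^'n) set" where
  "flag_space X k = (*v) X ` std_flag k"

lemma flag_space_mat_1 [simp]: "flag_space (mat 1) k = std_flag k"
  by (simp add: flag_space_def)

lemma flag_space_mult: "flag_space (A ** X) k = (*v) A ` flag_space X k"
  by (simp add: flag_space_def matrix_image_mult)

lemma subspace_flag_space [simp]: "vec.subspace (flag_space X k)"
  by (simp add: flag_space_def)

lemma dim_flag_space [simp]:
  "det X \<noteq> 0 \<Longrightarrow> k \<le> CARD('n) \<Longrightarrow> vec.dim (flag_space X k) = k" for X :: "'a::field^'n^'n"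
  by (simp add: flag_space_def)

lemma flag_space_mono: "k \<le> l \<Longrightarrow> flag_space X k \<subseteq> flag_space X l"
  unfolding flag_space_def by (intro image_mono std_flag_mono)

lemma flag_space_0 [simp]: "flag_space X 0 = {0}"
  by (simp add: flag_space_def)

lemma flag_space_top [simp]:
  "det X \<noteq> 0 \<Longrightarrow> CARD('n) \<le> k \<Longrightarrow> flag_space X k = UNIV" for X :: "'a::field^'n^'n"
  by (simp add: flag_space_def)

lemma flag_space_upper:
  fixes A :: "'a::field^'n^'n"
  assumes "upper A" "det A \<noteq> 0"
  shows "flag_space A k = std_flag k"
  unfolding flag_space_def using assms
  by (intro matrix_image_eq_of_subset) (auto simp: upper_iff_std_flag)

lemma flag_space_mult_upper:
  "upper B \<Longrightarrow> det B \<noteq> 0 \<Longrightarrow> flag_space (X ** B) k = flag_space X k"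
  by (simp add: flag_space_mult flag_space_upper) (simp add: flag_space_def)

lemma flag_space_scale_column:
  assumes "c \<noteq> 0"
  shows "flag_space (scale_column i c X) k = flag_space X k"
  unfolding scale_column_eq_mult[of i c X] using assms
  by (intro flag_space_mult_upper upper_scale_column) auto

lemma upper_matrix_inv:
  fixes A :: "'a::field^'n^'n"
  assumes "upper A" "det A \<noteq> 0"
  shows "upper (matrix_inv A)"
  unfolding upper_iff_std_flag
proof
  fix k
  have "(*v) (matrix_inv A) ` flag_space A k = std_flag k"
    using assms(2) by (simp add: flag_space_def)
  then show "(*v) (matrix_inv A) ` std_flag k \<subseteq> std_flag k"
    using assms by (simp add: flag_space_upper)
qed

section \<open>Flag stabilizers and the standard Borel subgroup\<close>

definition flag_stabilizer :: "complex^'n^'n \<Rightarrow> nat set \<Rightarrow> (complex^'n^'n) set" where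
  "flag_stabilizer W J = {g. det g = 1 \<and> (\<forall>k\<in>J. (*v) g ` flag_space W k = flag_space W k)}"

definition borel_std :: "(complex^'n^'n) set" where
  "borel_std = {A. det A = 1 \<and> upper A}"

lemma subgroup_flag_stabilizer: "subgroup (flag_stabilizer W J) SL"
proof (rule SL.subgroupI)
  have "mat 1 \<in> flag_stabilizer W J" by (simp add: flag_stabilizer_def)
  then show "flag_stabilizer W J \<noteq> {}" by blast
next
  fix g assume g: "g \<in> flag_stabilizer W J"
  then have "(*v) (matrix_inv g) ` flag_space W k = flag_space W k" if "k \<in> J" for k
    using matrix_inv_image_cancel(2)[of g "flag_space W k"] that by (auto simp: flag_stabilizer_def)
  then show "inv\<^bsub>SL\<^esub> g \<in> flag_stabilizer W J" using g by (simp add: flag_stabilizer_def)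
next
  fix g h assume "g \<in> flag_stabilizer W J" "h \<in> flag_stabilizer W J"
  then show "g \<otimes>\<^bsub>SL\<^esub> h \<in> flag_stabilizer W J"
    by (simp add: flag_stabilizer_def det_mul matrix_image_mult)
qed (auto simp: flag_stabilizer_def)

lemma flag_stabilizer_conj:
  fixes A W :: "complex^'n^'n"
  assumes W: "det W = 1"
  shows "matrix_inv W ** A ** W \<in> flag_stabilizer (mat 1) J \<longleftrightarrow> A \<in> flag_stabilizer W J"
proof -
  have "(*v) (matrix_inv W ** A ** W) ` std_flag k = std_flag k \<longleftrightarrow>
      (*v) A ` flag_space W k = flag_space W k" for k
    unfolding matrix_image_mult flag_space_def using W
    by (metis matrix_inv_image_cancel zero_neq_one)
  then show ?thesis using W by (simp add: flag_stabilizer_def det_mul)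
qed

lemma flag_stabilizer_eq_conj_image:
  assumes W: "det W = 1"
  shows "flag_stabilizer W J = (\<lambda>A. W ** A ** matrix_inv W) ` flag_stabilizer (mat 1) J"
proof (intro subset_antisym subsetI)
  fix A assume "A \<in> flag_stabilizer W J"
  then show "A \<in> (\<lambda>A. W ** A ** matrix_inv W) ` flag_stabilizer (mat 1) J"
    using W by (intro image_eqI[of _ _ "matrix_inv W ** A ** W"])
      (simp_all add: matrix_mul_rassoc flag_stabilizer_conj[OF W, unfolded matrix_mul_rassoc])
next
  fix A assume "A \<in> (\<lambda>A. W ** A ** matrix_inv W) ` flag_stabilizer (mat 1) J"
  then obtain B where B: "B \<in> flag_stabilizer (mat 1) J" "A = W ** B ** matrix_inv W" by blast
  then have "matrix_inv W ** A ** W = B" using W by (simp add: matrix_mul_rassoc)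
  then show "A \<in> flag_stabilizer W J" using B(1) flag_stabilizer_conj[OF W] by metis
qed

lemma flag_stabilizer_mat_1_UNIV: "flag_stabilizer (mat 1) UNIV = borel_std"
  using flag_space_upper upper_iff_std_flag
  by (fastforce simp: flag_stabilizer_def borel_std_def flag_space_def)

lemma mem_flag_stabilizer_UNIV_iff:
  fixes A W :: "complex^'n^'n"
  assumes "det W = 1"
  shows "A \<in> flag_stabilizer W UNIV \<longleftrightarrow> det A = 1 \<and> upper (matrix_inv W ** A ** W)"
  using flag_stabilizer_conj[OF assms, of A UNIV] assms
  by (simp add: flag_stabilizer_mat_1_UNIV borel_std_def det_mul)

lemma subgroup_borel_std: "subgroup borel_std SL"
  using subgroup_flag_stabilizer[of "mat 1" UNIV] by (simp only: flag_stabilizer_mat_1_UNIV)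

lemma connectedin_borel_std: "connectedin SL_topology (borel_std :: (complex^'n^'n) set)"
proof -
  have "irreduciblein SL_topology {A::complex^'n^'n. A \<in> Collect upper \<and> det A = 1}"
    by (rule irreduciblein_SL_linear_section) (auto simp: upper_def)
  moreover have "{A. A \<in> Collect upper \<and> det A = 1} = (borel_std :: (complex^'n^'n) set)"
    by (auto simp: borel_std_def)
  ultimately show ?thesis using irreduciblein_imp_connectedin by metis
qed

lemma (in group) derived_subset_subgroupI:
  assumes "subgroup K G" and "\<And>a b. a \<in> H \<Longrightarrow> b \<in> H \<Longrightarrow> a \<otimes> b \<otimes> inv a \<otimes> inv b \<in> K"
  shows "derived G H \<subseteq> K"
  unfolding derived_def by (rule generate_subgroup_incl[OF _ assms(1)]) (use assms(2) in auto)

lemma (in group) exp_of_derived_subset: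
  assumes "subgroup H G"
  shows "(derived G ^^ n) H \<subseteq> H"
  by (induction n) (use derived_incl[OF _ assms] in auto)

lemma (in group) exp_of_derived_consistent:
  assumes "subgroup H G"
  shows "(derived (G\<lparr>carrier := H\<rparr>) ^^ n) H = (derived G ^^ n) H"
  by (induction n) (simp_all add: derived_consistent[OF exp_of_derived_subset assms] assms)

lemma (in group) solvable_subgroup_iff:
  assumes "subgroup H G"
  shows "solvable (G\<lparr>carrier := H\<rparr>) \<longleftrightarrow> (\<exists>n. (derived G ^^ n) H = {\<one>})"
proof -
  interpret H: group "G\<lparr>carrier := H\<rparr>" by (rule subgroup_imp_group[OF assms])
  show ?thesis by (simp add: H.solvable_iff_trivial_derived_seq exp_of_derived_consistent[OF assms])
qed

definition unipotent_std :: "nat \<Rightarrow> (complex^'n^'n) set" where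
  "unipotent_std k = {A. det A = 1 \<and> (\<forall>j. \<forall>v\<in>std_flag j. A *v v - v \<in> std_flag (j - k))}"

lemma unipotent_stdD: "A \<in> unipotent_std k \<Longrightarrow> v \<in> std_flag j \<Longrightarrow> A *v v - v \<in> std_flag (j - k)"
  by (simp add: unipotent_std_def)

lemma upper_of_unipotent_std:
  fixes A :: "complex^'n^'n"
  assumes "A \<in> unipotent_std k"
  shows "upper A"
  unfolding upper_iff_std_flag
proof safe
  fix j and v :: "complex^'n" assume v: "v \<in> std_flag j"
  have "A *v v - v \<in> std_flag j"
    using unipotent_stdD[OF assms v] std_flag_mono[of "j - k" j] by auto
  from std_flag_add[OF this v] show "A *v v \<in> std_flag j" by simp
qed

lemma subgroup_unipotent_std: "subgroup (unipotent_std k :: (complex^'n^'n) set) SL"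
proof (rule SL.subgroupI)
  show "unipotent_std k \<subseteq> (carrier SL :: (complex^'n^'n) set)" by (auto simp: unipotent_std_def)
  have "mat 1 \<in> (unipotent_std k :: (complex^'n^'n) set)"
    by (simp add: unipotent_std_def vec.subspace_0)
  then show "(unipotent_std k :: (complex^'n^'n) set) \<noteq> {}" by blast
next
  fix A :: "complex^'n^'n" assume A: "A \<in> unipotent_std k"
  then have det: "det A = 1" by (simp add: unipotent_std_def)
  then have upper: "upper (matrix_inv A)"
    using upper_of_unipotent_std[OF A] by (simp add: upper_matrix_inv)
  have "matrix_inv A *v v - v \<in> std_flag (j - k)" if v: "v \<in> std_flag j" for j v
  proof -
    have "matrix_inv A *v (A *v v - v) \<in> std_flag (j - k)"
      using upper unipotent_stdD[OF A v] by (rule upper_vec_in_std_flag)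
    then have "0 - matrix_inv A *v (A *v v - v) \<in> std_flag (j - k)"
      by (intro std_flag_diff) (simp_all add: vec.subspace_0)
    then show ?thesis using det by (simp add: matrix_vector_mult_diff_distrib)
  qed
  then show "inv\<^bsub>SL\<^esub> A \<in> unipotent_std k" using det by (simp add: unipotent_std_def)
next
  fix A B :: "complex^'n^'n" assume A: "A \<in> unipotent_std k" and B: "B \<in> unipotent_std k"
  have "(A ** B) *v v - v \<in> std_flag (j - k)" if v: "v \<in> std_flag j" for j v
  proof -
    have "A *v (B *v v - v) \<in> std_flag (j - k)"
      using upper_of_unipotent_std[OF A] unipotent_stdD[OF B v] by (rule upper_vec_in_std_flag)
    from std_flag_add[OF this unipotent_stdD[OF A v]] show ?thesis
      by (simp add: matrix_vector_mult_diff_distrib matrix_vector_mul_assoc)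
  qed
  then show "A \<otimes>\<^bsub>SL\<^esub> B \<in> unipotent_std k" using A B by (simp add: unipotent_std_def det_mul)
qed

lemma commutator_in_unipotent_std:
  fixes A B :: "complex^'n^'n"
  assumes "A \<in> borel_std" "B \<in> borel_std"
    and diff: "\<And>j u. u \<in> std_flag j \<Longrightarrow> (A ** B) *v u - (B ** A) *v u \<in> std_flag (j - k)"
  shows "A ** B ** matrix_inv A ** matrix_inv B \<in> unipotent_std k"
proof -
  have AB: "upper A" "det A = 1" "upper B" "det B = 1" using assms by (auto simp: borel_std_def)
  have "(A ** B ** matrix_inv A ** matrix_inv B) *v v - v \<in> std_flag (j - k)"
    if "v \<in> std_flag j" for j v
  proof -
    define u where "u = (matrix_inv A ** matrix_inv B) *v v"
    have "u \<in> std_flag j"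
      unfolding u_def
      using AB that by (intro upper_vec_in_std_flag upper_mult upper_matrix_inv) auto
    moreover have "(B ** A) *v u = v"
      by (simp add: u_def AB flip: matrix_vector_mul_assoc)
    moreover have "(A ** B) *v u = (A ** B ** matrix_inv A ** matrix_inv B) *v v"
      by (simp add: u_def matrix_vector_mul_assoc matrix_mul_assoc)
    ultimately show ?thesis using diff by metis
  qed
  then show ?thesis using AB by (simp add: unipotent_std_def det_mul)
qed

lemma commutator_borel_std:
  fixes A B :: "complex^'n^'n"
  assumes "A \<in> borel_std" "B \<in> borel_std"
  shows "A ** B ** matrix_inv A ** matrix_inv B \<in> unipotent_std 1"
proof (rule commutator_in_unipotent_std[OF assms])
  have upper: "upper A" "upper B" "upper (A ** B)" "upper (B ** A)"
    using assms by (auto simp: borel_std_def intro: upper_mult)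
  define M where "M = A ** B - B ** A"
  have strictly_upper: "M $ i $ j = 0" if "idx j \<le> idx i" for i j
    using upper upper_mult_diag[OF upper(1,2), of i] upper_mult_diag[OF upper(2,1), of i] that
    by (cases "i = j") (auto simp: M_def upper_def order.order_iff_strict)
  fix j and u :: "complex^'n" assume u: "u \<in> std_flag j"
  have "M $ i $ k * u $ k = 0" if "j - 1 \<le> idx i" for i k
  proof (cases "idx k \<le> idx i")
    case False
    then have "j \<le> idx k" using that by linarith
    then show ?thesis using u by (simp add: mem_std_flag)
  qed (simp add: strictly_upper)
  then have "M *v u \<in> std_flag (j - 1)"
    by (auto simp: mem_std_flag matrix_vector_mult_def intro!: sum.neutral)
  then show "(A ** B) *v u - (B ** A) *v u \<in> std_flag (j - 1)"
    by (simp add: M_def matrix_vector_mult_diff_rdistrib)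
qed

lemma commutator_unipotent_std:
  fixes A B :: "complex^'n^'n"
  assumes A: "A \<in> unipotent_std k" and B: "B \<in> unipotent_std k" and "k \<ge> 1"
  shows "A ** B ** matrix_inv A ** matrix_inv B \<in> unipotent_std (Suc k)"
proof (rule commutator_in_unipotent_std)
  fix j and u :: "complex^'n" assume u: "u \<in> std_flag j"
  have "A *v (B *v u - u) - (B *v u - u) \<in> std_flag (j - k - k)"
    "B *v (A *v u - u) - (A *v u - u) \<in> std_flag (j - k - k)"
    by (intro unipotent_stdD[OF A] unipotent_stdD[OF B] u)+
  from std_flag_diff[OF this] have "(A ** B) *v u - (B ** A) *v u \<in> std_flag (j - k - k)"
    by (simp add: matrix_vector_mult_diff_distrib matrix_vector_mul_assoc)
  then show "(A ** B) *v u - (B ** A) *v u \<in> std_flag (j - Suc k)"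
    by (rule subsetD[OF std_flag_mono, rotated]) (use \<open>k \<ge> 1\<close> in linarith)
qed (use A B upper_of_unipotent_std in \<open>auto simp: unipotent_std_def borel_std_def\<close>)

lemma unipotent_std_top: "unipotent_std CARD('n) \<subseteq> {mat 1 :: complex^'n^'n}"
proof
  fix A :: "complex^'n^'n" assume A: "A \<in> unipotent_std CARD('n)"
  have "A *v v = mat 1 *v v" for v using unipotent_stdD[OF A, of v "CARD('n)"] by simp
  then show "A \<in> {mat 1}" by (simp add: matrix_eq)
qed

lemma solvable_seq_borel_std: "solvable_seq SL (borel_std :: (complex^'n^'n) set)"
proof -
  let ?B = "borel_std :: (complex^'n^'n) set"
  have "(derived SL ^^ Suc k) ?B \<subseteq> unipotent_std (Suc k)" for k
  proof (induction k)
    case 0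
    have "derived SL ?B \<subseteq> unipotent_std 1"
      using commutator_borel_std
      by (intro SL.derived_subset_subgroupI subgroup_unipotent_std) (auto simp: borel_std_def)
    then show ?case by simp
  next
    case (Suc k)
    have "derived SL (unipotent_std (Suc k)) \<subseteq> (unipotent_std (Suc (Suc k)) :: (complex^'n^'n) set)"
      using commutator_unipotent_std[where k="Suc k"]
      by (intro SL.derived_subset_subgroupI subgroup_unipotent_std) (auto simp: unipotent_std_def)
    then show ?case using SL.mono_derived[OF Suc.IH] by auto
  qed
  from this[of "CARD('n) - 1"] have "(derived SL ^^ CARD('n)) ?B \<subseteq> {mat 1}"
    using unipotent_std_top[where 'n='n] by simp
  then have "(derived SL ^^ CARD('n)) ?B = {\<one>\<^bsub>SL\<^esub>}"
    using subgroup.one_closed[OF SL.exp_of_derived_is_subgroup[OF subgroup_borel_std],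
        of "CARD('n)"]
    by auto
  then show ?thesis by (rule SL.trivial_derived_seq_imp_solvable[OF subgroup_borel_std])
qed

lemma group_hom_conj:
  assumes W: "det (W :: complex^'n^'n) = 1"
  shows "group_hom SL SL (\<lambda>A. W ** A ** matrix_inv W)"
proof -
  have "W ** (A ** B) ** matrix_inv W = W ** A ** matrix_inv W ** (W ** B ** matrix_inv W)" for A B
    using W by (simp add: matrix_mul_rassoc)
  then show ?thesis using W by unfold_locales (auto simp: hom_def det_mul)
qed

lemma closedin_full_flag_stabilizer:
  assumes W: "det (W :: complex^'n^'n) = 1"
  shows "closedin SL_topology (flag_stabilizer W UNIV)"
proof -
  define F :: "(complex^'n^'n \<Rightarrow> complex) set"
    where "F = (\<lambda>(i, j) A. (matrix_inv W ** A ** W) $ i $ j) ` {(i, j). idx j < idx i}"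
  have "F \<subseteq> poly_funs mat_coords"
    unfolding F_def by (auto intro!: poly_funs_matrix_mult poly_funs.const poly_funs_mat_coord)
  then have "closedin SL_topology {A \<in> carrier SL. \<forall>f\<in>F. f A = 0}"
    unfolding SL_topology_def by (rule closedin_subtopology_zariski_zeros)
  moreover have "{A \<in> carrier SL. \<forall>f\<in>F. f A = 0} = flag_stabilizer W UNIV"
    by (auto simp: mem_flag_stabilizer_UNIV_iff[OF W] F_def upper_def)
  ultimately show ?thesis by simp
qed

lemma conn_solv_full_flag_stabilizer:
  assumes W: "det (W :: complex^'n^'n) = 1"
  shows "conn_solv_subgroup (flag_stabilizer W UNIV)"
proof -
  interpret conj: group_hom SL SL "\<lambda>A. W ** A ** matrix_inv W" by (rule group_hom_conj[OF W])
  have image: "flag_stabilizer W UNIV = (\<lambda>A. W ** A ** matrix_inv W) ` borel_std"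
    using flag_stabilizer_eq_conj_image[OF W, of UNIV] by (simp add: flag_stabilizer_mat_1_UNIV)
  have "connectedin SL_topology (flag_stabilizer W UNIV)"
    unfolding image
    by (rule connectedin_continuous_map_image[OF continuous_map_SL_sandwich connectedin_borel_std])
       (simp_all add: W)
  moreover have "solvable_seq SL (flag_stabilizer W UNIV)"
    unfolding image by (rule conj.solvable_imp_solvable_img[OF solvable_seq_borel_std])
  then have "solvable (SL\<lparr>carrier := flag_stabilizer W UNIV\<rparr>)"
    using SL.solvable_imp_trivial_derived_seq
    by (simp add: SL.solvable_subgroup_iff subgroup_flag_stabilizer)
  ultimately show ?thesis
    by (simp add: conn_solv_subgroup_def subgroup_flag_stabilizer
      closedin_full_flag_stabilizer[OF W])
qed

section \<open>Eigenvectors modulo an invariant subspace\<close>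

definition eigenspace_mod :: "('a::field^'n) set \<Rightarrow> 'a^'n^'n \<Rightarrow> 'a \<Rightarrow> ('a^'n) set" where
  "eigenspace_mod U A c = {v. A *v v - c *s v \<in> U}"

lemma mem_eigenspace_mod: "v \<in> eigenspace_mod U A c \<longleftrightarrow> A *v v - c *s v \<in> U"
  by (simp add: eigenspace_mod_def)

lemma eigenspace_mod_eq_vimage: "eigenspace_mod U A c = (*v) (A - mat c) -` U"
  by (auto simp: eigenspace_mod_def matrix_vector_mult_diff_rdistrib)

lemma subspace_eigenspace_mod: "vec.subspace U \<Longrightarrow> vec.subspace (eigenspace_mod U A c)"
  unfolding eigenspace_mod_eq_vimage by (rule vec.subspace_vimage)

lemma subset_eigenspace_mod:
  "vec.subspace U \<Longrightarrow> (\<And>u. u \<in> U \<Longrightarrow> A *v u \<in> U) \<Longrightarrow> U \<subseteq> eigenspace_mod U A c"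
  by (auto simp: mem_eigenspace_mod vec.subspace_diff vec.subspace_scale)

lemma vec_subspace_scale_iff:
  fixes v :: "'a::field^'n"
  assumes "vec.subspace U" "c \<noteq> 0"
  shows "c *s v \<in> U \<longleftrightarrow> v \<in> U"
  using vec.subspace_scale[OF assms(1), of v c]
    vec.subspace_scale[OF assms(1), of "c *s v" "inverse c"]
    assms(2) by auto

lemma scalar_mod_unique:
  fixes v x :: "'a::field^'n"
  assumes "vec.subspace U" "v \<notin> U" "x - c *s v \<in> U" "x - d *s v \<in> U"
  shows "c = d"
proof (rule ccontr)
  assume "c \<noteq> d"
  have "(x - d *s v) - (x - c *s v) \<in> U" by (rule vec.subspace_diff[OF assms(1,4,3)])
  then have "(c - d) *s v \<in> U" by (simp add: vec.scale_left_diff_distrib)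
  then show False using vec_subspace_scale_iff[OF assms(1), of "c - d" v] assms(2) \<open>c \<noteq> d\<close> by simp
qed

definition poly_act :: "'a::field^'n^'n \<Rightarrow> 'a poly \<Rightarrow> 'a^'n \<Rightarrow> 'a^'n" where
  "poly_act A p v = fold_coeffs (\<lambda>a w. a *s v + A *v w) p 0"

lemma poly_act_0 [simp]: "poly_act A 0 v = 0"
  by (simp add: poly_act_def)

lemma poly_act_pCons [simp]: "poly_act A (pCons a p) v = a *s v + A *v poly_act A p v"
  by (cases "p = 0 \<and> a = 0") (auto simp: poly_act_def)

lemma poly_act_add: "poly_act A (p + q) v = poly_act A p v + poly_act A q v"
  by (induction p q rule: poly_induct2)
    (simp_all add: vec.scale_left_distrib matrix_vector_right_distrib)

lemma poly_act_smult: "poly_act A (smult c p) v = c *s poly_act A p v"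
  by (induction p) (simp_all add: vec.scale vec.scale_right_distrib)

lemma poly_act_sum: "poly_act A (\<Sum>i\<in>I. p i) v = (\<Sum>i\<in>I. poly_act A (p i) v)"
  by (induction I rule: infinite_finite_induct) (simp_all add: poly_act_add)

lemma poly_act_monom: "poly_act A (monom c k) v = c *s ((*v) A ^^ k) v"
  by (induction k) (simp_all add: monom_0 monom_Suc vec.scale)

lemma poly_act_matrix_vector: "poly_act A p (A *v v) = A *v poly_act A p v"
  by (induction p) (simp_all add: vec.scale matrix_vector_right_distrib)

lemma poly_act_diff_scale: "poly_act A p (u - c *s v) = poly_act A p u - c *s poly_act A p v"
  by (induction p)
    (simp_all add: vec.scale vec.scale_right_diff_distrib vec.scale_right_distrib
      matrix_vector_mult_diff_distrib mult.commute)

lemma poly_act_linear_factor: "poly_act A ([:-c, 1:] * q) v = poly_act A q (A *v v - c *s v)"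
proof -
  have "[:-c, 1:] * q = smult (-c) q + pCons 0 q" by simp
  then have "poly_act A ([:-c, 1:] * q) v = poly_act A (smult (-c) q) v + poly_act A (pCons 0 q) v"
    by (simp only: poly_act_add)
  also have "\<dots> = poly_act A q (A *v v - c *s v)"
    unfolding poly_act_smult poly_act_diff_scale by (simp add: poly_act_matrix_vector)
  finally show ?thesis .
qed

lemma eigenvector_mod_of_annihilator:
  fixes A :: "'a::alg_closed_field^'n^'n"
  assumes U: "vec.subspace U" and E: "vec.subspace E" "\<And>u. u \<in> E \<Longrightarrow> A *v u \<in> E"
    and "p \<noteq> 0" "poly_act A p v \<in> U" "v \<in> E" "v \<notin> U"
  shows "\<exists>w c. w \<in> E \<and> w \<notin> U \<and> w \<in> eigenspace_mod U A c"
  using assms(4-)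
proof (induction "degree p" arbitrary: p v)
  case 0
  then obtain c where "p = [:c:]" "c \<noteq> 0" by (metis degree_eq_zeroE pCons_0_0)
  then show ?case using 0 vec_subspace_scale_iff[OF U, of c v] by simp
next
  case (Suc m)
  then obtain c where "poly p c = 0" using alg_closed_imp_poly_has_root[of p] by auto
  then obtain q where q: "p = [:-c, 1:] * q" by (metis poly_eq_0_iff_dvd dvdE)
  then have "q \<noteq> 0" using Suc.prems by auto
  have "degree p = Suc (degree q)" unfolding q by (subst degree_mult_eq) (use \<open>q \<noteq> 0\<close> in auto)
  then have deg: "m = degree q" using Suc.hyps(2) by simp
  show ?case
  proof (cases "A *v v - c *s v \<in> U")
    case True
    then show ?thesis using Suc.prems by (auto simp: mem_eigenspace_mod)
  next
    case False
    have "A *v v - c *s v \<in> E" using Suc.prems E by (simp add: vec.subspace_diff vec.subspace_scale)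
    moreover have "poly_act A q (A *v v - c *s v) \<in> U"
      using Suc.prems(2) unfolding q poly_act_linear_factor .
    ultimately show ?thesis using Suc.hyps(1)[OF deg \<open>q \<noteq> 0\<close> _ _ False] by blast
  qed
qed

lemma ex_linear_relation:
  fixes f :: "nat \<Rightarrow> 'a::field^'n"
  shows "\<exists>c. (\<exists>k\<le>CARD('n). c k \<noteq> 0) \<and> (\<Sum>k\<le>CARD('n). c k *s f k) = 0"
proof (cases "inj_on f {..CARD('n)}")
  case True
  let ?S = "f ` {..CARD('n)}"
  have "card ?S = CARD('n) + 1" using True by (simp add: card_image)
  then have "vec.dependent ?S"
    using vec.independent_card_le_dim[of ?S UNIV] by (auto simp: vec_dim_card card_cart_basis)
  then obtain u where u: "\<exists>v\<in>?S. u v \<noteq> 0" "(\<Sum>v\<in>?S. u v *s v) = 0"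
    by (auto simp: vec.dependent_finite)
  then have "(\<Sum>k\<le>CARD('n). u (f k) *s f k) = 0" by (simp add: sum.reindex[OF True])
  then show ?thesis using u(1) by (intro exI[of _ "\<lambda>k. u (f k)"]) auto
next
  case False
  then obtain i j where ij: "i \<le> CARD('n)" "j \<le> CARD('n)" "f i = f j" "i \<noteq> j"
    by (auto simp: inj_on_def)
  define c where "c = (\<lambda>k. if k = i then 1 else if k = j then -1 else (0::'a))"
  have "(\<Sum>k\<le>CARD('n). c k *s f k) = (\<Sum>k\<in>{i,j}. c k *s f k)"
    by (rule sum.mono_neutral_right) (use ij in \<open>auto simp: c_def\<close>)
  also have "\<dots> = 0" using ij by (simp add: c_def)
  finally show ?thesis using ij by (intro exI[of _ c]) (auto simp: c_def)
qed

lemma ex_annihilating_poly: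
  fixes A :: "'a::field^'n^'n"
  obtains p where "p \<noteq> 0" "poly_act A p v = 0"
proof -
  obtain c where c: "\<exists>k\<le>CARD('n). c k \<noteq> 0" "(\<Sum>k\<le>CARD('n). c k *s ((*v) A ^^ k) v) = 0"
    using ex_linear_relation[of "\<lambda>k. ((*v) A ^^ k) v"] by blast
  define p where "p = (\<Sum>k\<le>CARD('n). monom (c k) k)"
  have "coeff p k = c k" if "k \<le> CARD('n)" for k using that by (simp add: p_def coeff_sum)
  then have "p \<noteq> 0" using c(1) by (metis coeff_0)
  moreover have "poly_act A p v = 0" using c(2) by (simp add: p_def poly_act_sum poly_act_monom)
  ultimately show ?thesis by (rule that)
qed

lemma ex_eigenvector_mod:
  fixes A :: "'a::alg_closed_field^'n^'n"
  assumes "vec.subspace U" "vec.subspace E" "\<And>u. u \<in> E \<Longrightarrow> A *v u \<in> E" "\<not> E \<subseteq> U"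
  obtains w c where "w \<in> E" "w \<notin> U" "w \<in> eigenspace_mod U A c"
proof -
  obtain v where v: "v \<in> E" "v \<notin> U" using assms(4) by blast
  obtain p where p: "p \<noteq> 0" "poly_act A p v = 0" by (rule ex_annihilating_poly)
  have "poly_act A p v \<in> U" using p(2) vec.subspace_0[OF assms(1)] by simp
  from eigenvector_mod_of_annihilator[OF assms(1-3) p(1) this v] show ?thesis using that by blast
qed

lemma finite_eigenvalues:
  fixes A :: "'a::field^'n^'n"
  shows "finite {c. det (A - mat c) = 0}"
proof -
  obtain d where d: "\<And>t. det (mat 1 + mat t ** (- A)) = poly d t"
    by (rule polynomial_matrix_det[OF polynomial_matrix_line]) blast
  have "poly d 0 = 1" by (simp flip: d)
  then have "d \<noteq> 0" by auto
  have "poly d (inverse c) = 0" if c: "det (A - mat c) = 0" "c \<noteq> 0" for c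
  proof -
    have "A - mat c = mat (- c) ** (mat 1 + mat (inverse c) ** (- A))"
      using c(2) by (simp add: vec_eq_iff algebra_simps) (simp add: mat_def)
    then have "det (mat (- c) :: 'a^'n^'n) * poly d (inverse c) = 0"
      using c(1) by (simp add: det_mul flip: d)
    moreover have "det (mat (- c) :: 'a^'n^'n) \<noteq> 0"
      using c(2) by (subst det_diagonal) (auto simp: mat_def)
    ultimately show ?thesis by simp
  qed
  then have "{c. det (A - mat c) = 0} \<subseteq> insert 0 (inverse ` {t. poly d t = 0})"
    by (smt (verit, ccfv_threshold) image_eqI insertCI inverse_inverse_eq mem_Collect_eq subsetI)
  then show ?thesis using poly_roots_finite[OF \<open>d \<noteq> 0\<close>] by (simp add: finite_subset)
qed

lemma eigenvalue_mod_is_eigenvalue: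
  fixes A :: "'a::field^'n^'n"
  assumes U: "vec.subspace U" "\<And>u. u \<in> U \<Longrightarrow> A *v u \<in> U"
    and v: "v \<notin> U" "v \<in> eigenspace_mod U A c"
  shows "det (A - mat c) = 0"
proof (rule ccontr)
  assume "det (A - mat c) \<noteq> 0"
  have "(*v) (A - mat c) ` insert v U \<subseteq> U"
    using v(2) subset_eigenspace_mod[OF U, of c] unfolding eigenspace_mod_eq_vimage by blast
  then have "vec.dim ((*v) (A - mat c) ` insert v U) \<le> vec.dim U" by (rule vec.dim_subset)
  moreover have "vec.dim (insert v U) = vec.dim U + 1"
    using v(1) U(1) by (simp add: vec.dim_insert vec.span_eq_iff[THEN iffD2])
  ultimately show False using dim_matrix_image[OF \<open>det (A - mat c) \<noteq> 0\<close>, of "insert v U"] by simp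
qed

lemma common_eigenvector_mod:
  fixes H :: "('a::alg_closed_field^'n^'n) set"
  assumes U: "vec.subspace U" "\<And>h u. h \<in> H \<Longrightarrow> u \<in> U \<Longrightarrow> h *v u \<in> U"
    and "vec.subspace E" "U \<subset> E" "\<And>h v. h \<in> H \<Longrightarrow> v \<in> E \<Longrightarrow> h *v v \<in> E"
    and "\<And>h k v. h \<in> H \<Longrightarrow> k \<in> H \<Longrightarrow> v \<in> E \<Longrightarrow> h *v (k *v v) - k *v (h *v v) \<in> U"
  shows "\<exists>v. v \<notin> U \<and> (\<forall>h\<in>H. \<exists>c. v \<in> eigenspace_mod U h c)"
  using assms(3-)
proof (induction "vec.dim E" arbitrary: E rule: less_induct)
  case (less E)
  show ?case
  proof (cases "\<forall>h\<in>H. \<exists>c. E \<subseteq> eigenspace_mod U h c")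
    case True
    then show ?thesis using less.prems(2) by blast
  next
    case False
    then obtain h where h: "h \<in> H" "\<And>c. \<not> E \<subseteq> eigenspace_mod U h c" by blast
    obtain w c where w: "w \<in> E" "w \<notin> U" "w \<in> eigenspace_mod U h c"
      using ex_eigenvector_mod[OF U(1) less.prems(1), of h] less.prems(2,3) h(1) by blast
    define F where "F = E \<inter> eigenspace_mod U h c"
    have F: "vec.subspace F"
      unfolding F_def by (intro vec.subspace_inter less.prems(1) subspace_eigenspace_mod U(1))
    have "F \<subset> E" using h(2) by (auto simp: F_def)
    then have "vec.dim F < vec.dim E"
      using F less.prems(1) by (intro vec.dim_psubset) (simp add: vec.span_eq_iff[THEN iffD2])
    moreover have "U \<subset> F"
      using subset_eigenspace_mod[OF U(1), of h c] U(2)[OF h(1)] less.prems(2) w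
      by (auto simp: F_def)
    moreover have "k *v v \<in> F" if k: "k \<in> H" and v: "v \<in> F" for k v
    proof -
      have "k *v (h *v v - c *s v) \<in> U" "h *v (k *v v) - k *v (h *v v) \<in> U"
        using v U(2)[OF k] less.prems(4)[OF h(1) k] by (auto simp: F_def mem_eigenspace_mod)
      from vec.subspace_add[OF U(1) this] show ?thesis
        using less.prems(3)[OF k] v
        by (simp add: F_def mem_eigenspace_mod matrix_vector_mult_diff_distrib vec.scale)
    qed
    moreover have "\<And>h k v. h \<in> H \<Longrightarrow> k \<in> H \<Longrightarrow> v \<in> F \<Longrightarrow> h *v (k *v v) - k *v (h *v v) \<in> U"
      using less.prems(4) by (simp add: F_def)
    ultimately show ?thesis using less.hyps[OF _ F] by blast
  qed
qed

lemma subspace_eq_kernel: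
  fixes U :: "('a::field^'n) set"
  assumes "vec.subspace U"
  obtains F :: "'a^'n^'n" where "\<And>v. v \<in> U \<longleftrightarrow> F *v v = 0"
proof -
  obtain B where B: "B \<subseteq> U" "vec.independent B" "vec.span B = U"
    using vec.maximal_independent_subset[of U] assms by (metis vec.span_minimal subset_antisym)
  obtain B' where B': "B \<subseteq> B'" "vec.independent B'" "UNIV \<subseteq> vec.span B'"
    by (rule vec.maximal_independent_subset_extend[OF subset_UNIV B(2)])
  obtain f where f: "Vector_Spaces.linear (*s) (*s) f" "\<And>x. x \<in> B' \<Longrightarrow> f x = (if x \<in> B then 0 else x)"
    using vec.linear_independent_extend[OF B'(2), of "\<lambda>x. if x \<in> B then 0 else x"] by auto
  interpret f: Vector_Spaces.linear "(*s)" "(*s)" f by (rule f(1))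
  have f_B: "f v = 0" if "v \<in> vec.span B" for v
    using that by (rule f.eq_0_on_span[rotated]) (use f(2) B'(1) in auto)
  have f_compl: "f v = v" if "v \<in> vec.span (B' - B)" for v
    using that by (induction rule: vec.span_induct_alt) (auto simp: f.add f.scale f(2))
  have "v \<in> U" if "f v = 0" for v
  proof -
    have "v \<in> vec.span (B \<union> (B' - B))" using B' by (simp add: Un_absorb1) blast
    then obtain x y where xy: "x \<in> vec.span B" "y \<in> vec.span (B' - B)" "v = x + y"
      unfolding vec.span_Un by blast
    then have "y = 0" using that f_B[OF xy(1)] f_compl[OF xy(2)] by (simp add: f.add)
    then show ?thesis using xy B(3) by simp
  qed
  then have "v \<in> U \<longleftrightarrow> f v = 0" for v using f_B B(3) by auto
  then have "v \<in> U \<longleftrightarrow> matrix f *v v = 0" for v by (simp add: matrix_works[OF f(1)])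
  then show ?thesis by (rule that)
qed

section \<open>The Lie--Kolchin theorem\<close>

definition joined_to_one :: "(complex^'n^'n) set \<Rightarrow> complex^'n^'n \<Rightarrow> bool" where
  "joined_to_one K x \<longleftrightarrow> (\<exists>C\<subseteq>K. connectedin SL_topology C \<and> mat 1 \<in> C \<and> x \<in> C)"

lemma joined_to_one_mult:
  assumes K: "subgroup K SL" and "joined_to_one K x" "joined_to_one K y"
  shows "joined_to_one K (x ** y)"
proof -
  obtain C D where C: "C \<subseteq> K" "connectedin SL_topology C" "mat 1 \<in> C" "x \<in> C"
    and D: "D \<subseteq> K" "connectedin SL_topology D" "mat 1 \<in> D" "y \<in> D"
    using assms(2,3) unfolding joined_to_one_def by blast
  have "x \<in> K" using C by blast
  then have "connectedin SL_topology ((\<lambda>A. x ** A ** mat 1) ` D)"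
    using subgroup.mem_carrier[OF K]
    by (intro connectedin_continuous_map_image[OF continuous_map_SL_sandwich D(2)]) auto
  then have "connectedin SL_topology ((**) x ` D)" by simp
  moreover have "x \<in> (**) x ` D" using D(3) by (intro image_eqI[of _ _ "mat 1"]) auto
  ultimately have "connectedin SL_topology (C \<union> (**) x ` D)"
    using connectedin_Un[OF C(2)] C(4) by blast
  moreover have "(**) x ` D \<subseteq> K" using \<open>x \<in> K\<close> D(1) subgroup.m_closed[OF K] by auto
  ultimately show ?thesis
    unfolding joined_to_one_def using C D by (intro exI[of _ "C \<union> (**) x ` D"]) auto
qed

lemma commutator_in_derived:
  fixes H :: "(complex^'n^'n) set"
  assumes H: "subgroup H SL" and hk: "h \<in> H" "k \<in> H"
  shows "h ** k ** matrix_inv h ** matrix_inv k \<in> derived SL H"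
proof -
  have "h \<otimes>\<^bsub>SL\<^esub> k \<otimes>\<^bsub>SL\<^esub> inv\<^bsub>SL\<^esub> h \<otimes>\<^bsub>SL\<^esub> inv\<^bsub>SL\<^esub> k \<in> derived_set SL H" using hk by blast
  then have "h \<otimes>\<^bsub>SL\<^esub> k \<otimes>\<^bsub>SL\<^esub> inv\<^bsub>SL\<^esub> h \<otimes>\<^bsub>SL\<^esub> inv\<^bsub>SL\<^esub> k \<in> derived SL H"
    unfolding derived_def by (rule generate.incl)
  then show ?thesis using subgroup.mem_carrier[OF H] hk by simp
qed

lemma joined_to_one_commutator:
  fixes H :: "(complex^'n^'n) set"
  assumes H: "subgroup H SL" "connectedin SL_topology H" and hk: "h \<in> H" "k \<in> H"
  shows "joined_to_one (derived SL H) (h ** k ** matrix_inv h ** matrix_inv k)"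
proof -
  let ?f = "\<lambda>A. A ** k ** matrix_inv A ** matrix_inv k"
  have det_H: "det a = 1" if "a \<in> H" for a using subgroup.mem_carrier[OF H(1) that] by simp
  have "connectedin SL_topology (?f ` H)"
    by (rule connectedin_continuous_map_image[OF continuous_map_SL_commutator H(2)])
      (rule det_H[OF hk(2)])
  moreover have "mat 1 \<in> ?f ` H"
    using subgroup.one_closed[OF H(1)] det_H[OF hk(2)] by (intro image_eqI[of _ _ "mat 1"]) auto
  moreover have "?f ` H \<subseteq> derived SL H" using commutator_in_derived[OF H(1) _ hk(2)] by blast
  ultimately show ?thesis unfolding joined_to_one_def using hk(1) by blast
qed

lemma connectedin_derived:
  fixes H :: "(complex^'n^'n) set"
  assumes H: "subgroup H SL" "connectedin SL_topology H"
  shows "connectedin SL_topology (derived SL H)"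
proof -
  let ?D = "derived SL H"
  have D: "subgroup ?D SL" by (rule SL.derived_is_subgroup[OF subgroup.subset[OF H(1)]])
  have det_H: "det h = 1" if "h \<in> H" for h using subgroup.mem_carrier[OF H(1) that] by simp
  have "joined_to_one ?D x" if "x \<in> generate SL (derived_set SL H)" for x
    using that
  proof induction
    case one
    have "connectedin SL_topology {mat 1 :: complex^'n^'n}" by simp
    then show ?case using subgroup.one_closed[OF D] by (auto simp: joined_to_one_def)
  next
    case (incl x)
    then show ?case using joined_to_one_commutator[OF H] det_H by auto
  next
    case (inv x)
    then obtain a b where ab: "a \<in> H" "b \<in> H" "x = a ** b ** matrix_inv a ** matrix_inv b"
      using det_H by auto
    then have "matrix_inv x = b ** a ** matrix_inv b ** matrix_inv a"
      using det_H by (intro matrix_inv_unique) (simp add: matrix_mul_rassoc)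
    then show ?case using joined_to_one_commutator[OF H] ab det_H by (simp add: det_mul)
  next
    case (eng x y)
    then show ?case using joined_to_one_mult[OF D] by simp
  qed
  then have "\<forall>x\<in>?D. \<exists>C. C \<subseteq> ?D \<and> connectedin SL_topology C \<and> mat 1 \<in> C \<and> x \<in> C"
    unfolding joined_to_one_def derived_def[symmetric] by blast
  from bchoice[OF this] obtain C where C: "\<forall>x\<in>?D. C x \<subseteq> ?D \<and>
      connectedin SL_topology (C x) \<and> mat 1 \<in> C x \<and> x \<in> C x" by blast
  have "connectedin SL_topology (\<Union>x\<in>?D. C x)"
    by (rule connectedin_Union) (use C in auto)
  moreover have "(\<Union>x\<in>?D. C x) = ?D" using C by blast
  ultimately show ?thesis by simp
qed

locale connected_group_stabilizing =
  fixes H :: "(complex^'n^'n) set" and U :: "(complex^'n) set"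
  assumes subgroup_H: "subgroup H SL" and connected_H: "connectedin SL_topology H"
    and subspace_U: "vec.subspace U" and stable_U: "h \<in> H \<Longrightarrow> u \<in> U \<Longrightarrow> h *v u \<in> U"
begin

lemma det_H: "h \<in> H \<Longrightarrow> det h = 1"
  using subgroup.mem_carrier[OF subgroup_H] by simp

lemma matrix_inv_closed: "h \<in> H \<Longrightarrow> matrix_inv h \<in> H"
  using subgroup.m_inv_closed[OF subgroup_H] det_H by force

lemma mult_vec_mem_iff:
  assumes "h \<in> H"
  shows "h *v u \<in> U \<longleftrightarrow> u \<in> U"
  using stable_U[OF assms, of u] stable_U[OF matrix_inv_closed[OF assms], of "h *v u"]
    det_H[OF assms]
  by auto

lemma closedin_mem_U:
  assumes "\<And>i. (\<lambda>A. \<phi> A $ i) \<in> poly_funs mat_coords"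
  shows "closedin (subtopology SL_topology H) {h\<in>H. \<phi> h \<in> U}"
proof -
  obtain F :: "complex^'n^'n" where F: "\<And>v. v \<in> U \<longleftrightarrow> F *v v = 0"
    by (rule subspace_eq_kernel[OF subspace_U]) blast
  have "closedin SL_topology {A \<in> carrier SL. F *v \<phi> A = 0}"
    using assms by (intro closedin_SL_vanishing poly_funs_matrix_vector_mult poly_funs.const)
  moreover have "{h\<in>H. \<phi> h \<in> U} = H \<inter> {A \<in> carrier SL. F *v \<phi> A = 0}" using det_H by (auto simp: F)
  ultimately show ?thesis by (auto simp: closedin_subtopology)
qed

lemma eigenspace_mod_conj:
  assumes "h \<in> H" "v \<in> eigenspace_mod U (matrix_inv h ** n ** h) c"
  shows "h *v v \<in> eigenspace_mod U n c"
proof -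
  have "h *v ((matrix_inv h ** n ** h) *v v - c *s v) \<in> U"
    using assms by (intro stable_U) (simp_all add: mem_eigenspace_mod)
  then show ?thesis
    using det_H[OF assms(1)]
    by (simp add: mem_eigenspace_mod matrix_vector_mult_diff_distrib vec.scale
      flip: matrix_vector_mul_assoc)
qed

end

locale group_with_weight_vector = connected_group_stabilizing H U
  for H :: "(complex^'n^'n) set" and U :: "(complex^'n) set" +
  fixes N :: "(complex^'n^'n) set" and wt :: "complex^'n^'n \<Rightarrow> complex" and v0 :: "complex^'n"
  assumes subset_H: "N \<subseteq> H"
    and conj_closed: "h \<in> H \<Longrightarrow> n \<in> N \<Longrightarrow> matrix_inv h ** n ** h \<in> N"
    and commutator_closed: "h \<in> H \<Longrightarrow> k \<in> H \<Longrightarrow> h ** k ** matrix_inv h ** matrix_inv k \<in> N"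
    and not_in_U: "v0 \<notin> U" and weight_vector: "n \<in> N \<Longrightarrow> v0 \<in> eigenspace_mod U n (wt n)"
begin

definition weight_space :: "(complex^'n) set" where
  "weight_space = (\<Inter>n\<in>N. eigenspace_mod U n (wt n))"

lemma subspace_weight_space: "vec.subspace weight_space"
  unfolding weight_space_def
  using subspace_eigenspace_mod[OF subspace_U] by (intro vec.subspace_Inter) auto

lemma v0_in_weight_space: "v0 \<in> weight_space"
  using weight_vector by (simp add: weight_space_def)

text \<open>The weight of the conjugate of \<open>n\<close> by \<open>h\<close> is an eigenvalue of \<open>n\<close> modulo \<open>U\<close>, hence takes
  finitely many values as \<open>h\<close> ranges over the connected group \<open>H\<close>.\<close>

lemma weight_conj:
  assumes n: "n \<in> N" and h: "h \<in> H"
  shows "wt (matrix_inv h ** n ** h) = wt n"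
proof -
  define c where "c h = wt (matrix_inv h ** n ** h)" for h
  have eigen: "h *v v0 \<in> eigenspace_mod U n (c h)" if "h \<in> H" for h
    unfolding c_def
    using that weight_vector[OF conj_closed[OF that n]] by (rule eigenspace_mod_conj)
  have nonzero: "h *v v0 \<notin> U" if "h \<in> H" for h using mult_vec_mem_iff[OF that] not_in_U by simp
  have "c h = c (mat 1)"
  proof (rule connectedin_finite_valued_constant[OF connected_H])
    have "det (n - mat (c h)) = 0" if "h \<in> H" for h
      using subset_H n
      by (intro eigenvalue_mod_is_eigenvalue[OF subspace_U stable_U nonzero[OF that]
          eigen[OF that]]) auto
    then have "c ` H \<subseteq> {c. det (n - mat c) = 0}" by blast
    then show "finite (c ` H)" using finite_eigenvalues finite_subset by blast
    fix z
    have "c h = z \<longleftrightarrow> n *v (h *v v0) - z *s (h *v v0) \<in> U" if "h \<in> H" for h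
      using eigen[OF that] scalar_mod_unique[OF subspace_U nonzero[OF that]]
      unfolding mem_eigenspace_mod by blast
    then have "{h\<in>H. c h = z} = {h\<in>H. (n - mat z) *v (h *v v0) \<in> U}"
      by (auto simp: matrix_vector_mult_diff_rdistrib)
    then show "closedin (subtopology SL_topology H) {h\<in>H. c h = z}"
      by (simp only:) (intro closedin_mem_U poly_funs_matrix_vector_mult poly_funs.const
        poly_funs_mat_coord)
  qed (use h subgroup.one_closed[OF subgroup_H] in auto)
  then show ?thesis by (simp add: c_def)
qed

lemma weight_space_stable:
  assumes h: "h \<in> H" and v: "v \<in> weight_space"
  shows "h *v v \<in> weight_space"
  unfolding weight_space_def
proof
  fix n assume n: "n \<in> N"
  have "v \<in> eigenspace_mod U (matrix_inv h ** n ** h) (wt n)"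
    using v conj_closed[OF h n] weight_conj[OF n h] unfolding weight_space_def by force
  then show "h *v v \<in> eigenspace_mod U n (wt n)" by (rule eigenspace_mod_conj[OF h])
qed

lemma commute_up_to_weight:
  assumes hk: "h \<in> H" "k \<in> H" and v: "v \<in> weight_space"
  shows "h *v (k *v v) - wt (h ** k ** matrix_inv h ** matrix_inv k) *s (k *v (h *v v)) \<in> U"
proof -
  have "k *v (h *v v) \<in> eigenspace_mod U (h ** k ** matrix_inv h ** matrix_inv k)
      (wt (h ** k ** matrix_inv h ** matrix_inv k))"
    using weight_space_stable hk v commutator_closed[OF hk] unfolding weight_space_def by blast
  then show ?thesis
    using det_H hk by (simp add: mem_eigenspace_mod flip: matrix_vector_mul_assoc)
qed

lemma finite_commutator_weights:
  assumes k: "k \<in> H"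
  shows "finite ((\<lambda>h. wt (h ** k ** matrix_inv h ** matrix_inv k)) ` H)" (is "finite (?c ` H)")
proof -
  obtain w l where w: "w \<in> weight_space" "w \<notin> U" "w \<in> eigenspace_mod U k l"
    using ex_eigenvector_mod[OF subspace_U subspace_weight_space weight_space_stable[OF k]]
      v0_in_weight_space not_in_U by blast
  have "k *v w \<notin> U" using w(2) mult_vec_mem_iff[OF k] by simp
  then have "l \<noteq> 0" using w(3) by (auto simp: mem_eigenspace_mod)
  have "?c h \<in> (\<lambda>m. l / m) ` {c. det (k - mat c) = 0}" if h: "h \<in> H" for h
  proof -
    have "h *v (k *v w) - l *s (h *v w) \<in> U"
      using stable_U[OF h, of "k *v w - l *s w"] w(3)
      by (simp add: mem_eigenspace_mod matrix_vector_mult_diff_distrib vec.scale)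
    from vec.subspace_diff[OF subspace_U commute_up_to_weight[OF h k w(1)] this]
    have diff: "l *s (h *v w) - ?c h *s (k *v (h *v w)) \<in> U" by simp
    have hw: "h *v w \<notin> U" using mult_vec_mem_iff[OF h] w(2) by simp
    have "?c h \<noteq> 0"
    proof
      assume "?c h = 0"
      then have "l *s (h *v w) \<in> U" using diff by simp
      then show False using hw vec_subspace_scale_iff[OF subspace_U \<open>l \<noteq> 0\<close>] by simp
    qed
    have "- inverse (?c h) *s (l *s (h *v w) - ?c h *s (k *v (h *v w))) \<in> U"
      by (rule vec.subspace_scale[OF subspace_U diff])
    then have "h *v w \<in> eigenspace_mod U k (l / ?c h)"
      using \<open>?c h \<noteq> 0\<close>
      by (simp add: mem_eigenspace_mod vec.scale_right_diff_distrib field_simps)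
    then have "det (k - mat (l / ?c h)) = 0"
      using stable_U[OF k] by (intro eigenvalue_mod_is_eigenvalue[OF subspace_U _ hw])
    then show ?thesis using \<open>l \<noteq> 0\<close> by (intro image_eqI[of _ _ "l / ?c h"]) simp_all
  qed
  then have "?c ` H \<subseteq> (\<lambda>m. l / m) ` {c. det (k - mat c) = 0}" by blast
  then show ?thesis using finite_eigenvalues finite_subset by blast
qed

lemma commute_on_weight_space:
  assumes h: "h \<in> H" and k: "k \<in> H" and v: "v \<in> weight_space"
  shows "h *v (k *v v) - k *v (h *v v) \<in> U"
proof -
  define c where "c h = wt (h ** k ** matrix_inv h ** matrix_inv k)" for h
  have commute: "h *v (k *v v) - c h *s (k *v (h *v v)) \<in> U" if "h \<in> H" "v \<in> weight_space" for h v
    unfolding c_def by (rule commute_up_to_weight[OF that(1) k that(2)])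
  have nonzero: "k *v (h *v v0) \<notin> U" if "h \<in> H" for h
    using mult_vec_mem_iff[OF k] mult_vec_mem_iff[OF that] not_in_U by simp
  have one: "mat 1 \<in> H" using subgroup.one_closed[OF subgroup_H] by simp
  have "c h = c (mat 1)"
  proof (rule connectedin_finite_valued_constant[OF connected_H])
    show "finite (c ` H)" unfolding c_def by (rule finite_commutator_weights[OF k])
    fix z
    have "c h = z \<longleftrightarrow> h *v (k *v v0) - z *s (k *v (h *v v0)) \<in> U" if "h \<in> H" for h
      using commute[OF that v0_in_weight_space] scalar_mod_unique[OF subspace_U nonzero[OF that]]
      by blast
    then have "{h\<in>H. c h = z} = {h\<in>H. h *v (k *v v0) - (mat z ** k) *v (h *v v0) \<in> U}"
      by (auto simp flip: matrix_vector_mul_assoc)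
    then show "closedin (subtopology SL_topology H) {h\<in>H. c h = z}"
      by (simp only:, intro closedin_mem_U, unfold vector_minus_component)
        (intro poly_funs_diff poly_funs_matrix_vector_mult poly_funs.const poly_funs_mat_coord)
  qed (use h one in auto)
  moreover have "c (mat 1) = 1"
    using commute[OF one v0_in_weight_space] vec.subspace_0[OF subspace_U]
    by (intro scalar_mod_unique[OF subspace_U nonzero[OF one], of "k *v v0"]) simp_all
  ultimately show ?thesis using commute[OF h v] by simp
qed

lemma ex_common_eigenvector_mod: "\<exists>v. v \<notin> U \<and> (\<forall>h\<in>H. \<exists>c. v \<in> eigenspace_mod U h c)"
proof (rule common_eigenvector_mod[OF subspace_U stable_U subspace_weight_space])
  have "U \<subseteq> weight_space"
    unfolding weight_space_def
    using subset_H by (intro INT_greatest subset_eigenspace_mod[OF subspace_U stable_U]) auto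
  then show "U \<subset> weight_space" using v0_in_weight_space not_in_U by blast
qed (auto intro: weight_space_stable commute_on_weight_space)

end

lemma Lie_Kolchin_vector:
  fixes H :: "(complex^'n^'n) set"
  assumes "connected_group_stabilizing H U" "(derived SL ^^ m) H = {mat 1}" "U \<noteq> UNIV"
  shows "\<exists>v. v \<notin> U \<and> (\<forall>h\<in>H. \<exists>c. v \<in> eigenspace_mod U h c)"
  using assms(1,2)
proof (induction m arbitrary: H)
  case 0
  interpret connected_group_stabilizing H U by fact
  obtain v where "v \<notin> U" using assms(3) by blast
  moreover have "v \<in> eigenspace_mod U h 1" if "h \<in> H" for h
    using 0 that vec.subspace_0[OF subspace_U] by (simp add: mem_eigenspace_mod)
  ultimately show ?case by blast
next
  case (Suc m)
  interpret connected_group_stabilizing H U by fact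
  let ?D = "derived SL H"
  have D_H: "?D \<subseteq> H" by (rule SL.derived_incl[OF _ subgroup_H]) simp
  have "connected_group_stabilizing ?D U"
    using SL.derived_is_subgroup[OF subgroup.subset[OF subgroup_H]]
      connectedin_derived[OF subgroup_H connected_H] subspace_U stable_U D_H
    by (auto simp: connected_group_stabilizing_def)
  moreover have "(derived SL ^^ m) ?D = {mat 1}" using Suc.prems(2) by (simp add: funpow_swap1)
  ultimately obtain v0 where v0: "v0 \<notin> U" "\<forall>n\<in>?D. \<exists>c. v0 \<in> eigenspace_mod U n c"
    using Suc.IH by blast
  from bchoice[OF v0(2)] obtain wt where wt: "\<forall>n\<in>?D. v0 \<in> eigenspace_mod U n (wt n)" ..
  interpret normal ?D "SL\<lparr>carrier := H\<rparr>" by (rule SL.derived_subgroup_is_normal[OF subgroup_H])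
  have "matrix_inv h ** n ** h \<in> ?D" if "h \<in> H" "n \<in> ?D" for h n
    using inv_op_closed1[of h n] that SL.m_inv_consistent[OF subgroup_H that(1)] det_H[OF that(1)]
    by simp
  moreover have "h ** k ** matrix_inv h ** matrix_inv k \<in> ?D" if "h \<in> H" "k \<in> H" for h k
    using that by (rule commutator_in_derived[OF subgroup_H])
  ultimately interpret group_with_weight_vector H U ?D wt v0
    using D_H v0(1) wt by unfold_locales auto
  show ?case by (rule ex_common_eigenvector_mod)
qed

lemma stable_span_insert:
  fixes A :: "'a::field^'n^'n"
  assumes stable: "\<And>u. u \<in> vec.span S \<Longrightarrow> A *v u \<in> vec.span S"
    and v: "v \<in> eigenspace_mod (vec.span S) A c" and u: "u \<in> vec.span (insert v S)"
  shows "A *v u \<in> vec.span (insert v S)"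
proof -
  obtain k where k: "u - k *s v \<in> vec.span S" using u by (auto simp: vec.span_insert)
  have "A *v (u - k *s v) + k *s (A *v v - c *s v) \<in> vec.span S"
    using stable[OF k] v by (intro vec.span_add vec.span_scale) (auto simp: mem_eigenspace_mod)
  then have "A *v u - (k * c) *s v \<in> vec.span S"
    by (simp add: matrix_vector_mult_diff_distrib vec.scale vec.scale_right_diff_distrib)
  then show ?thesis by (auto simp: vec.span_insert)
qed

lemma ex_stable_flag_vectors:
  fixes H :: "('a::field^'n^'n) set"
  assumes extend: "\<And>U. vec.subspace U \<Longrightarrow> (\<And>h u. h \<in> H \<Longrightarrow> u \<in> U \<Longrightarrow> h *v u \<in> U) \<Longrightarrow> U \<noteq> UNIV
      \<Longrightarrow> \<exists>v. v \<notin> U \<and> (\<forall>h\<in>H. \<exists>c. v \<in> eigenspace_mod U h c)"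
    and "k \<le> CARD('n)"
  shows "\<exists>w. vec.dim (w ` {..<k}) = k \<and>
    (\<forall>j\<le>k. \<forall>h\<in>H. \<forall>u\<in>vec.span (w ` {..<j}). h *v u \<in> vec.span (w ` {..<j}))"
  using assms(2)
proof (induction k)
  case (Suc k)
  then obtain w :: "nat \<Rightarrow> 'a^'n" where dim: "vec.dim (w ` {..<k}) = k"
    and stable: "\<And>j h u. j \<le> k \<Longrightarrow> h \<in> H \<Longrightarrow> u \<in> vec.span (w ` {..<j}) \<Longrightarrow> h *v u \<in> vec.span (w ` {..<j})"
    by auto
  let ?U = "vec.span (w ` {..<k})"
  have "vec.dim ?U \<noteq> vec.dim (UNIV :: ('a^'n) set)"
    using dim Suc.prems by (simp add: vec_dim_card card_cart_basis)
  then have "?U \<noteq> UNIV" by metis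
  then obtain v where v: "v \<notin> ?U" "\<forall>h\<in>H. \<exists>c. v \<in> eigenspace_mod ?U h c"
    using extend[of ?U] stable by auto
  define w' where "w' = w(k := v)"
  have old: "w' ` {..<j} = w ` {..<j}" if "j \<le> k" for j using that by (auto simp: w'_def)
  have new: "w' ` {..<Suc k} = insert v (w ` {..<k})" by (auto simp: lessThan_Suc w'_def)
  have "h *v u \<in> vec.span (w' ` {..<j})"
    if "j \<le> Suc k" "h \<in> H" "u \<in> vec.span (w' ` {..<j})" for j h u
  proof (cases "j = Suc k")
    case True
    obtain c where "v \<in> eigenspace_mod ?U h c" using v(2) \<open>h \<in> H\<close> by blast
    then show ?thesis
      using stable_span_insert[of "w ` {..<k}" h v c u] stable \<open>h \<in> H\<close> that(3)
      by (simp only: True new)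
  next
    case False
    then show ?thesis using that stable[of j h u] old[of j] by simp
  qed
  moreover have "vec.dim (w' ` {..<Suc k}) = Suc k" using v(1) dim by (simp add: new vec.dim_insert)
  ultimately show ?case by blast
qed simp

lemma flag_space_eq_span:
  fixes w :: "nat \<Rightarrow> 'a::field^'n"
  assumes "k \<le> CARD('n)"
  shows "flag_space (\<chi> i j. w (idx j) $ i) k = vec.span (w ` {..<k})"
proof -
  let ?W = "(\<chi> i j. w (idx j) $ i) :: 'a^'n^'n"
  have axis: "?W *v axis j 1 = w (idx j)" for j by (simp add: vec_eq_iff matrix_vector_mult_axis)
  have "m \<in> idx ` {j::'n. idx j < k}" if "m < k" for m
    using idx_surj[where 'n='n, of m] that assms by (metis imageI less_le_trans mem_Collect_eq)
  then have "{..<k} = idx ` {j::'n. idx j < k}" by auto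
  then have "w ` {..<k} = (\<lambda>j. ?W *v axis j 1) ` {j. idx j < k}" by (simp add: axis image_image)
  then show ?thesis
    by (simp add: flag_space_def std_flag_def coord_space_eq_span image_image flip: vec.span_image)
qed

lemma ex_stable_full_flag:
  fixes H :: "('a::field^'n^'n) set"
  assumes "\<And>U. vec.subspace U \<Longrightarrow> (\<And>h u. h \<in> H \<Longrightarrow> u \<in> U \<Longrightarrow> h *v u \<in> U) \<Longrightarrow> U \<noteq> UNIV
      \<Longrightarrow> \<exists>v. v \<notin> U \<and> (\<forall>h\<in>H. \<exists>c. v \<in> eigenspace_mod U h c)"
  obtains W where "det W = 1" "\<And>h k. h \<in> H \<Longrightarrow> (*v) h ` flag_space W k \<subseteq> flag_space W k"
proof -
  obtain w :: "nat \<Rightarrow> 'a^'n" where dim: "vec.dim (w ` {..<CARD('n)}) = CARD('n)"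
    and stable: "\<And>j h u. j \<le> CARD('n) \<Longrightarrow> h \<in> H \<Longrightarrow> u \<in> vec.span (w ` {..<j}) \<Longrightarrow>
      h *v u \<in> vec.span (w ` {..<j})"
    using ex_stable_flag_vectors[OF assms, of "CARD('n)"] by auto
  define W :: "'a^'n^'n" where "W = (\<chi> i j. w (idx j) $ i)"
  have W: "flag_space W k = vec.span (w ` {..<k})" if "k \<le> CARD('n)" for k
    unfolding W_def by (rule flag_space_eq_span[OF that])
  have "range ((*v) W) = UNIV"
  proof -
    have "vec.dim (range ((*v) W)) = vec.dim (UNIV :: ('a^'n) set)"
      using W[of "CARD('n)"] dim by (simp add: flag_space_def vec_dim_card card_cart_basis)
    then show ?thesis using vec.subspace_dim_equal[of "range ((*v) W)" UNIV] by simp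
  qed
  then have "det W \<noteq> 0"
    by (metis invertible_det_nz invertible_right_inverse matrix_right_invertible_surjective)
  obtain i0 :: 'n where "idx i0 = 0" using idx_surj[of 0] by auto
  let ?W = "scale_column i0 (inverse (det W)) W"
  have "(*v) h ` flag_space ?W k \<subseteq> flag_space ?W k" if "h \<in> H" for h k
  proof (cases "k \<le> CARD('n)")
    case True
    then show ?thesis
      using stable[OF True that] W[OF True] \<open>det W \<noteq> 0\<close> by (auto simp: flag_space_scale_column)
  qed (use \<open>det W \<noteq> 0\<close> in simp)
  then show thesis using that[of ?W] \<open>det W \<noteq> 0\<close> by simp
qed

theorem Lie_Kolchin:
  fixes H :: "(complex^'n^'n) set"
  assumes "conn_solv_subgroup H"
  obtains W where "det W = 1" "H \<subseteq> flag_stabilizer W UNIV"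
proof -
  have H: "subgroup H SL" "connectedin SL_topology H" "solvable (SL\<lparr>carrier := H\<rparr>)"
    using assms by (auto simp: conn_solv_subgroup_def)
  obtain m where m: "(derived SL ^^ m) H = {mat 1}" using H by (auto simp: SL.solvable_subgroup_iff)
  obtain W where W: "det W = 1" "\<And>h k. h \<in> H \<Longrightarrow> (*v) h ` flag_space W k \<subseteq> flag_space W k"
  proof (rule ex_stable_full_flag[of H])
    fix U :: "(complex^'n) set"
    assume "vec.subspace U" "\<And>h u. h \<in> H \<Longrightarrow> u \<in> U \<Longrightarrow> h *v u \<in> U" "U \<noteq> UNIV"
    then show "\<exists>v. v \<notin> U \<and> (\<forall>h\<in>H. \<exists>c. v \<in> eigenspace_mod U h c)"
      using H m by (intro Lie_Kolchin_vector) (auto simp: connected_group_stabilizing_def)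
  qed blast
  have det_H: "det h = 1" if "h \<in> H" for h using subgroup.mem_carrier[OF H(1) that] by simp
  have "(*v) h ` flag_space W k = flag_space W k" if "h \<in> H" for h k
    using W(2)[OF that] det_H[OF that] by (intro matrix_image_eq_of_subset) auto
  then have "H \<subseteq> flag_stabilizer W UNIV" using det_H by (auto simp: flag_stabilizer_def)
  then show thesis using that W(1) by blast
qed

theorem borel_subgroup_eq_flag_stabilizer:
  fixes B :: "(complex^'n^'n) set"
  assumes "borel_subgroup B"
  obtains W where "det W = 1" "B = flag_stabilizer W UNIV"
proof -
  have B: "conn_solv_subgroup B" "\<And>H. conn_solv_subgroup H \<Longrightarrow> B \<subseteq> H \<Longrightarrow> H = B"
    using assms by (auto simp: borel_subgroup_def)
  obtain W where W: "det W = 1" "B \<subseteq> flag_stabilizer W UNIV" by (rule Lie_Kolchin[OF B(1)])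
  then show thesis using B(2)[OF conn_solv_full_flag_stabilizer] that by blast
qed

section \<open>Monomial matrices and the Bruhat decomposition\<close>

definition monomial_matrix :: "('n \<Rightarrow> 'm) \<Rightarrow> 'a::zero^'n^'m \<Rightarrow> bool" where
  "monomial_matrix \<tau> A \<longleftrightarrow> (\<forall>r c. A $ r $ c \<noteq> 0 \<longleftrightarrow> r = \<tau> c)"

lemma monomial_matrix_eq_0_iff: "monomial_matrix \<tau> A \<Longrightarrow> A $ r $ c = 0 \<longleftrightarrow> r \<noteq> \<tau> c"
  unfolding monomial_matrix_def by blast

lemma monomial_matrix_mult_axis:
  fixes A :: "'a::field^'n^'m"
  assumes "monomial_matrix \<tau> A"
  shows "A *v axis j c = axis (\<tau> j) (A $ \<tau> j $ j * c)"
  by (simp add: vec_eq_iff matrix_vector_mult_axis axis_nth_if monomial_matrix_eq_0_iff[OF assms])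

lemma monomial_matrix_axisI:
  fixes A :: "'a::comm_semiring_1^'n^'m"
  assumes "\<And>j. \<exists>c. c \<noteq> 0 \<and> A *v axis j 1 = axis (\<tau> j) c"
  shows "monomial_matrix \<tau> A"
  unfolding monomial_matrix_def
proof (intro allI)
  fix r j
  obtain c where "c \<noteq> 0" "A *v axis j 1 = axis (\<tau> j) c" using assms by blast
  then show "A $ r $ j \<noteq> 0 \<longleftrightarrow> r = \<tau> j"
    using matrix_vector_mult_axis[of A j 1 r] by (auto simp: axis_nth_if split: if_splits)
qed

lemma monomial_matrix_mult:
  fixes A B :: "'a::field^'n^'n"
  assumes A: "monomial_matrix \<sigma> A" and B: "monomial_matrix \<tau> B"
  shows "monomial_matrix (\<sigma> \<circ> \<tau>) (A ** B)"
proof (rule monomial_matrix_axisI)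
  fix j
  have "(A ** B) *v axis j 1 = axis ((\<sigma> \<circ> \<tau>) j) (A $ \<sigma> (\<tau> j) $ \<tau> j * B $ \<tau> j $ j)"
    using A B by (simp add: monomial_matrix_mult_axis flip: matrix_vector_mul_assoc)
  then show "\<exists>c. c \<noteq> 0 \<and> (A ** B) *v axis j 1 = axis ((\<sigma> \<circ> \<tau>) j) c"
    by (intro exI conjI)
      (simp_all add: monomial_matrix_eq_0_iff[OF A] monomial_matrix_eq_0_iff[OF B])
qed

lemma monomial_matrix_inv:
  fixes A :: "'a::field^'n^'n"
  assumes A: "monomial_matrix \<sigma> A" and "bij \<sigma>" "det A \<noteq> 0"
  shows "monomial_matrix (inv_into UNIV \<sigma>) (matrix_inv A)"
proof (rule monomial_matrix_axisI)
  fix j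
  let ?i = "inv_into UNIV \<sigma> j"
  have j: "\<sigma> ?i = j" using assms(2) by (simp add: bij_is_surj surj_f_inv_f)
  define c where "c = A $ j $ ?i"
  have "c \<noteq> 0" by (simp add: c_def j monomial_matrix_eq_0_iff[OF A])
  then have "A *v axis ?i (inverse c) = axis j 1"
    using monomial_matrix_mult_axis[OF A, of ?i] by (simp add: j c_def)
  then have "matrix_inv A *v axis j 1 = axis ?i (inverse c)"
    using matrix_inv_cancel(4)[OF assms(3)] by metis
  then show "\<exists>d. d \<noteq> 0 \<and> matrix_inv A *v axis j 1 = axis ?i d"
    using \<open>c \<noteq> 0\<close> by (intro exI[of _ "inverse c"]) simp
qed

lemma ex_monomial_matrix:
  fixes \<sigma> :: "'n::finite \<Rightarrow> 'n" and d :: "'a::field"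
  assumes "bij \<sigma>" "d \<noteq> 0"
  obtains m :: "'a^'n^'n" where "det m = d" "monomial_matrix \<sigma> m"
proof -
  define p :: "'a^'n^'n" where "p = (\<chi> i j. if i = \<sigma> j then 1 else 0)"
  have "(p *v v) $ \<sigma> j = v $ j" for v j
    using bij_is_inj[OF assms(1)]
    by (simp add: p_def matrix_vector_mult_def inj_eq if_distrib[of "\<lambda>x. x * _"] cong: if_cong)
  then have "v = 0" if "p *v v = 0" for v using that by (simp add: vec_eq_iff) metis
  then have det: "det p \<noteq> 0" using det_eq_0_iff_kernel by blast
  obtain i0 :: 'n where True by simp
  show thesis
  proof (rule that)
    show "det (scale_column i0 (d / det p) p) = d" using det by simp
    show "monomial_matrix \<sigma> (scale_column i0 (d / det p) p)"
      using det assms(2) by (simp add: monomial_matrix_def p_def)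
  qed
qed

lemma monomial_image_subset_iff:
  assumes "monomial_matrix \<tau> m"
  shows "(*v) m ` coord_space I \<subseteq> coord_space J \<longleftrightarrow> \<tau> ` I \<subseteq> J"
  unfolding matrix_image_coord_space_subset_iff by (auto simp: monomial_matrix_eq_0_iff[OF assms])

lemma monomial_image_coord_space:
  fixes m :: "'a::field^'n^'n"
  assumes "monomial_matrix \<tau> m" "bij \<tau>" "det m \<noteq> 0"
  shows "(*v) m ` coord_space I = coord_space (\<tau> ` I)"
proof (rule matrix_image_eq_of_subset)
  have "inj_on \<tau> I" using assms(2) by (meson bij_is_inj inj_on_subset subset_UNIV)
  then show "vec.dim (coord_space I :: ('a^'n) set) = vec.dim (coord_space (\<tau> ` I) :: ('a^'n) set)"
    by (simp add: card_image)
qed (simp_all add: assms monomial_image_subset_iff[OF assms(1)])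

definition count_below :: "'n::finite set \<Rightarrow> nat \<Rightarrow> nat" where
  "count_below I j = card {i\<in>I. idx i < j}"

lemma count_below_0 [simp]: "count_below I 0 = 0"
  by (simp add: count_below_def)

lemma count_below_top [simp]: "count_below (I :: 'n::finite set) CARD('n) = card I"
  by (simp add: count_below_def)

lemma count_below_Suc_idx:
  "count_below I (Suc (idx i)) = count_below I (idx i) + (if i \<in> I then 1 else 0)"
proof -
  have "{l\<in>I. idx l < Suc (idx i)} = {l\<in>I. idx l < idx i} \<union> (if i \<in> I then {i} else {})"
    using less_Suc_eq[of _ "idx i"] by auto
  then show ?thesis by (auto simp: count_below_def card_insert_if)
qed

definition pivots :: "('a::field^'n) set \<Rightarrow> 'n set" where
  "pivots E = {i. \<exists>v\<in>E. v \<in> std_flag (Suc (idx i)) \<and> v $ i \<noteq> 0}"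

lemma pivots_mono: "E \<subseteq> F \<Longrightarrow> pivots E \<subseteq> pivots F"
  by (auto simp: pivots_def)

lemma dim_Int_std_flag_Suc_idx:
  fixes E :: "('a::field^'n) set"
  assumes E: "vec.subspace E"
  shows "vec.dim (E \<inter> std_flag (Suc (idx i)))
    = vec.dim (E \<inter> std_flag (idx i)) + (if i \<in> pivots E then 1 else 0)"
proof (cases "i \<in> pivots E")
  case True
  then obtain v where v: "v \<in> E" "v \<in> std_flag (Suc (idx i))" "v $ i \<noteq> 0" by (auto simp: pivots_def)
  have sub: "vec.subspace (E \<inter> std_flag l)" for l using E by (simp add: vec.subspace_inter)
  let ?S = "E \<inter> std_flag (idx i)" and ?T = "E \<inter> std_flag (Suc (idx i))"
  have "?T = vec.span (insert v ?S)"
  proof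
    show "?T \<subseteq> vec.span (insert v ?S)"
    proof
      fix u assume u: "u \<in> ?T"
      have "u - (u $ i / v $ i) *s v \<in> ?T"
        using u v(1,2) by (intro vec.subspace_diff[OF sub] vec.subspace_scale[OF sub]) auto
      moreover have "(u - (u $ i / v $ i) *s v) $ i = 0" using v(3) by simp
      ultimately have "u - (u $ i / v $ i) *s v \<in> ?S" using in_std_flag_idx_iff by blast
      then show "u \<in> vec.span (insert v ?S)" by (auto simp: vec.span_insert intro: vec.span_base)
    qed
    show "vec.span (insert v ?S) \<subseteq> ?T"
      using v(1,2) std_flag_mono[of "idx i" "Suc (idx i)", where 'b='n]
      by (intro vec.span_minimal sub) auto
  qed
  then have "vec.dim ?T = vec.dim (insert v ?S)" by simp
  moreover have "v \<notin> ?S" using v(3) by (auto simp: mem_std_flag)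
  ultimately show ?thesis using True sub by (simp add: vec.dim_insert vec.span_eq_iff[THEN iffD2])
next
  case False
  then have "v \<in> std_flag (idx i)" if "v \<in> E" "v \<in> std_flag (Suc (idx i))" for v
    using that in_std_flag_idx_iff[of v i] by (auto simp: pivots_def)
  then have "E \<inter> std_flag (Suc (idx i)) = E \<inter> std_flag (idx i)"
    using std_flag_mono[of "idx i" "Suc (idx i)", where 'b='n] by auto
  then show ?thesis using False by simp
qed

lemma dim_Int_std_flag:
  fixes E :: "('a::field^'n) set"
  assumes "vec.subspace E" "k \<le> CARD('n)"
  shows "vec.dim (E \<inter> std_flag k) = count_below (pivots E) k"
  using assms(2)
proof (induction k)
  case 0
  have "E \<inter> std_flag 0 = {0}" using vec.subspace_0[OF assms(1)] by auto
  then show ?case by simp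
next
  case (Suc k)
  then obtain i :: 'n where "idx i = k" using idx_surj[where 'n='n, of k] by auto
  then show ?case
    using Suc dim_Int_std_flag_Suc_idx[OF assms(1), of i] count_below_Suc_idx[of "pivots E" i]
    by simp
qed

lemma card_pivots:
  fixes E :: "('a::field^'n) set"
  assumes "vec.subspace E"
  shows "card (pivots E) = vec.dim E"
  using dim_Int_std_flag[OF assms order_refl] by simp

lemma bij_of_card_less:
  fixes s :: "'n::finite \<Rightarrow> nat"
  assumes card: "\<And>j. j \<le> CARD('n) \<Longrightarrow> card {i. s i < j} = j"
  obtains \<sigma> :: "'n \<Rightarrow> 'n" where "bij \<sigma>" "\<And>i. idx (\<sigma> i) = s i"
proof -
  have "j \<in> range s" if "j < CARD('n)" for j
  proof (rule ccontr)
    assume "j \<notin> range s"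
    then have "{i. s i < Suc j} = {i. s i < j}" by (auto simp: less_Suc_eq)
    then show False using card[of j] card[of "Suc j"] that by simp
  qed
  then have sub: "{..<CARD('n)} \<subseteq> range s" by auto
  then have "card (range s) = CARD('n)" using card_image_le[of UNIV s] card_mono[OF _ sub] by simp
  then have "range s = {..<CARD('n)}" "inj s"
    using card_subset_eq[OF _ sub] by (auto intro: eq_card_imp_inj_on)
  then have s: "bij_betw s UNIV {..<CARD('n)}" by (simp add: bij_betw_def)
  define \<sigma> :: "'n \<Rightarrow> 'n" where "\<sigma> = inv_into UNIV idx \<circ> s"
  have "bij \<sigma>" unfolding \<sigma>_def by (rule bij_betw_trans[OF s bij_betw_inv_into[OF bij_betw_idx]])
  moreover have "idx (\<sigma> i) = s i" for i
    using s bij_betw_idx[where 'n='n] by (auto simp: \<sigma>_def bij_betw_def intro!: f_inv_into_f)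
  ultimately show thesis by (rule that)
qed

lemma ex_pivot_permutation:
  fixes g :: "'a::field^'n^'n"
  assumes "det g \<noteq> 0"
  obtains \<sigma> :: "'n \<Rightarrow> 'n" where "bij \<sigma>" "\<And>i j. i \<in> pivots (flag_space g j) \<longleftrightarrow> idx (\<sigma> i) < j"
proof -
  have "\<exists>s. \<forall>j. i \<in> pivots (flag_space g j) \<longleftrightarrow> s < j" for i
  proof -
    have "i \<notin> pivots (flag_space g 0)" by (auto simp: pivots_def)
    moreover have "i \<in> pivots (flag_space g CARD('n))"
      using assms by (auto simp: pivots_def intro!: exI[of _ "axis i 1"])
    ultimately obtain s
      where "\<forall>j\<le>s. i \<notin> pivots (flag_space g j)" "i \<in> pivots (flag_space g (Suc s))"
      using ex_least_nat_less[of "\<lambda>j. i \<in> pivots (flag_space g j)"] by blast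
    then have "i \<in> pivots (flag_space g j) \<longleftrightarrow> s < j" for j
      using pivots_mono[OF flag_space_mono[of "Suc s" j g]] by (meson Suc_leI not_le subsetD)
    then show ?thesis by blast
  qed
  then obtain s where s: "\<And>i j. i \<in> pivots (flag_space g j) \<longleftrightarrow> s i < j" by metis
  have "card {i. s i < j} = j" if "j \<le> CARD('n)" for j
  proof -
    have "{i. s i < j} = pivots (flag_space g j)" using s by auto
    then show ?thesis using card_pivots[OF subspace_flag_space, of g j] assms that by simp
  qed
  then obtain \<sigma> :: "'n \<Rightarrow> 'n" where \<sigma>: "bij \<sigma>" "\<And>i. idx (\<sigma> i) = s i"
    using bij_of_card_less[of s] by metis
  show thesis by (rule that[OF \<sigma>(1)]) (simp add: \<sigma>(2) s)
qed

lemma ex_upper_adapted_to_flag: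
  fixes g :: "'a::field^'n^'n"
  assumes pivots: "\<And>i. i \<in> pivots (flag_space g (k i))"
  obtains b where "upper b" "det b = 1" "\<And>i. b *v axis i 1 \<in> flag_space g (k i)"
proof -
  have "\<forall>i. \<exists>v. v \<in> flag_space g (k i) \<and> v \<in> std_flag (Suc (idx i)) \<and> v $ i \<noteq> 0"
    using pivots by (auto simp: pivots_def)
  from choice[OF this] obtain v where
    v: "\<And>i. v i \<in> flag_space g (k i) \<and> v i \<in> std_flag (Suc (idx i)) \<and> v i $ i \<noteq> 0" by blast
  define B :: "'a^'n^'n" where "B = (\<chi> r i. v i $ r)"
  have "upper B" using v by (auto simp: upper_def B_def mem_std_flag)
  have "det B \<noteq> 0" unfolding det_upper[OF \<open>upper B\<close>] using v by (simp add: B_def)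
  obtain i0 :: 'n where True by simp
  show thesis
  proof (rule that)
    show "upper (scale_column i0 (inverse (det B)) B)" by (rule upper_scale_column) fact
    show "det (scale_column i0 (inverse (det B)) B) = 1" using \<open>det B \<noteq> 0\<close> by simp
    have "B *v axis i 1 = v i" for i by (simp add: vec_eq_iff matrix_vector_mult_axis B_def)
    then show "scale_column i0 (inverse (det B)) B *v axis i 1 \<in> flag_space g (k i)" for i
      unfolding scale_column_mult_axis
      using v by (simp only:) (intro vec.subspace_scale subspace_flag_space, blast)
  qed
qed

text \<open>The permutation sends \<open>i\<close> to the first step of the flag of \<open>g\<close> that contains a vector with
  last nonzero coordinate \<open>i\<close>; such vectors form a basis adapted to both flags.\<close>

theorem Bruhat_decomposition:
  fixes g :: "'a::field^'n^'n"
  assumes g: "det g \<noteq> 0"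
  obtains b m b' \<tau> where "upper b" "det b = 1" "upper b'" "det b' = 1"
    "bij \<tau>" "monomial_matrix \<tau> m" "g = b ** m ** b'"
proof -
  obtain \<sigma> :: "'n \<Rightarrow> 'n" where \<sigma>: "bij \<sigma>" "\<And>i j. i \<in> pivots (flag_space g j) \<longleftrightarrow> idx (\<sigma> i) < j"
    by (rule ex_pivot_permutation[OF g]) (blast intro: that)
  then obtain b where b: "upper b" "det b = 1" "\<And>i. b *v axis i 1 \<in> flag_space g (Suc (idx (\<sigma> i)))"
    using ex_upper_adapted_to_flag[of g "\<lambda>i. Suc (idx (\<sigma> i))"] by auto
  obtain m :: "'a^'n^'n" where m: "det m = inverse (det g)" "monomial_matrix \<sigma> m"
    using ex_monomial_matrix[OF \<sigma>(1), of "inverse (det g)"] g by auto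
  define c where "c = matrix_inv g ** b ** matrix_inv m"
  have det_c: "det c = 1" using g by (simp add: c_def det_mul m b)
  have c_axis: "c *v axis (\<sigma> i) (m $ \<sigma> i $ i) \<in> std_flag (Suc (idx (\<sigma> i)))" for i
  proof -
    have "c *v axis (\<sigma> i) (m $ \<sigma> i $ i) = c *v (m *v axis i 1)"
      by (simp add: monomial_matrix_mult_axis[OF m(2)])
    also have "\<dots> = matrix_inv g *v (b *v axis i 1)"
      using g by (simp add: c_def m flip: matrix_vector_mul_assoc)
    also have "\<dots> \<in> (*v) (matrix_inv g) ` flag_space g (Suc (idx (\<sigma> i)))"
      by (rule imageI) (rule b(3))
    also have "\<dots> = std_flag (Suc (idx (\<sigma> i)))" using g by (simp add: flag_space_def)
    finally show ?thesis .
  qed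
  then have "c $ r $ \<sigma> i = 0" if "idx (\<sigma> i) < idx r" for r i
  proof -
    have "(c *v axis (\<sigma> i) (m $ \<sigma> i $ i)) $ r = 0"
      using c_axis[of i] that by (simp add: mem_std_flag)
    then show ?thesis by (simp add: matrix_vector_mult_axis monomial_matrix_eq_0_iff[OF m(2)])
  qed
  then have "upper c" unfolding upper_def using \<sigma>(1) by (metis bij_pointE)
  have "g = b ** matrix_inv m ** matrix_inv c"
  proof -
    have "g ** c = b ** matrix_inv m" using g by (simp add: c_def matrix_mul_rassoc)
    then have "g ** c ** matrix_inv c = b ** matrix_inv m ** matrix_inv c" by simp
    then show ?thesis using det_c by (simp add: matrix_mul_rassoc)
  qed
  moreover have "bij (inv_into UNIV \<sigma>)" using \<sigma>(1) by (rule bij_imp_bij_inv)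
  moreover have "monomial_matrix (inv_into UNIV \<sigma>) (matrix_inv m)"
    using m g \<sigma>(1) by (intro monomial_matrix_inv) auto
  moreover have "upper (matrix_inv c)" "det (matrix_inv c) = 1"
    using \<open>upper c\<close> det_c by (simp_all add: upper_matrix_inv)
  ultimately show thesis using that b(1,2) by blast
qed

section \<open>Parabolic subgroups are stabilizers of flags\<close>

definition transvection :: "'n \<Rightarrow> 'n \<Rightarrow> 'a \<Rightarrow> 'a::comm_ring_1^'n^'n" where
  "transvection i j t = (\<chi> r s. (if r = s then 1 else 0) + (if r = i \<and> s = j then t else 0))"

lemma transvection_mult_vec: "transvection i j t *v v = v + axis i (t * v $ j)"
proof -
  have "(\<Sum>s\<in>UNIV. ((if r = s then 1 else 0) + (if r = i \<and> s = j then t else 0)) * v $ s)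
      = (\<Sum>s\<in>UNIV. if s = r then v $ r else 0) + (\<Sum>s\<in>UNIV. if s = j then
        (if r = i then t * v $ j else 0) else 0)" for r
    unfolding sum.distrib[symmetric] by (rule sum.cong) (auto simp: algebra_simps)
  then show ?thesis by (simp add: vec_eq_iff transvection_def matrix_vector_mult_def axis_nth_if)
qed

lemma det_transvection:
  assumes "i \<noteq> j"
  shows "det (transvection i j t) = 1"
proof -
  have "transvection i j t =
      (\<chi> k. if k = i then row i (mat 1) + t *s row j (mat 1) else row k (mat 1))"
    using assms by (auto simp: vec_eq_iff transvection_def row_def mat_def)
  then show ?thesis using det_row_operation[OF assms, of "mat 1" t] by simp
qed

lemma upper_transvection: "idx i < idx j \<Longrightarrow> upper (transvection i j t)"
  by (auto simp: upper_def transvection_def)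

lemma transvection_commutator:
  assumes "i \<noteq> j" "j \<noteq> k" "i \<noteq> k"
  shows "transvection i j 1 ** transvection j k t ** transvection i j (-1) ** transvection j k (-t)
    = transvection i k t"
  by (rule matrix_eq_axisI)
    (use assms in \<open>simp add: transvection_mult_vec axis_nth_if vec_eq_iff
      flip: matrix_vector_mul_assoc\<close>)

lemma monomial_matrix_mult_transvection:
  fixes m :: "'a::field^'n^'n"
  assumes m: "monomial_matrix \<tau> m" and "inj \<tau>"
  shows "m ** transvection i j (t * m $ \<tau> j $ j / m $ \<tau> i $ i) = transvection (\<tau> i) (\<tau> j) t ** m"
proof (rule matrix_eq_axisI)
  fix k
  show "(m ** transvection i j (t * m $ \<tau> j $ j / m $ \<tau> i $ i)) *v axis k 1 =
      (transvection (\<tau> i) (\<tau> j) t ** m) *v axis k 1"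
    using \<open>inj \<tau>\<close> monomial_matrix_eq_0_iff[OF m, of "\<tau> i" i]
    by (auto simp: transvection_mult_vec monomial_matrix_mult_axis[OF m] axis_nth_if inj_eq
        matrix_vector_right_distrib simp flip: matrix_vector_mul_assoc)
qed

lemma monomial_matrix_transposition:
  fixes i j :: "'n::finite"
  assumes "i \<noteq> j"
  shows "monomial_matrix (Transposition.transpose i j)
    (transvection i j 1 ** transvection j i (-1) ** transvection i j 1 :: 'a::field^'n^'n)"
proof (rule monomial_matrix_axisI)
  fix k
  have "(transvection i j 1 ** transvection j i (-1) ** transvection i j 1) *v axis k 1 =
      axis (Transposition.transpose i j k) (if k = i then -1 else 1 :: 'a)"
    using assms
    by (auto simp: transvection_mult_vec vec_eq_iff axis_nth_if Transposition.transpose_def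
        simp flip: matrix_vector_mul_assoc)
  then show "\<exists>c. c \<noteq> 0 \<and>
      (transvection i j 1 ** transvection j i (-1) ** transvection i j 1) *v axis k 1 =
        axis (Transposition.transpose i j k) (c :: 'a)"
    by (intro exI conjI) auto
qed

lemma bij_mem_iff_of_image_subset:
  fixes \<tau> :: "'n::finite \<Rightarrow> 'n"
  assumes "bij \<tau>" "\<tau> ` S \<subseteq> S"
  shows "\<tau> i \<in> S \<longleftrightarrow> i \<in> S"
proof -
  have inj: "inj \<tau>" using assms(1) by (rule bij_is_inj)
  then have "\<tau> ` S = S" using assms(2) by (intro endo_inj_surj) (auto intro: inj_on_subset)
  then show ?thesis using inj_image_mem_iff[OF inj, of i S] by simp
qed

lemma support_transpose_comp_psubset:
  assumes "inj \<tau>" "\<tau> i \<noteq> i"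
  shows "{k. (Transposition.transpose i (\<tau> i) \<circ> \<tau>) k \<noteq> k} \<subset> {k. \<tau> k \<noteq> k}"
proof
  have "k \<noteq> i \<and> k \<noteq> \<tau> i" if "\<tau> k = k" for k using that assms injD[OF assms(1), of k i] by auto
  then have "(Transposition.transpose i (\<tau> i) \<circ> \<tau>) k = k" if "\<tau> k = k" for k
    using that by (simp add: Transposition.transpose_def)
  then show "{k. (Transposition.transpose i (\<tau> i) \<circ> \<tau>) k \<noteq> k} \<subseteq> {k. \<tau> k \<noteq> k}" by blast
  have "(Transposition.transpose i (\<tau> i) \<circ> \<tau>) i = i" by simp
  then show "{k. (Transposition.transpose i (\<tau> i) \<circ> \<tau>) k \<noteq> k} \<noteq> {k. \<tau> k \<noteq> k}"
    using assms(2) by blast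
qed

locale borel_overgroup =
  fixes P :: "(complex^'n^'n) set"
  assumes subgroup_P: "subgroup P SL" and borel_std_subset: "borel_std \<subseteq> P"
begin

lemma det_P: "g \<in> P \<Longrightarrow> det g = 1"
  using subgroup.mem_carrier[OF subgroup_P] by simp

lemma mult_closed: "g \<in> P \<Longrightarrow> h \<in> P \<Longrightarrow> g ** h \<in> P"
  using subgroup.m_closed[OF subgroup_P] by simp

lemma matrix_inv_closed: "g \<in> P \<Longrightarrow> matrix_inv g \<in> P"
  using subgroup.m_inv_closed[OF subgroup_P] det_P by force

lemma Bruhat_factors:
  assumes "det g = 1"
  obtains b m b' \<tau> where "b \<in> borel_std" "b' \<in> borel_std" "bij \<tau>" "monomial_matrix \<tau> m" "det m = 1"
    "g = b ** m ** b'" "m \<in> P \<longleftrightarrow> g \<in> P"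
    "\<And>k. (*v) m ` std_flag k = std_flag k \<longleftrightarrow> (*v) g ` std_flag k = std_flag k"
proof -
  have "det g \<noteq> 0" using assms by simp
  then obtain b m b' \<tau> where b: "upper b" "det b = 1" "upper b'" "det b' = 1"
    and \<tau>: "bij \<tau>" "monomial_matrix \<tau> m" and g: "g = b ** m ** b'"
    by (rule Bruhat_decomposition)
  have borel: "b \<in> borel_std" "b' \<in> borel_std" using b by (simp_all add: borel_std_def)
  have m: "m = matrix_inv b ** g ** matrix_inv b'" using b by (simp add: g matrix_mul_rassoc)
  have "det m = 1" using assms b by (simp add: m det_mul)
  moreover have "m \<in> P \<longleftrightarrow> g \<in> P"
    using borel borel_std_subset g m mult_closed matrix_inv_closed by (metis subsetD)
  moreover have "(*v) m ` std_flag k = std_flag k \<longleftrightarrow> (*v) g ` std_flag k = std_flag k" for k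
  proof -
    have "(*v) c ` std_flag k = std_flag k" if "upper c" "det c = 1" for c :: "complex^'n^'n"
      using flag_space_upper[of c k] that by (simp add: flag_space_def)
    then show ?thesis using b unfolding g matrix_image_mult
      by (metis matrix_inv_image_cancel(2) zero_neq_one)
  qed
  ultimately show thesis using that borel \<tau> g by blast
qed

definition linked :: "'n \<Rightarrow> 'n \<Rightarrow> bool" where
  "linked i j \<longleftrightarrow> i = j \<or> (\<forall>t. transvection i j t \<in> P)"

lemma linkedD: "linked i j \<Longrightarrow> i \<noteq> j \<Longrightarrow> transvection i j t \<in> P"
  by (simp add: linked_def)

lemma linked_of_idx_le:
  assumes "idx i \<le> idx j"
  shows "linked i j"
proof (cases "i = j")
  case False
  then have "transvection i j t \<in> borel_std" for t
    using assms by (simp add: borel_std_def det_transvection upper_transvection le_neq_implies_less)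
  then show ?thesis using borel_std_subset by (auto simp: linked_def)
qed (simp add: linked_def)

lemma linked_trans:
  assumes "linked i j" "linked j k"
  shows "linked i k"
proof (cases "i = j \<or> j = k \<or> i = k")
  case False
  then have "transvection i k t \<in> P" for t
    using transvection_commutator[of i j k t] linkedD[OF assms(1)] linkedD[OF assms(2)]
    by (metis mult_closed)
  then show ?thesis by (simp add: linked_def)
qed (use assms in \<open>auto simp: linked_def\<close>)

lemma linked_monomial:
  assumes "linked i j" and m: "m \<in> P" "monomial_matrix \<tau> m" "bij \<tau>"
  shows "linked (\<tau> i) (\<tau> j)"
proof (cases "i = j")
  case False
  have "transvection (\<tau> i) (\<tau> j) t \<in> P" for t
  proof -
    let ?s = "t * m $ \<tau> j $ j / m $ \<tau> i $ i"
    have "m ** transvection i j ?s ** matrix_inv m = transvection (\<tau> i) (\<tau> j) t"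
      using monomial_matrix_mult_transvection[OF m(2) bij_is_inj[OF m(3)]] det_P[OF m(1)]
      by (simp add: matrix_mul_rassoc)
    moreover have "m ** transvection i j ?s ** matrix_inv m \<in> P"
      using linkedD[OF assms(1) False] m(1) by (intro mult_closed matrix_inv_closed)
    ultimately show ?thesis by simp
  qed
  then show ?thesis by (simp add: linked_def)
qed (simp add: linked_def)

definition stable_steps :: "nat set" where
  "stable_steps = {k. \<forall>h\<in>P. (*v) h ` std_flag k = (std_flag k :: (complex^'n) set)}"

text \<open>A monomial matrix of \<open>P\<close> that does not preserve the standard flag at \<open>k\<close> carries some root
  subgroup of the standard Borel subgroup across the step \<open>k\<close>.\<close>

lemma linked_of_unstable_step:
  assumes k: "k \<notin> stable_steps" and ij: "idx i = k" "Suc (idx j) = k"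
  shows "linked i j"
proof -
  obtain h where h: "h \<in> P" "(*v) h ` std_flag k \<noteq> std_flag k"
    using k by (auto simp: stable_steps_def)
  obtain m and \<tau> :: "'n \<Rightarrow> 'n" where m: "m \<in> P" "monomial_matrix \<tau> m" "bij \<tau>" "det m = 1"
    and unstable: "(*v) m ` std_flag k \<noteq> std_flag k"
    using Bruhat_factors[OF det_P[OF h(1)]] h by metis
  let ?S = "{r::'n. idx r < k}"
  have "\<not> (*v) m ` std_flag k \<subseteq> std_flag k"
    using unstable m(4) matrix_image_eq_of_subset[of m "std_flag k" "std_flag k"] by auto
  then have "\<not> \<tau> ` ?S \<subseteq> ?S" unfolding std_flag_def monomial_image_subset_iff[OF m(2)] .
  then obtain a where a: "a \<in> ?S" "\<tau> a \<in> - ?S" by blast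
  then have "\<not> \<tau> ` (- ?S) \<subseteq> - ?S" using bij_mem_iff_of_image_subset[OF m(3), of "- ?S" a] by blast
  then obtain c where c: "c \<in> - ?S" "\<tau> c \<in> ?S" by blast
  have "linked (\<tau> a) (\<tau> c)" using a c by (intro linked_monomial[OF linked_of_idx_le m(1-3)]) simp
  moreover have "linked i (\<tau> a)" "linked (\<tau> c) j" using a c ij by (auto intro: linked_of_idx_le)
  ultimately show ?thesis by (meson linked_trans)
qed

lemma linked_of_no_stable_step:
  assumes "\<And>k. idx j < k \<Longrightarrow> k \<le> idx i \<Longrightarrow> k \<notin> stable_steps"
  shows "linked i j"
  using assms
proof (induction "idx i" arbitrary: i)
  case 0
  then show ?case by (simp add: linked_of_idx_le)
next
  case (Suc k)
  show ?case
  proof (cases "idx i \<le> idx j")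
    case False
    have "k < CARD('n)" using Suc.hyps(2) idx_less[of i] by linarith
    then obtain l :: 'n where l: "idx l = k" by (rule idx_surj)
    then have "linked l j" using Suc.prems Suc.hyps(2) by (intro Suc.hyps(1)) auto
    moreover have "linked i l"
      by (rule linked_of_unstable_step[of "idx i"]) (use False l Suc in auto)
    ultimately show ?thesis by (meson linked_trans)
  qed (rule linked_of_idx_le)
qed

lemma monomial_matrix_in_P:
  assumes "det m = 1" "monomial_matrix \<tau> m" "bij \<tau>"
    and "\<And>i k. k \<in> stable_steps \<Longrightarrow> idx (\<tau> i) < k \<longleftrightarrow> idx i < k"
  shows "m \<in> P"
  using assms
proof (induction "card {i. \<tau> i \<noteq> i}" arbitrary: m \<tau> rule: less_induct)
  case less
  show ?case
  proof (cases "\<exists>i. \<tau> i \<noteq> i")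
    case False
    then have "upper m" using monomial_matrix_eq_0_iff[OF less.prems(2)] by (auto simp: upper_def)
    then show ?thesis using less.prems(1) borel_std_subset by (auto simp: borel_std_def)
  next
    case True
    then obtain i where i: "\<tau> i \<noteq> i" by blast
    define j where "j = \<tau> i"
    define swap where "swap = Transposition.transpose i j"
    have same_block: "idx j < k \<longleftrightarrow> idx i < k" if "k \<in> stable_steps" for k
      using less.prems(4)[OF that, of i] by (simp add: j_def)
    have linked: "linked i j" "linked j i"
      by (rule linked_of_no_stable_step; use same_block in \<open>fastforce simp: not_less\<close>)+
    define s :: "complex^'n^'n"
      where "s = transvection i j 1 ** transvection j i (-1) ** transvection i j 1"
    have s: "s \<in> P" "monomial_matrix swap s"
      unfolding s_def swap_def using i linkedD[OF linked(1)] linkedD[OF linked(2)]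
      by (auto simp: j_def intro: mult_closed monomial_matrix_transposition)
    have "{k. (swap \<circ> \<tau>) k \<noteq> k} \<subset> {k. \<tau> k \<noteq> k}"
      unfolding swap_def j_def
      using bij_is_inj[OF less.prems(3)] i by (rule support_transpose_comp_psubset)
    then have "card {k. (swap \<circ> \<tau>) k \<noteq> k} < card {k. \<tau> k \<noteq> k}" by (intro psubset_card_mono) auto
    moreover have "bij (swap \<circ> \<tau>)" using less.prems(3) by (simp add: swap_def bij_comp)
    moreover have "idx ((swap \<circ> \<tau>) l) < k \<longleftrightarrow> idx l < k" if "k \<in> stable_steps" for l k
    proof -
      have "idx (swap r) < k \<longleftrightarrow> idx r < k" for r
        using same_block[OF that] by (simp add: swap_def Transposition.transpose_def)
      then show ?thesis using less.prems(4)[OF that] by simp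
    qed
    ultimately have "s ** m \<in> P"
      using det_P[OF s(1)] less.prems(1) monomial_matrix_mult[OF s(2) less.prems(2)]
      by (intro less.hyps[of "swap \<circ> \<tau>"]) (auto simp: det_mul)
    then have "matrix_inv s ** (s ** m) \<in> P" by (rule mult_closed[OF matrix_inv_closed[OF s(1)]])
    then show ?thesis using det_P[OF s(1)] by simp
  qed
qed

theorem eq_flag_stabilizer: "P = flag_stabilizer (mat 1) stable_steps"
proof (intro subset_antisym subsetI)
  fix g :: "complex^'n^'n" assume g: "g \<in> flag_stabilizer (mat 1) stable_steps"
  then have det_g: "det g = 1" by (simp add: flag_stabilizer_def)
  obtain m and \<tau> :: "'n \<Rightarrow> 'n" where m: "bij \<tau>" "monomial_matrix \<tau> m" "det m = 1" "m \<in> P \<longleftrightarrow> g \<in> P"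
    and stable: "\<And>k. (*v) m ` std_flag k = std_flag k \<longleftrightarrow> (*v) g ` std_flag k = std_flag k"
    using Bruhat_factors[OF det_g] by metis
  have "idx (\<tau> i) < k \<longleftrightarrow> idx i < k" if "k \<in> stable_steps" for i k
  proof -
    have "(*v) m ` std_flag k = std_flag k"
      using g stable[of k] that by (simp add: flag_stabilizer_def)
    then have "(*v) m ` std_flag k \<subseteq> std_flag k" by simp
    then have "\<tau> ` {i. idx i < k} \<subseteq> {i. idx i < k}"
      unfolding std_flag_def monomial_image_subset_iff[OF m(2)] .
    from bij_mem_iff_of_image_subset[OF m(1) this] show ?thesis by simp
  qed
  then show "g \<in> P" using monomial_matrix_in_P[OF m(3,2,1)] m(4) by blast
qed (auto simp: flag_stabilizer_def stable_steps_def det_P)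

end

lemma flag_stabilizer_proper_steps:
  fixes W :: "complex^'n^'n"
  assumes "det W = 1"
  shows "flag_stabilizer W (J \<inter> {0<..<CARD('n)}) = flag_stabilizer W J"
proof -
  have "(*v) g ` flag_space W k = flag_space W k" if "det g = 1" "k \<notin> {0<..<CARD('n)}" for g k
    using that assms by (cases "k = 0") auto
  then have "(\<forall>k\<in>J \<inter> {0<..<CARD('n)}. (*v) g ` flag_space W k = flag_space W k) \<longleftrightarrow>
      (\<forall>k\<in>J. (*v) g ` flag_space W k = flag_space W k)" if "det g = 1" for g
    using that by (meson IntD1 IntI)
  then show ?thesis unfolding flag_stabilizer_def by (simp cong: conj_cong)
qed

theorem parabolic_subgroup_eq_flag_stabilizer:
  fixes P :: "(complex^'n^'n) set"
  assumes "parabolic_subgroup P"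
  obtains W J where "det W = 1" "J \<subseteq> {0<..<CARD('n)}" "P = flag_stabilizer W J"
proof -
  obtain B where "borel_subgroup B" "B \<subseteq> P" and P: "subgroup P SL"
    using assms by (auto simp: parabolic_subgroup_def)
  then obtain W where W: "det W = 1" "flag_stabilizer W UNIV \<subseteq> P"
    using borel_subgroup_eq_flag_stabilizer by metis
  define conj where "conj A = matrix_inv W ** A ** W" for A
  interpret conj: group_hom SL SL conj
    using group_hom_conj[of "matrix_inv W"] W(1) by (simp add: conj_def[abs_def])
  have cancel: "conj (W ** A ** matrix_inv W) = A" "W ** conj A ** matrix_inv W = A" for A
    using W(1) by (simp_all add: conj_def matrix_mul_rassoc)
  have "borel_overgroup (conj ` P)"
  proof (rule borel_overgroup.intro)
    show "subgroup (conj ` P) SL" by (rule conj.subgroup_img_is_subgroup[OF P])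
    show "borel_std \<subseteq> conj ` P"
    proof
      fix A :: "complex^'n^'n" assume "A \<in> borel_std"
      then have "W ** A ** matrix_inv W \<in> P"
        using W(2) flag_stabilizer_eq_conj_image[OF W(1), of UNIV]
        by (auto simp: flag_stabilizer_mat_1_UNIV)
      from imageI[OF this, of conj] show "A \<in> conj ` P" by (simp only: cancel)
    qed
  qed
  then obtain J where J: "conj ` P = flag_stabilizer (mat 1) J"
    using borel_overgroup.eq_flag_stabilizer by blast
  have "A \<in> P \<longleftrightarrow> A \<in> flag_stabilizer W J" for A
  proof -
    have "A \<in> P \<longleftrightarrow> conj A \<in> conj ` P" using cancel(2) by (metis image_iff)
    then show ?thesis unfolding J using flag_stabilizer_conj[OF W(1)] by (simp add: conj_def)
  qed
  then have "P = flag_stabilizer W (J \<inter> {0<..<CARD('n)})"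
    by (auto simp: flag_stabilizer_proper_steps[OF W(1)])
  then show thesis using that W(1) by blast
qed

section \<open>Relative position of a subspace and a flag\<close>

definition rel_pos :: "'a::field^'n^'n \<Rightarrow> nat \<Rightarrow> 'a^'n^'n \<Rightarrow> nat \<Rightarrow> nat" where
  "rel_pos X a Y j = vec.dim (flag_space X a \<inter> flag_space Y j)"

lemma rel_pos_mult:
  "det g \<noteq> 0 \<Longrightarrow> rel_pos (g ** X) a (g ** Y) j = rel_pos X a Y j"
  by (simp add: rel_pos_def flag_space_mult flip: matrix_image_Int)

lemma ex_common_frame_flags:
  fixes X Y :: "'a::field^'n^'n"
  assumes "det X \<noteq> 0" "det Y \<noteq> 0"
  obtains Z and \<tau> :: "'n \<Rightarrow> 'n" where "det Z = det Y" "bij \<tau>" "\<And>j. flag_space Z j = flag_space Y j"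
    "\<And>a. flag_space X a = (*v) Z ` coord_space (\<tau> ` {i. idx i < a})"
proof -
  have det: "det (matrix_inv Y ** X) \<noteq> 0" using assms by (simp add: det_mul)
  then obtain b m b' \<tau> where b: "upper b" "det b = 1" "upper b'" "det b' = 1"
    and \<tau>: "bij \<tau>" "monomial_matrix \<tau> m" and factors: "matrix_inv Y ** X = b ** m ** b'"
    by (rule Bruhat_decomposition)
  have "det m \<noteq> 0" using det b by (simp add: factors det_mul)
  have "X = Y ** (matrix_inv Y ** X)" using assms by simp
  then have X: "X = Y ** b ** (m ** b')" unfolding factors by (simp add: matrix_mul_rassoc)
  have "flag_space X a = (*v) (Y ** b) ` coord_space (\<tau> ` {i. idx i < a})" for a
    using b(3,4) \<tau> \<open>det m \<noteq> 0\<close>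
    by (simp add: X flag_space_mult flag_space_upper std_flag_def monomial_image_coord_space)
  moreover have "flag_space (Y ** b) j = flag_space Y j" for j
    using b by (simp add: flag_space_mult_upper)
  moreover have "det (Y ** b) = det Y" using b by (simp add: det_mul)
  ultimately show thesis using that \<tau>(1) by blast
qed

lemma card_image_idx_less:
  assumes "bij (\<tau> :: 'n::finite \<Rightarrow> 'n)" "a \<le> CARD('n)"
  shows "card (\<tau> ` {i. idx i < a}) = a"
  using assms card_image[OF inj_on_subset[OF bij_is_inj[OF assms(1)] subset_UNIV]] by simp

lemma rel_pos_eq_count_below:
  fixes X Y Z :: "'a::field^'n^'n"
  assumes "det Z \<noteq> 0" "flag_space Z j = flag_space Y j" "flag_space X a = (*v) Z ` coord_space I"
  shows "rel_pos X a Y j = count_below I j"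
proof -
  have "rel_pos X a Y j = vec.dim ((*v) Z ` coord_space (I \<inter> {i. idx i < j}))"
    unfolding rel_pos_def assms(3) assms(2)[symmetric]
    by (simp add: flag_space_def std_flag_def matrix_image_Int[OF assms(1)] flip: coord_space_Int)
  then show ?thesis using assms(1) by (simp add: count_below_def Int_def)
qed

lemma ex_common_frame_subspace:
  fixes X Y :: "'a::field^'n^'n"
  assumes "det X \<noteq> 0" "det Y \<noteq> 0" and a: "a \<le> CARD('n)"
  obtains Z I where "det Z \<noteq> 0" "card I = a" "\<And>j. flag_space Z j = flag_space Y j"
    "flag_space X a = (*v) Z ` coord_space I" "\<And>j. rel_pos X a Y j = count_below I j"
proof -
  obtain Z and \<tau> :: "'n \<Rightarrow> 'n" where "det Z = det Y"
    and Z: "bij \<tau>" "\<And>j. flag_space Z j = flag_space Y j"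
    "\<And>a. flag_space X a = (*v) Z ` coord_space (\<tau> ` {i. idx i < a})"
    using ex_common_frame_flags[OF assms(1,2)] by metis
  then have "det Z \<noteq> 0" using assms(2) by simp
  show thesis
    by (rule that[OF \<open>det Z \<noteq> 0\<close> card_image_idx_less[OF Z(1) a] Z(2,3)
        rel_pos_eq_count_below[OF \<open>det Z \<noteq> 0\<close> Z(2,3)]])
qed

definition unit_steps :: "nat \<Rightarrow> (nat \<Rightarrow> nat) \<Rightarrow> bool" where
  "unit_steps n r \<longleftrightarrow> r 0 = 0 \<and> (\<forall>j<n. r (Suc j) = r j \<or> r (Suc j) = Suc (r j))"

lemma unit_steps_min:
  assumes "unit_steps n r" "unit_steps n s"
  shows "unit_steps n (\<lambda>j. min (r j) (s j))"
  unfolding unit_steps_def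
proof (intro conjI allI impI)
  fix j assume "j < n"
  then have "r (Suc j) = r j \<or> r (Suc j) = Suc (r j)" "s (Suc j) = s j \<or> s (Suc j) = Suc (s j)"
    using assms by (auto simp: unit_steps_def)
  then show "min (r (Suc j)) (s (Suc j)) = min (r j) (s j) \<or>
      min (r (Suc j)) (s (Suc j)) = Suc (min (r j) (s j))" by linarith
qed (use assms in \<open>simp add: unit_steps_def\<close>)

lemma unit_steps_max:
  assumes "unit_steps n r" "unit_steps n s"
  shows "unit_steps n (\<lambda>j. max (r j) (s j))"
  unfolding unit_steps_def
proof (intro conjI allI impI)
  fix j assume "j < n"
  then have "r (Suc j) = r j \<or> r (Suc j) = Suc (r j)" "s (Suc j) = s j \<or> s (Suc j) = Suc (s j)"
    using assms by (auto simp: unit_steps_def)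
  then show "max (r (Suc j)) (s (Suc j)) = max (r j) (s j) \<or>
      max (r (Suc j)) (s (Suc j)) = Suc (max (r j) (s j))" by linarith
qed (use assms in \<open>simp add: unit_steps_def\<close>)

lemma unit_steps_count_below: "unit_steps CARD('n) (count_below (I :: 'n::finite set))"
  unfolding unit_steps_def
proof (intro conjI allI impI)
  fix j assume "j < CARD('n)"
  then obtain i :: 'n where "idx i = j" by (rule idx_surj)
  then show "count_below I (Suc j) = count_below I j \<or>
    count_below I (Suc j) = Suc (count_below I j)"
    using count_below_Suc_idx[of I i] by auto
qed simp

lemma ex_count_below_eq:
  assumes "unit_steps CARD('n::finite) r"
  obtains I :: "'n::finite set" where "\<And>j. j \<le> CARD('n::finite) \<Longrightarrow> count_below I j = r j"
proof -
  define I :: "'n set" where "I = {i. r (Suc (idx i)) = Suc (r (idx i))}"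
  have "count_below I j = r j" if "j \<le> CARD('n)" for j
    using that
  proof (induction j)
    case 0
    show ?case using assms by (simp add: unit_steps_def)
  next
    case (Suc j)
    then obtain i :: 'n where i: "idx i = j" using idx_surj[where 'n='n, of j] by auto
    have "r (Suc j) = r j \<or> r (Suc j) = Suc (r j)"
      using assms Suc.prems by (simp add: unit_steps_def)
    then show ?case using count_below_Suc_idx[of I i] Suc by (auto simp: I_def i)
  qed
  then show ?thesis by (rule that)
qed

lemma count_below_mono: "j \<le> k \<Longrightarrow> count_below I j \<le> count_below I k"
  unfolding count_below_def by (intro card_mono) auto

lemma count_below_idx_less_iff:
  assumes "i \<in> I"
  shows "count_below I (idx i) < count_below I j \<longleftrightarrow> idx i < j"
proof
  assume "idx i < j"
  then show "count_below I (idx i) < count_below I j"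
    using count_below_mono[of "Suc (idx i)" j I] count_below_Suc_idx[of I i] assms by simp
next
  assume "count_below I (idx i) < count_below I j"
  then show "idx i < j" using count_below_mono[of j "idx i" I] by (meson leD leI)
qed

lemma bij_betw_count_below:
  fixes I :: "'n::finite set"
  shows "bij_betw (\<lambda>i. count_below I (idx i)) I {..<card I}"
proof -
  have "inj_on (\<lambda>i. count_below I (idx i)) I"
    by (rule inj_onI) (metis count_below_idx_less_iff idx_eq_iff less_irrefl linorder_less_linear)
  moreover from this have "(\<lambda>i. count_below I (idx i)) ` I = {..<card I}"
    using count_below_idx_less_iff[of _ I "CARD('n)"]
    by (intro card_subset_eq) (auto simp: card_image)
  ultimately show ?thesis by (simp add: bij_betw_def)
qed

lemma ex_count_preserving_bijection:
  fixes I K :: "'n::finite set"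
  assumes "card I = card K"
  obtains f :: "'n \<Rightarrow> 'n"
    where "bij_betw f I K" "\<And>i. i \<in> I \<Longrightarrow> count_below K (idx (f i)) = count_below I (idx i)"
proof -
  define f :: "'n \<Rightarrow> 'n"
    where "f = inv_into K (\<lambda>i. count_below K (idx i)) \<circ> (\<lambda>i. count_below I (idx i))"
  have "bij_betw f I K"
    unfolding f_def using bij_betw_count_below[of I]
    by (rule bij_betw_trans) (simp add: assms bij_betw_inv_into bij_betw_count_below)
  moreover have "count_below K (idx (f i)) = count_below I (idx i)" if "i \<in> I" for i
  proof -
    have "count_below I (idx i) \<in> (\<lambda>i. count_below K (idx i)) ` K"
      using bij_betw_count_below[of I] bij_betw_count_below[of K] assms that
      by (auto simp: bij_betw_def)
    then show ?thesis unfolding f_def comp_def by (rule f_inv_into_f)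
  qed
  ultimately show thesis by (rule that)
qed

lemma count_below_Compl:
  assumes "j \<le> CARD('n::finite)"
  shows "count_below (- I :: 'n::finite set) j = j - count_below I j"
proof -
  have "{i\<in>- I. idx i < j} = {i. idx i < j} - {i\<in>I. idx i < j}" by auto
  then have "count_below (- I) j = card {i::'n. idx i < j} - card {i\<in>I. idx i < j}"
    unfolding count_below_def by (simp only:) (rule card_Diff_subset, auto)
  then show ?thesis using assms by (simp add: count_below_def)
qed

lemma ex_block_preserving_bijection:
  fixes I K :: "'n::finite set"
  assumes card: "card I = card K"
    and J: "J \<subseteq> {..CARD('n)}" "\<And>j. j \<in> J \<Longrightarrow> count_below I j = count_below K j"
  obtains \<pi> :: "'n \<Rightarrow> 'n" where "bij \<pi>" "\<pi> ` I = K" "\<And>i j. j \<in> J \<Longrightarrow> idx (\<pi> i) < j \<longleftrightarrow> idx i < j"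
proof -
  obtain f where f: "bij_betw f I K" "\<And>i. i \<in> I \<Longrightarrow> count_below K (idx (f i)) = count_below I (idx i)"
    using ex_count_preserving_bijection[OF card] by metis
  have "card (- I) = card (- K)" by (simp add: Compl_eq_Diff_UNIV card_Diff_subset card)
  then obtain g where g: "bij_betw g (- I) (- K)"
    "\<And>i. i \<in> - I \<Longrightarrow> count_below (- K) (idx (g i)) = count_below (- I) (idx i)"
    using ex_count_preserving_bijection by metis
  define \<pi> where "\<pi> i = (if i \<in> I then f i else g i)" for i
  have "bij_betw \<pi> (I \<union> - I) (K \<union> - K)"
    unfolding \<pi>_def by (rule bij_betw_disjoint_Un) (use f(1) g(1) in auto)
  then have "bij \<pi>" by (simp add: Compl_partition)
  moreover have "\<pi> ` I = K" using f(1) by (auto simp: \<pi>_def bij_betw_def)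
  moreover have "idx (\<pi> i) < j \<longleftrightarrow> idx i < j" if "j \<in> J" for i j
  proof (cases "i \<in> I")
    case True
    then show ?thesis
      using f(2)[OF True] bij_betwE[OF f(1)] J(2)[OF that]
        count_below_idx_less_iff[of i I j] count_below_idx_less_iff[of "f i" K j]
      by (simp add: \<pi>_def)
  next
    case False
    have "count_below (- I) j = count_below (- K) j" using J that by (auto simp: count_below_Compl)
    then show ?thesis
      using False g(2)[of i] bij_betwE[OF g(1)]
        count_below_idx_less_iff[of i "- I" j] count_below_idx_less_iff[of "g i" "- K" j]
      by (simp add: \<pi>_def)
  qed
  ultimately show thesis by (rule that)
qed

lemma ex_translation_of_equal_rel_pos:
  fixes X Y X' Y' :: "'a::field^'n^'n"
  assumes det: "det X \<noteq> 0" "det Y \<noteq> 0" "det X' \<noteq> 0" "det Y' \<noteq> 0"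
    and a: "a \<le> CARD('n)" and J: "J \<subseteq> {..CARD('n)}"
    and eq: "\<And>j. j \<in> J \<Longrightarrow> rel_pos X a Y j = rel_pos X' a Y' j"
  obtains h where "det h = 1" "flag_space (h ** X) a = flag_space X' a"
    "\<And>j. j \<in> J \<Longrightarrow> flag_space (h ** Y) j = flag_space Y' j"
proof -
  obtain Z I where Z: "det Z \<noteq> 0" "card I = a" "\<And>j. flag_space Z j = flag_space Y j"
    "flag_space X a = (*v) Z ` coord_space I" "\<And>j. rel_pos X a Y j = count_below I j"
    using ex_common_frame_subspace[OF det(1,2) a] by metis
  obtain Z' I' where Z': "det Z' \<noteq> 0" "card I' = a" "\<And>j. flag_space Z' j = flag_space Y' j"
    "flag_space X' a = (*v) Z' ` coord_space I'" "\<And>j. rel_pos X' a Y' j = count_below I' j"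
    using ex_common_frame_subspace[OF det(3,4) a] by metis
  obtain \<pi> where \<pi>: "bij \<pi>" "\<pi> ` I = I'" "\<And>i j. j \<in> J \<Longrightarrow> idx (\<pi> i) < j \<longleftrightarrow> idx i < j"
    using ex_block_preserving_bijection[of I I' J] Z(2,5) Z'(2,5) J eq by metis
  obtain p :: "'a^'n^'n" where p: "det p = det Z / det Z'" "monomial_matrix \<pi> p"
    using ex_monomial_matrix[OF \<pi>(1), of "det Z / det Z'"] Z(1) Z'(1) by auto
  define h where "h = Z' ** p ** matrix_inv Z"
  have h_Z: "(*v) h ` (*v) Z ` S = (*v) Z' ` (*v) p ` S" for S
    using Z(1) by (simp add: h_def matrix_image_mult)
  have "det p \<noteq> 0" using p(1) Z(1) Z'(1) by simp
  have "det h = 1" using p(1) Z(1) Z'(1) by (simp add: h_def det_mul)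
  moreover have "flag_space (h ** X) a = flag_space X' a"
    using monomial_image_coord_space[OF p(2) \<pi>(1) \<open>det p \<noteq> 0\<close>] \<pi>(2)
    by (simp add: flag_space_mult Z(4) Z'(4) h_Z)
  moreover have "flag_space (h ** Y) j = flag_space Y' j" if j: "j \<in> J" for j
  proof -
    have "(*v) p ` std_flag j = std_flag j"
      unfolding std_flag_def using \<pi>(3)[OF j]
      by (intro matrix_image_eq_of_subset)
        (auto simp: \<open>det p \<noteq> 0\<close> monomial_image_subset_iff[OF p(2)])
    then show ?thesis unfolding flag_space_mult Z(3)[symmetric] Z'(3)[symmetric]
      by (simp add: flag_space_def h_Z)
  qed
  ultimately show thesis by (rule that)
qed

lemma ex_matrix_with_rel_pos:
  assumes r: "unit_steps CARD('n) r" and "r CARD('n) = a"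
  obtains X :: "'a::field^'n^'n" where "det X = 1" "\<And>j. j \<le> CARD('n) \<Longrightarrow> rel_pos X a (mat 1) j = r j"
proof -
  obtain I :: "'n set" where I: "\<And>j. j \<le> CARD('n) \<Longrightarrow> count_below I j = r j"
    using ex_count_below_eq[OF r] by metis
  then have "card I = a" using assms(2) I[of "CARD('n)"] by simp
  moreover have "a \<le> CARD('n)" using \<open>card I = a\<close> card_mono[of UNIV I] by auto
  ultimately obtain \<pi> where \<pi>: "bij \<pi>" "\<pi> ` {i::'n. idx i < a} = I"
    using ex_block_preserving_bijection[of "{i::'n. idx i < a}" I "{}"] by auto
  obtain p :: "'a^'n^'n" where p: "det p = 1" "monomial_matrix \<pi> p"
    using ex_monomial_matrix[OF \<pi>(1), of 1] by auto
  have "flag_space p a = (*v) (mat 1) ` coord_space I"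
    using monomial_image_coord_space[OF p(2) \<pi>(1)] p(1) \<pi>(2)
    by (simp add: flag_space_def std_flag_def)
  then have "rel_pos p a (mat 1) j = count_below I j" for j
    by (rule rel_pos_eq_count_below[rotated 2]) simp_all
  then show thesis using that p(1) I by metis
qed

lemma unit_steps_rel_pos:
  fixes X Y :: "'a::field^'n^'n"
  assumes "det X \<noteq> 0" "det Y \<noteq> 0" "a \<le> CARD('n)"
  shows "unit_steps CARD('n) (rel_pos X a Y)" "rel_pos X a Y CARD('n) = a"
proof -
  obtain I :: "'n set" where "card I = a" and I: "\<And>j. rel_pos X a Y j = count_below I j"
    using ex_common_frame_subspace[OF assms] by metis
  then show "rel_pos X a Y CARD('n) = a" by simp
  have "rel_pos X a Y = count_below I" using I by blast
  then show "unit_steps CARD('n) (rel_pos X a Y)" using unit_steps_count_below[of I] by simp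
qed

section \<open>Degeneration of relative positions\<close>

definition shear :: "'n set \<Rightarrow> ('n \<Rightarrow> 'n) \<Rightarrow> 'a \<Rightarrow> 'a::comm_ring_1^'n^'n" where
  "shear I f t = (\<chi> r s. (if r = s then 1 else 0) + (if s \<in> I \<and> r = f s \<and> r \<noteq> s then t else 0))"

lemma shear_0 [simp]: "shear I f 0 = mat 1"
  by (simp add: shear_def mat_def vec_eq_iff)

lemma shear_mult_axis:
  "s \<in> I \<Longrightarrow> shear I f t *v axis s 1 = axis s 1 + (if f s = s then 0 else axis (f s) t)"
  by (simp add: vec_eq_iff matrix_vector_mult_axis shear_def axis_nth_if)

lemma polynomial_matrix_shear: "polynomial_matrix (shear I f)"
  unfolding polynomial_matrix_def
proof (intro allI)
  fix r s
  show "\<exists>p. \<forall>t. shear I f t $ r $ s = poly p t"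
    by (rule exI[of _ "[:if r = s then 1 else 0, if s \<in> I \<and> r = f s \<and> r \<noteq> s then 1 else 0:]"])
      (auto simp: shear_def)
qed

lemma det_shear:
  fixes I :: "'n::finite set"
  assumes "\<And>s. s \<in> I \<Longrightarrow> idx s \<le> idx (f s)"
  shows "det (shear I f t) = 1"
proof -
  have "inj (\<lambda>k::'n. - int (idx k))" by (rule injI) simp
  then have "det (shear I f t) = (\<Prod>k\<in>UNIV. shear I f t $ k $ k)"
    by (rule det_triangular) (use assms in \<open>force simp: shear_def\<close>)
  then show ?thesis by (simp add: shear_def)
qed

lemma pivots_shear:
  fixes I K :: "'n::finite set" and t :: "'a::field"
  assumes f: "bij_betw f I K" "\<And>s. s \<in> I \<Longrightarrow> idx s \<le> idx (f s)" and t: "t \<noteq> 0"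
  shows "pivots ((*v) (shear I f t) ` coord_space I) = K"
proof -
  let ?E = "(*v) (shear I f t) ` coord_space I"
  have "f s \<in> pivots ?E" if s: "s \<in> I" for s
  proof -
    have "shear I f t *v axis s 1 \<in> ?E" using s by (intro imageI) simp
    moreover have "shear I f t *v axis s 1 \<in> std_flag (Suc (idx (f s)))"
      unfolding shear_mult_axis[OF s]
      using f(2)[OF s] by (intro std_flag_add) (auto simp: vec.subspace_0)
    moreover have "(shear I f t *v axis s 1) $ f s \<noteq> 0"
      unfolding shear_mult_axis[OF s] using t by (auto simp: axis_nth_if)
    ultimately show ?thesis unfolding pivots_def by blast
  qed
  then have "K \<subseteq> pivots ?E" using f(1) by (auto simp: bij_betw_def)
  moreover have "card (pivots ?E) = card K"
    using det_shear[OF f(2), of I t] bij_betw_same_card[OF f(1)] by (simp add: card_pivots)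
  ultimately show ?thesis by (intro card_subset_eq[symmetric]) auto
qed

lemma ex_upward_bijection:
  fixes I I' :: "'n::finite set"
  assumes card: "card I = card I'" and J: "J \<subseteq> {..CARD('n)}"
    and le: "\<And>j. j \<in> J \<Longrightarrow> count_below I j \<le> count_below I' j"
  obtains f and K :: "'n set" where "bij_betw f I' K" "\<And>s. s \<in> I' \<Longrightarrow> idx s \<le> idx (f s)"
    "\<And>j. j \<in> J \<Longrightarrow> count_below K j = count_below I j"
proof -
  obtain K :: "'n set"
    where K: "\<And>j. j \<le> CARD('n) \<Longrightarrow> count_below K j = min (count_below I j) (count_below I' j)"
    using ex_count_below_eq[OF unit_steps_min[OF unit_steps_count_below unit_steps_count_below]]
    by metis
  have "card I' = card K" using K[of "CARD('n)"] card by simp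
  then obtain f
    where f: "bij_betw f I' K" "\<And>i. i \<in> I' \<Longrightarrow> count_below K (idx (f i)) = count_below I' (idx i)"
    using ex_count_preserving_bijection by metis
  have "idx s \<le> idx (f s)" if s: "s \<in> I'" for s
  proof (rule ccontr)
    assume "\<not> idx s \<le> idx (f s)"
    then have "count_below K (idx (f s)) < count_below K (idx s)"
      using count_below_idx_less_iff bij_betwE[OF f(1)] s by (metis not_le)
    also have "\<dots> \<le> count_below I' (idx s)" using K[of "idx s"] by (simp add: less_imp_le)
    finally show False using f(2)[OF s] by simp
  qed
  moreover have "count_below K j = count_below I j" if "j \<in> J" for j
    using K[of j] le[OF that] J that by auto
  ultimately show thesis by (rule that[OF f(1)])
qed

text \<open>Replacing the index set \<open>I\<close> of the first pair by the pointwise minimum \<open>K\<close> of the two step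
  functions does not change the dimensions at \<open>J\<close>, and the increasing bijection from \<open>I'\<close> to \<open>K\<close>
  only moves indices up, so that a unipotent shear moves the second pair into the orbit of the
  first.\<close>

lemma ex_degeneration:
  fixes X Y X' Y' :: "'a::field^'n^'n"
  assumes det: "det X \<noteq> 0" "det Y \<noteq> 0" "det X' \<noteq> 0" "det Y' \<noteq> 0"
    and a: "a \<le> CARD('n)" and J: "J \<subseteq> {..CARD('n)}"
    and le: "\<And>j. j \<in> J \<Longrightarrow> rel_pos X a Y j \<le> rel_pos X' a Y' j"
  obtains g where "g 0 = mat 1" "polynomial_matrix g" "\<And>t. det (g t) = 1"
    "\<And>t. t \<noteq> 0 \<Longrightarrow> \<exists>h. det h = 1 \<and> flag_space (h ** X) a = flag_space (g t ** X') a \<and>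
       (\<forall>j\<in>J. flag_space (h ** Y) j = flag_space Y' j)"
proof -
  obtain I :: "'n set" where I: "card I = a" "\<And>j. rel_pos X a Y j = count_below I j"
    using ex_common_frame_subspace[OF det(1,2) a] by metis
  obtain Z I' where Z: "det Z \<noteq> 0" "card I' = a" "\<And>j. flag_space Z j = flag_space Y' j"
    "flag_space X' a = (*v) Z ` coord_space I'" "\<And>j. rel_pos X' a Y' j = count_below I' j"
    using ex_common_frame_subspace[OF det(3,4) a] by metis
  have card: "card I = card I'" and count_le: "\<And>j. j \<in> J \<Longrightarrow> count_below I j \<le> count_below I' j"
    using I Z(2,5) le by simp_all
  obtain f and K :: "'n set" where f: "bij_betw f I' K" "\<And>s. s \<in> I' \<Longrightarrow> idx s \<le> idx (f s)"
    "\<And>j. j \<in> J \<Longrightarrow> count_below K j = count_below I j"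
    using ex_upward_bijection[OF card J count_le] by metis
  define g where "g t = Z ** shear I' f t ** matrix_inv Z" for t
  have det_g: "det (g t) = 1" for t using Z(1) by (simp add: g_def det_mul det_shear[OF f(2)])
  have "rel_pos (g t ** X') a Y' j = rel_pos X a Y j" if t: "t \<noteq> 0" and j: "j \<in> J" for t j
  proof -
    let ?E = "(*v) (shear I' f t) ` coord_space I'"
    have "flag_space (g t ** X') a = (*v) Z ` ?E"
      using Z(1) by (simp add: flag_space_mult Z(4) g_def matrix_image_mult)
    then have "rel_pos (g t ** X') a Y' j = vec.dim ((*v) Z ` (?E \<inter> std_flag j))"
      unfolding rel_pos_def Z(3)[symmetric]
      by (simp add: flag_space_def[of Z] matrix_image_Int[OF Z(1)])
    also have "\<dots> = vec.dim (?E \<inter> std_flag j)" by (rule dim_matrix_image[OF Z(1)])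
    also have "\<dots> = count_below (pivots ?E) j" using J j by (intro dim_Int_std_flag) auto
    also have "\<dots> = rel_pos X a Y j" using f(3)[OF j] I(2) by (simp add: pivots_shear[OF f(1,2) t])
    finally show ?thesis .
  qed
  then have "\<exists>h. det h = 1 \<and> flag_space (h ** X) a = flag_space (g t ** X') a \<and>
       (\<forall>j\<in>J. flag_space (h ** Y) j = flag_space Y' j)" if "t \<noteq> 0" for t
    using ex_translation_of_equal_rel_pos[OF det(1,2) _ det(4) a J, of "g t ** X'"] that det_g
      det(3)
    by (metis det_mul mult_1)
  moreover have "polynomial_matrix g"
    unfolding g_def
    by (intro polynomial_matrix_mult polynomial_matrix_const polynomial_matrix_shear)
  moreover have "g 0 = mat 1" using Z(1) by (simp add: g_def)
  ultimately show thesis using that det_g by metis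
qed

definition mixed_columns :: "'n set \<Rightarrow> 'a^'n^'n \<Rightarrow> 'a^'n^'n \<Rightarrow> 'a^'n^'n" where
  "mixed_columns I A B = (\<chi> r c. if c \<in> I then A $ r $ c else B $ r $ c)"

lemma mixed_columns_nth [simp]:
  "mixed_columns I A B $ r $ c = (if c \<in> I then A $ r $ c else B $ r $ c)"
  by (simp add: mixed_columns_def)

lemma dim_Int_le_of_mixed_columns:
  fixes A B :: "'a::field^'n^'n"
  assumes det: "det A \<noteq> 0" "det B \<noteq> 0" "det (mixed_columns I A B) \<noteq> 0"
  shows "vec.dim ((*v) A ` coord_space I \<inter> (*v) B ` coord_space K) \<le> card (I \<inter> K)"
proof -
  let ?A = "(*v) A ` coord_space I" and ?B = "(*v) B ` coord_space K" and ?M = "mixed_columns I A B"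
  have "(*v) ?M ` coord_space (I \<union> K) \<subseteq> {x + y | x y. x \<in> ?A \<and> y \<in> ?B}"
  proof (rule image_subsetI)
    fix w :: "'a^'n" assume w: "w \<in> coord_space (I \<union> K)"
    define u v :: "'a^'n" where "u = (\<chi> i. if i \<in> I then w $ i else 0)" and "v = w - u"
    have "?M *v u = A *v u"
      unfolding matrix_vector_mult_def by (auto simp: vec_eq_iff u_def intro!: sum.cong)
    moreover have "?M $ r $ c * v $ c = B $ r $ c * v $ c" for r c by (simp add: u_def v_def)
    then have "?M *v v = B *v v" by (simp only: matrix_vector_mult_def)
    moreover have "w = u + v" by (simp add: v_def)
    ultimately have "?M *v w = A *v u + B *v v" by (simp add: matrix_vector_right_distrib)
    moreover have "u \<in> coord_space I" "v \<in> coord_space K"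
      using w by (auto simp: coord_space_def u_def v_def)
    ultimately show "?M *v w \<in> {x + y | x y. x \<in> ?A \<and> y \<in> ?B}" by blast
  qed
  from vec.dim_subset[OF this] have "card (I \<union> K) \<le> vec.dim {x + y | x y. x \<in> ?A \<and> y \<in> ?B}"
    using det(3) by simp
  moreover have "vec.dim {x + y | x y. x \<in> ?A \<and> y \<in> ?B} + vec.dim (?A \<inter> ?B) = card I + card K"
    using vec.dim_sums_Int[of ?A ?B] det by simp
  ultimately show ?thesis using card_Un_Int[of I K] by simp
qed

lemma rel_pos_mult_le_of_mixed_columns:
  fixes X Y Z x y :: "'a::field^'n^'n"
  assumes det: "det x \<noteq> 0" "det y \<noteq> 0" "det (mixed_columns I (x ** Z) (y ** Z)) \<noteq> 0"
    and Z: "det Z \<noteq> 0" "flag_space Z j = flag_space Y j" "flag_space X a = (*v) Z ` coord_space I"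
  shows "rel_pos (x ** X) a (y ** Y) j \<le> rel_pos X a Y j"
proof -
  have "flag_space (x ** X) a = (*v) (x ** Z) ` coord_space I"
    by (simp only: flag_space_mult Z(3) matrix_image_mult)
  moreover have "flag_space (y ** Y) j = (*v) (y ** Z) ` coord_space {i. idx i < j}"
    unfolding flag_space_mult Z(2)[symmetric]
    by (simp only: flag_space_def std_flag_def matrix_image_mult)
  ultimately have "rel_pos (x ** X) a (y ** Y) j
      = vec.dim ((*v) (x ** Z) ` coord_space I \<inter> (*v) (y ** Z) ` coord_space {i. idx i < j})"
    by (simp only: rel_pos_def)
  also have "\<dots> \<le> card (I \<inter> {i. idx i < j})"
    using det Z(1) by (intro dim_Int_le_of_mixed_columns) (simp_all add: det_mul)
  also have "\<dots> = rel_pos X a Y j"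
    unfolding rel_pos_eq_count_below[OF Z] by (simp add: count_below_def Int_def)
  finally show ?thesis .
qed

section \<open>The double flag variety\<close>

abbreviation SL_pairs :: "((complex^'n^'n) \<times> (complex^'n^'n)) topology" where
  "SL_pairs \<equiv> subtopology (zariski mat_pair_coords) (carrier SL \<times> carrier SL)"

lemma poly_funs_fst_coord: "(\<lambda>z. fst z $ i $ j) \<in> poly_funs mat_pair_coords"
  by (rule poly_funs.coord) (force simp: mat_coords_def mat_pair_coords_def comp_def)

lemma poly_funs_snd_coord: "(\<lambda>z. snd z $ i $ j) \<in> poly_funs mat_pair_coords"
  by (rule poly_funs.coord) (force simp: mat_coords_def mat_pair_coords_def comp_def)

lemma mat_pair_coords_cases:
  assumes "c \<in> mat_pair_coords"
  obtains i j where "c = (\<lambda>z. fst z $ i $ j)" | i j where "c = (\<lambda>z. snd z $ i $ j)"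
  using assms by (auto simp: mat_pair_coords_def mat_coords_def comp_def)

lemma polynomial_curve_mat_pair_coords:
  assumes "polynomial_matrix M" "polynomial_matrix N"
  shows "polynomial_curve mat_pair_coords (\<lambda>t. (M t, N t))"
  unfolding polynomial_curve_def
  using assms by (auto simp: polynomial_matrix_def elim!: mat_pair_coords_cases)

lemma continuous_map_into_SL_pairs:
  assumes "\<phi> \<in> S \<rightarrow> carrier SL \<times> carrier SL"
    and "\<And>i j. (\<lambda>x. fst (\<phi> x) $ i $ j) \<in> poly_funs C" "\<And>i j. (\<lambda>x. snd (\<phi> x) $ i $ j) \<in> poly_funs C"
  shows "continuous_map (subtopology (zariski C) S) SL_pairs \<phi>"
proof (rule continuous_map_zariski[OF assms(1)])
  fix c :: "(complex^'b^'b) \<times> (complex^'b^'b) \<Rightarrow> complex" assume "c \<in> mat_pair_coords"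
  then have "(\<lambda>x. c (\<phi> x)) \<in> poly_funs C" using assms(2,3) by (elim mat_pair_coords_cases) simp_all
  then show "\<exists>g\<in>poly_funs C. \<forall>x\<in>S. c (\<phi> x) = g x" by (rule bexI[rotated]) simp
qed

lemma openin_SL_slice:
  fixes V :: "((complex^'n^'n) \<times> (complex^'n^'n)) set"
  assumes V: "openin SL_pairs V"
  shows "det y = 1 \<Longrightarrow> openin SL_topology {x. (x, y) \<in> V}"
    and "det x = 1 \<Longrightarrow> openin SL_topology {y. (x, y) \<in> V}"
proof -
  have V_sub: "V \<subseteq> carrier SL \<times> carrier SL" using openin_subset[OF V] by simp
  have preimage: "openin SL_topology {z. \<phi> z \<in> V}"
    if "continuous_map SL_topology SL_pairs \<phi>" "\<And>z. \<phi> z \<in> V \<Longrightarrow> det z = 1"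
    for \<phi> :: "complex^'n^'n \<Rightarrow> (complex^'n^'n) \<times> (complex^'n^'n)"
  proof -
    have "{z \<in> topspace SL_topology. \<phi> z \<in> V} = {z. \<phi> z \<in> V}" using that(2) by auto
    then show ?thesis using openin_continuous_map_preimage[OF that(1) V] by simp
  qed
  show "openin SL_topology {x. (x, y) \<in> V}" if "det y = 1" for y
    using V_sub that unfolding SL_topology_def
    by (intro preimage[unfolded SL_topology_def] continuous_map_into_SL_pairs)
      (auto intro: poly_funs_mat_coord poly_funs.const)
  show "openin SL_topology {y. (x, y) \<in> V}" if "det x = 1" for x
    using V_sub that unfolding SL_topology_def
    by (intro preimage[unfolded SL_topology_def] continuous_map_into_SL_pairs)
      (auto intro: poly_funs_mat_coord poly_funs.const)
qed

lemma continuous_map_quotient_topology: "continuous_map T (quotient_topology T q) q"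
  by (auto simp: continuous_map_def openin_quotient_topology)

lemma continuous_map_from_quotient_topology:
  assumes "continuous_map T X (f \<circ> q)"
  shows "continuous_map (quotient_topology T q) X f"
  unfolding continuous_map_def
proof (intro conjI allI impI)
  show "f \<in> topspace (quotient_topology T q) \<rightarrow> topspace X"
    using assms by (auto simp: continuous_map_def)
  fix U assume "openin X U"
  from openin_continuous_map_preimage[OF assms this]
  have "openin T {x \<in> topspace T. f (q x) \<in> U}" by simp
  moreover have "{x \<in> topspace T. q x \<in> {y \<in> q ` topspace T. f y \<in> U}}
    = {x \<in> topspace T. f (q x) \<in> U}" by auto
  ultimately show "openin (quotient_topology T q) {y \<in> topspace (quotient_topology T q). f y \<in> U}"
    unfolding openin_quotient_topology topspace_quotient_topology by auto
qed

definition coset_pair :: "(complex^'n^'n) set \<Rightarrow> (complex^'n^'n) set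
    \<Rightarrow> (complex^'n^'n) \<times> (complex^'n^'n) \<Rightarrow> (complex^'n^'n) set \<times> (complex^'n^'n) set" where
  "coset_pair P Q = (\<lambda>(x, y). (l_coset SL x P, l_coset SL y Q))"

lemma double_flag_topology_eq: "double_flag_topology P Q
  = quotient_topology SL_pairs (coset_pair P Q)"
  by (simp add: double_flag_topology_def coset_pair_def)

lemma double_flag_eq_image: "double_flag P Q = coset_pair P Q ` (carrier SL \<times> carrier SL)"
  using topspace_double_flag_topology[of P Q] by (simp add: double_flag_topology_eq)

lemma openin_double_flag_topology:
  "openin (double_flag_topology P Q) U \<longleftrightarrow>
     U \<subseteq> double_flag P Q \<and> openin SL_pairs {z \<in> carrier SL \<times> carrier SL. coset_pair P Q z \<in> U}"
  by (simp add: double_flag_topology_eq openin_quotient_topology double_flag_eq_image)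

lemma orbit_coset_pair:
  "orbit (SL\<lparr>carrier := H\<rparr>) diag_act (coset_pair P Q (x, y))
    = (\<lambda>g. coset_pair P Q (g ** x, g ** y)) ` H"
  by (auto simp: orbit_def coset_pair_def diag_act_cosets)

lemma orbit_SL_coset_pair:
  "orbit SL diag_act (coset_pair P Q (x, y)) = (\<lambda>g. coset_pair P Q (g ** x, g ** y)) ` carrier SL"
  by (auto simp: orbit_def coset_pair_def diag_act_cosets)

lemma orbits_eq_image: "orbits G E \<phi> = orbit G \<phi> ` E"
  by (auto simp: orbits_def)

lemma orbit_closures_eq_image:
  "orbit_closures P Q
    = (\<lambda>z. double_flag_topology P Q closure_of orbit SL diag_act (coset_pair P Q z))
     ` (carrier SL \<times> carrier SL)"
  by (simp only: orbit_closures_def orbits_eq_image double_flag_eq_image image_image)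

lemma homeomorphic_map_swap:
  "homeomorphic_map (double_flag_topology P Q) (double_flag_topology Q P) prod.swap"
proof -
  have "continuous_map (double_flag_topology P Q) (double_flag_topology Q P) prod.swap"
    for P Q :: "(complex^'a^'a) set"
    unfolding double_flag_topology_eq[of P Q]
  proof (rule continuous_map_from_quotient_topology)
    have "continuous_map SL_pairs SL_pairs (prod.swap :: (complex^'a^'a) \<times> _ \<Rightarrow> _)"
      by (rule continuous_map_into_SL_pairs) (auto intro: poly_funs_fst_coord poly_funs_snd_coord)
    moreover have "continuous_map SL_pairs (double_flag_topology Q P) (coset_pair Q P)"
      unfolding double_flag_topology_eq by (rule continuous_map_quotient_topology)
    ultimately have "continuous_map SL_pairs (double_flag_topology Q P)
        (coset_pair Q P \<circ> prod.swap)"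
      by (rule continuous_map_compose)
    moreover have "coset_pair Q P \<circ> prod.swap = prod.swap \<circ> coset_pair P Q"
      by (auto simp: coset_pair_def)
    ultimately show "continuous_map SL_pairs (double_flag_topology Q P)
        (prod.swap \<circ> coset_pair P Q)" by simp
  qed
  then show ?thesis
    by (intro homeomorphic_maps_imp_map[of _ _ _ prod.swap]) (simp add: homeomorphic_maps_def)
qed

lemma swap_double_flag: "prod.swap ` double_flag P Q = double_flag Q P"
  by (auto simp: double_flag_def)

lemma orbit_diag_act_swap: "orbit G diag_act (prod.swap w) = prod.swap ` orbit G diag_act w"
  by (cases w) (auto simp: orbit_def diag_act_def)

lemma orbits_diag_act_swap:
  "orbits G (double_flag Q P) diag_act = (`) prod.swap ` orbits G (double_flag P Q) diag_act"
  by (simp only: orbits_eq_image swap_double_flag[of P Q, symmetric] image_image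
    orbit_diag_act_swap)

lemma spherical_double_flag_swap:
  assumes "spherical_double_flag P Q"
  shows "spherical_double_flag Q P"
proof -
  obtain B Y where "borel_subgroup B" "Y \<in> orbits (SL\<lparr>carrier := B\<rparr>) (double_flag P Q) diag_act"
    "openin (double_flag_topology P Q) Y"
    using assms by (auto simp: spherical_double_flag_def)
  moreover have "openin (double_flag_topology Q P) (prod.swap ` Y)"
    using homeomorphic_imp_open_map[OF homeomorphic_map_swap] \<open>openin _ Y\<close>
    by (auto simp: open_map_def)
  ultimately show ?thesis
    unfolding spherical_double_flag_def orbits_diag_act_swap[of _ Q P] by blast
qed

lemma orbit_closures_swap: "orbit_closures Q P = (`) prod.swap ` orbit_closures P Q"
proof -
  have "double_flag_topology Q P closure_of (prod.swap ` Y)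
    = prod.swap ` (double_flag_topology P Q closure_of Y)"
    if "Y \<in> orbits SL (double_flag P Q) diag_act" for Y
  proof (rule homeomorphic_map_closure_of[OF homeomorphic_map_swap])
    show "Y \<subseteq> topspace (double_flag_topology P Q)"
      using that unfolding topspace_double_flag_topology double_flag_eq_image
      by (fastforce simp: orbits_eq_image orbit_SL_coset_pair det_mul)
  qed
  then show ?thesis
    unfolding orbit_closures_def orbits_diag_act_swap[of _ Q P] image_image
    by (rule image_cong[OF refl])
qed

section \<open>Lattices of sets\<close>

lemma lattice_subset_order_iff:
  "lattice \<lparr>carrier = \<A>, eq = (=), le = (\<subseteq>)\<rparr> \<longleftrightarrow> (\<forall>A\<in>\<A>. \<forall>B\<in>\<A>.
     (\<exists>S\<in>\<A>. A \<subseteq> S \<and> B \<subseteq> S \<and> (\<forall>D\<in>\<A>. A \<subseteq> D \<longrightarrow> B \<subseteq> D \<longrightarrow> S \<subseteq> D)) \<and>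
     (\<exists>S\<in>\<A>. S \<subseteq> A \<and> S \<subseteq> B \<and> (\<forall>D\<in>\<A>. D \<subseteq> A \<longrightarrow> D \<subseteq> B \<longrightarrow> D \<subseteq> S)))"
    (is "lattice ?L \<longleftrightarrow> ?bounds")
proof -
  have Upper: "Upper ?L {A, B} = {S\<in>\<A>. A \<subseteq> S \<and> B \<subseteq> S}"
    and Lower: "Lower ?L {A, B} = {S\<in>\<A>. S \<subseteq> A \<and> S \<subseteq> B}" if "A \<in> \<A>" "B \<in> \<A>" for A B
    using that unfolding Upper_def Lower_def by auto
  have least: "least ?L S (Upper ?L {A, B}) \<longleftrightarrow>
      S \<in> \<A> \<and> A \<subseteq> S \<and> B \<subseteq> S \<and> (\<forall>D\<in>\<A>. A \<subseteq> D \<longrightarrow> B \<subseteq> D \<longrightarrow> S \<subseteq> D)"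
    and greatest: "greatest ?L S (Lower ?L {A, B}) \<longleftrightarrow>
      S \<in> \<A> \<and> S \<subseteq> A \<and> S \<subseteq> B \<and> (\<forall>D\<in>\<A>. D \<subseteq> A \<longrightarrow> D \<subseteq> B \<longrightarrow> D \<subseteq> S)"
    if "A \<in> \<A>" "B \<in> \<A>" for A B S
    unfolding least_def greatest_def Upper[OF that] Lower[OF that] by auto
  show ?thesis
  proof
    assume "lattice ?L"
    then interpret lattice ?L .
    show ?bounds
    proof (intro ballI)
      fix A B assume AB: "A \<in> \<A>" "B \<in> \<A>"
      have "\<exists>S. least ?L S (Upper ?L {A, B})" "\<exists>S. greatest ?L S (Lower ?L {A, B})"
        using AB by (simp_all add: sup_of_two_exists inf_of_two_exists)
      then show "(\<exists>S\<in>\<A>. A \<subseteq> S \<and> B \<subseteq> S \<and> (\<forall>D\<in>\<A>. A \<subseteq> D \<longrightarrow> B \<subseteq> D \<longrightarrow> S \<subseteq> D)) \<and>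
          (\<exists>S\<in>\<A>. S \<subseteq> A \<and> S \<subseteq> B \<and> (\<forall>D\<in>\<A>. D \<subseteq> A \<longrightarrow> D \<subseteq> B \<longrightarrow> D \<subseteq> S))"
        unfolding least[OF AB] greatest[OF AB] Bex_def by (rule conjI)
    qed
  next
    assume bounds: ?bounds
    show "lattice ?L"
    proof unfold_locales
      fix A B assume "A \<in> carrier ?L" "B \<in> carrier ?L"
      then have AB: "A \<in> \<A>" "B \<in> \<A>" by simp_all
      show "\<exists>S. least ?L S (Upper ?L {A, B})" "\<exists>S. greatest ?L S (Lower ?L {A, B})"
        unfolding least[OF AB] greatest[OF AB] using bspec[OF bspec[OF bounds AB(1)] AB(2)]
        by (auto simp only: Bex_def)
    qed auto
  qed
qed

lemma lattice_image:
  assumes "inj f" "lattice \<lparr>carrier = \<A>, eq = (=), le = (\<subseteq>)\<rparr>"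
  shows "lattice \<lparr>carrier = (`) f ` \<A>, eq = (=), le = (\<subseteq>)\<rparr>"
  using assms(2) unfolding lattice_subset_order_iff by (simp add: inj_image_subset_iff[OF assms(1)])

lemma lattice_of_order_embedding:
  fixes C :: "'i \<Rightarrow> 'a set" and r :: "'i \<Rightarrow> 'j \<Rightarrow> 'b::lattice"
  assumes subset_iff: "\<And>u v. u \<in> I \<Longrightarrow> v \<in> I \<Longrightarrow> C u \<subseteq> C v \<longleftrightarrow> (\<forall>j\<in>J. r v j \<le> r u j)"
    and inf: "\<And>u v. u \<in> I \<Longrightarrow> v \<in> I \<Longrightarrow> \<exists>w\<in>I. \<forall>j\<in>J. r w j = inf (r u j) (r v j)"
    and sup: "\<And>u v. u \<in> I \<Longrightarrow> v \<in> I \<Longrightarrow> \<exists>w\<in>I. \<forall>j\<in>J. r w j = sup (r u j) (r v j)"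
  shows "lattice \<lparr>carrier = C ` I, eq = (=), le = (\<subseteq>)\<rparr>"
  unfolding lattice_subset_order_iff
proof safe
  fix u v assume uv: "u \<in> I" "v \<in> I"
  obtain w where "w \<in> I" "\<forall>j\<in>J. r w j = inf (r u j) (r v j)" using inf[OF uv] by blast
  then show "\<exists>S\<in>C ` I. C u \<subseteq> S \<and> C v \<subseteq> S \<and> (\<forall>D\<in>C ` I. C u \<subseteq> D \<longrightarrow> C v \<subseteq> D \<longrightarrow> S \<subseteq> D)"
    using uv by (intro bexI[of _ "C w"]) (auto simp: subset_iff)
  obtain w where "w \<in> I" "\<forall>j\<in>J. r w j = sup (r u j) (r v j)" using sup[OF uv] by blast
  then show "\<exists>S\<in>C ` I. S \<subseteq> C u \<and> S \<subseteq> C v \<and> (\<forall>D\<in>C ` I. D \<subseteq> C u \<longrightarrow> D \<subseteq> C v \<longrightarrow> D \<subseteq> S)"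
    using uv by (intro bexI[of _ "C w"]) (auto simp: subset_iff)
qed

section \<open>Orbit closures when one flag has a single step\<close>

lemma (in group) l_coset_eq_iff:
  assumes "subgroup H G" "x \<in> carrier G" "y \<in> carrier G"
  shows "x <# H = y <# H \<longleftrightarrow> inv x \<otimes> y \<in> H"
proof
  assume "x <# H = y <# H"
  then have "y \<in> x <# H" using lcos_self[OF assms(3,1)] by simp
  then obtain h where h: "h \<in> H" "y = x \<otimes> h" by (auto simp: l_coset_def)
  then have "inv x \<otimes> y = h" using assms(2) subgroup.mem_carrier[OF assms(1)] by (simp flip: m_assoc)
  then show "inv x \<otimes> y \<in> H" using h(1) by simp
next
  assume "inv x \<otimes> y \<in> H"
  then show "x <# H = y <# H"
    using assms subgroup.lcos_module_rev[OF assms(1) is_group] l_repr_independence by metis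
qed

lemma l_coset_flag_stabilizer_eq_iff:
  fixes W :: "complex^'n^'n"
  assumes "det x = 1" "det y = 1"
  shows "l_coset SL x (flag_stabilizer W J) = l_coset SL y (flag_stabilizer W J) \<longleftrightarrow>
    (\<forall>k\<in>J. flag_space (x ** W) k = flag_space (y ** W) k)"
proof -
  have "(*v) (matrix_inv x ** y) ` flag_space W k = flag_space W k \<longleftrightarrow>
      flag_space (x ** W) k = flag_space (y ** W) k" for k
    unfolding matrix_image_mult flag_space_mult using assms
    by (metis matrix_inv_image_cancel zero_neq_one)
  then show ?thesis
    using assms SL.l_coset_eq_iff[OF subgroup_flag_stabilizer, of x y W J]
    by (simp add: flag_stabilizer_def det_mul)
qed

lemma coset_pair_flag_stabilizer_eq_iff:
  fixes Wp Wq :: "complex^'n^'n"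
  assumes "z \<in> carrier SL \<times> carrier SL" "w \<in> carrier SL \<times> carrier SL"
  shows "coset_pair (flag_stabilizer Wp I) (flag_stabilizer Wq J) z
    = coset_pair (flag_stabilizer Wp I) (flag_stabilizer Wq J) w \<longleftrightarrow>
    (\<forall>l\<in>I. flag_space (fst z ** Wp) l = flag_space (fst w ** Wp) l) \<and>
    (\<forall>l\<in>J. flag_space (snd z ** Wq) l = flag_space (snd w ** Wq) l)"
  using assms by (cases z; cases w) (simp add: coset_pair_def l_coset_flag_stabilizer_eq_iff)

lemma openin_rel_pos_le:
  fixes W W' :: "complex^'n^'n"
  assumes W: "det W = 1" "det W' = 1" and a: "a \<le> CARD('n)"
  shows "openin SL_pairs {z \<in> carrier SL \<times> carrier SL. rel_pos (fst z ** W) a (snd z ** W') k \<le> c}"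
  unfolding openin_subtopology_zariski
proof (intro conjI ballI)
  fix w assume w: "w \<in> {z \<in> carrier SL \<times> carrier SL. rel_pos (fst z ** W) a (snd z ** W') k \<le> c}"
  define u v where "u = fst w" and "v = snd w"
  have det_uv: "det u = 1" "det v = 1" using w by (auto simp: u_def v_def)
  have "det (u ** W) \<noteq> 0" "det (v ** W') \<noteq> 0" using det_uv W by (simp_all add: det_mul)
  then obtain Z I where Z: "det Z \<noteq> 0" "\<And>j. flag_space Z j = flag_space (v ** W') j"
    "flag_space (u ** W) a = (*v) Z ` coord_space I"
    using ex_common_frame_subspace[OF _ _ a] by metis
  let ?M = "\<lambda>z. mixed_columns I (fst z ** matrix_inv u ** Z) (snd z ** matrix_inv v ** Z)"
  have "(\<lambda>z. ?M z $ r $ i) \<in> poly_funs mat_pair_coords" for r i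
    by (cases "i \<in> I") (auto intro!: poly_funs_matrix_mult poly_funs_fst_coord
        poly_funs_snd_coord poly_funs.const)
  then have "(\<lambda>z. det (?M z)) \<in> poly_funs mat_pair_coords" by (rule poly_funs_det)
  moreover have "?M w = Z" using det_uv by (simp add: vec_eq_iff flip: u_def v_def)
  then have "det (?M w) \<noteq> 0" using Z(1) by simp
  moreover have "rel_pos (fst z ** W) a (snd z ** W') k \<le> c"
    if z: "z \<in> carrier SL \<times> carrier SL" and "det (?M z) \<noteq> 0" for z
  proof -
    let ?x = "fst z ** matrix_inv u" and ?y = "snd z ** matrix_inv v"
    have "rel_pos (?x ** (u ** W)) a (?y ** (v ** W')) k \<le> rel_pos (u ** W) a (v ** W') k"
      using z det_uv \<open>det (?M z) \<noteq> 0\<close>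
      by (intro rel_pos_mult_le_of_mixed_columns[OF _ _ _ Z]) (auto simp: det_mul)
    moreover have "rel_pos (u ** W) a (v ** W') k \<le> c" using w by (simp add: u_def v_def)
    ultimately show ?thesis using det_uv by (simp add: matrix_mul_rassoc)
  qed
  ultimately show "\<exists>f\<in>poly_funs mat_pair_coords. f w \<noteq> 0 \<and> {y \<in> carrier SL \<times> carrier SL. f y \<noteq> 0}
     \<subseteq> {z \<in> carrier SL \<times> carrier SL. rel_pos (fst z ** W) a (snd z ** W') k \<le> c}"
    by (intro bexI[of _ "\<lambda>z. det (?M z)"]) auto
qed auto

locale one_step_double_flag =
  fixes Wp Wq :: "complex^'n^'n" and a :: nat and J :: "nat set"
  assumes det_Wp: "det Wp = 1" and det_Wq: "det Wq = 1" and a: "a \<le> CARD('n)"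
    and J: "J \<subseteq> {..CARD('n)}"
begin

abbreviation P :: "(complex^'n^'n) set" where
  "P \<equiv> flag_stabilizer Wp {a}"

abbreviation Q :: "(complex^'n^'n) set" where
  "Q \<equiv> flag_stabilizer Wq J"

abbreviation orbit_closure ::
    "(complex^'n^'n) \<times> (complex^'n^'n) \<Rightarrow> ((complex^'n^'n) set \<times> (complex^'n^'n) set) set" where
  "orbit_closure z \<equiv> double_flag_topology P Q closure_of orbit SL diag_act (coset_pair P Q z)"

definition rank :: "(complex^'n^'n) \<times> (complex^'n^'n) \<Rightarrow> nat \<Rightarrow> nat" where
  "rank z j = rel_pos (fst z ** Wp) a (snd z ** Wq) j"

lemma rank_cong:
  assumes "z \<in> carrier SL \<times> carrier SL" "w \<in> carrier SL \<times> carrier SL"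
    and "coset_pair P Q z = coset_pair P Q w" "j \<in> J"
  shows "rank z j = rank w j"
  using assms coset_pair_flag_stabilizer_eq_iff[OF assms(1,2), of Wp "{a}" Wq J]
  by (simp add: rank_def rel_pos_def)

lemma rank_translate: "det g = 1 \<Longrightarrow> rank (g ** x, g ** y) j = rank (x, y) j"
  using rel_pos_mult[of g "x ** Wp" a "y ** Wq" j] by (simp add: rank_def matrix_mul_assoc)

lemma openin_rank_le:
  assumes "j \<in> J"
  shows "openin (double_flag_topology P Q)
    (coset_pair P Q ` {z \<in> carrier SL \<times> carrier SL. rank z j \<le> c})"
    (is "openin _ (coset_pair P Q ` ?V)")
proof -
  have "z \<in> ?V" if z: "z \<in> carrier SL \<times> carrier SL"
    and image: "coset_pair P Q z \<in> coset_pair P Q ` ?V" for z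
  proof -
    obtain v where "v \<in> ?V" "coset_pair P Q z = coset_pair P Q v" using image by blast
    then show ?thesis using rank_cong[OF z, of v j] z assms by simp
  qed
  then have "{z \<in> carrier SL \<times> carrier SL. coset_pair P Q z \<in> coset_pair P Q ` ?V} = ?V" by blast
  then show ?thesis
    using openin_rel_pos_le[OF det_Wp det_Wq a, of j c]
    by (auto simp: openin_double_flag_topology double_flag_eq_image rank_def)
qed

lemma rank_le_of_in_orbit_closure:
  assumes z: "z \<in> carrier SL \<times> carrier SL" and w: "w \<in> carrier SL \<times> carrier SL"
    and closure: "coset_pair P Q w \<in> orbit_closure z" and j: "j \<in> J"
  shows "rank z j \<le> rank w j"
proof -
  let ?V = "{z \<in> carrier SL \<times> carrier SL. rank z j \<le> rank w j}"
  have "\<forall>U. coset_pair P Q w \<in> U \<and> openin (double_flag_topology P Q) U \<longrightarrow>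
      (\<exists>S. S \<in> orbit SL diag_act (coset_pair P Q z) \<and> S \<in> U)"
    using closure unfolding in_closure_of by (rule conjunct2)
  moreover have "coset_pair P Q w \<in> coset_pair P Q ` ?V" using w by blast
  ultimately obtain S where S: "S \<in> orbit SL diag_act (coset_pair P Q z)" "S \<in> coset_pair P Q ` ?V"
    using openin_rank_le[OF j, of "rank w j"] by meson
  from S(2) obtain v where v: "v \<in> ?V" "S = coset_pair P Q v" by blast
  have "S \<in> (\<lambda>g. coset_pair P Q (g ** fst z, g ** snd z)) ` carrier SL"
    using S(1) orbit_SL_coset_pair[of P Q "fst z" "snd z"] by simp
  then obtain g where g: "det g = 1" "S = coset_pair P Q (g ** fst z, g ** snd z)" by auto
  have "rank (g ** fst z, g ** snd z) j = rank v j"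
    using z v g by (intro rank_cong[OF _ _ _ j]) (auto simp: det_mul)
  then have "rank z j = rank v j" using rank_translate[OF g(1), of "fst z" "snd z" j] by simp
  then show ?thesis using v by simp
qed

lemma in_orbit_closure_of_rank_le:
  assumes z: "z \<in> carrier SL \<times> carrier SL" and w: "w \<in> carrier SL \<times> carrier SL"
    and le: "\<And>j. j \<in> J \<Longrightarrow> rank z j \<le> rank w j"
  shows "coset_pair P Q w \<in> orbit_closure z"
proof -
  have det: "det (fst z) = 1" "det (snd z) = 1" "det (fst w) = 1" "det (snd w) = 1"
    using z w by auto
  have det_mult: "det (fst z ** Wp) \<noteq> 0" "det (snd z ** Wq) \<noteq> 0" "det (fst w ** Wp) \<noteq> 0"
    "det (snd w ** Wq) \<noteq> 0"
    by (simp_all add: det_mul det det_Wp det_Wq)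
  obtain g where g: "g 0 = mat 1" "polynomial_matrix g" "\<And>t. det (g t) = 1"
    and degenerate: "\<And>t. t \<noteq> 0 \<Longrightarrow> \<exists>h. det h = 1 \<and>
      flag_space (h ** (fst z ** Wp)) a = flag_space (g t ** (fst w ** Wp)) a \<and>
      (\<forall>j\<in>J. flag_space (h ** (snd z ** Wq)) j = flag_space (snd w ** Wq) j)"
    using ex_degeneration[OF det_mult a J] le by (auto simp: rank_def)
  define \<phi> where "\<phi> t = (g t ** fst w, snd w)" for t
  let ?O = "orbit SL diag_act (coset_pair P Q z)"
  have \<phi>_SL: "\<phi> t \<in> carrier SL \<times> carrier SL" for t by (simp add: \<phi>_def det_mul g(3) det)
  have "coset_pair P Q (\<phi> t) \<in> ?O" if t: "t \<noteq> 0" for t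
  proof -
    obtain h where h: "det h = 1"
      "flag_space (h ** (fst z ** Wp)) a = flag_space (g t ** (fst w ** Wp)) a"
      "\<forall>j\<in>J. flag_space (h ** (snd z ** Wq)) j = flag_space (snd w ** Wq) j"
      using degenerate[OF t] by blast
    then have "coset_pair P Q (\<phi> t) = coset_pair P Q (h ** fst z, h ** snd z)"
      using \<phi>_SL[of t] det
      by (subst coset_pair_flag_stabilizer_eq_iff) (simp_all add: \<phi>_def det_mul matrix_mul_assoc)
    then show ?thesis using h(1) orbit_SL_coset_pair[of P Q "fst z" "snd z"] by simp
  qed
  moreover have "polynomial_curve mat_pair_coords \<phi>"
    unfolding \<phi>_def using g(2)
    by (intro polynomial_curve_mat_pair_coords polynomial_matrix_mult polynomial_matrix_const)
  ultimately have "\<phi> 0 \<in> SL_pairs closure_of {z. coset_pair P Q z \<in> ?O}"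
    using \<phi>_SL by (intro polynomial_curve_in_closure_of) auto
  then have "coset_pair P Q (\<phi> 0)
    \<in> double_flag_topology P Q closure_of (coset_pair P Q ` {z. coset_pair P Q z \<in> ?O})"
    unfolding double_flag_topology_eq
    by (rule subsetD[OF continuous_map_image_closure_subset[OF continuous_map_quotient_topology]
      imageI])
  moreover have "coset_pair P Q ` {z. coset_pair P Q z \<in> ?O} \<subseteq> ?O" by blast
  ultimately have "coset_pair P Q (\<phi> 0) \<in> orbit_closure z" using closure_of_mono by blast
  then show ?thesis by (simp add: \<phi>_def g(1))
qed

lemma orbit_closure_subset_iff:
  assumes z: "z \<in> carrier SL \<times> carrier SL" and w: "w \<in> carrier SL \<times> carrier SL"
  shows "orbit_closure w \<subseteq> orbit_closure z \<longleftrightarrow> (\<forall>j\<in>J. rank z j \<le> rank w j)"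
proof
  assume "orbit_closure w \<subseteq> orbit_closure z"
  then have "coset_pair P Q w \<in> orbit_closure z" using in_orbit_closure_of_rank_le[OF w w] by blast
  then show "\<forall>j\<in>J. rank z j \<le> rank w j" using rank_le_of_in_orbit_closure[OF z w] by blast
next
  assume le: "\<forall>j\<in>J. rank z j \<le> rank w j"
  show "orbit_closure w \<subseteq> orbit_closure z"
  proof
    fix S assume S: "S \<in> orbit_closure w"
    then have "S \<in> double_flag P Q"
      using closure_of_subset_topspace[of "double_flag_topology P Q"]
      unfolding topspace_double_flag_topology[symmetric] by blast
    then obtain v where v: "v \<in> carrier SL \<times> carrier SL" "S = coset_pair P Q v"
      unfolding double_flag_eq_image by blast
    then have "rank w j \<le> rank v j" if "j \<in> J" for j
      using rank_le_of_in_orbit_closure[OF w v(1)] S that by simp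
    then show "S \<in> orbit_closure z"
      unfolding v(2) using le by (intro in_orbit_closure_of_rank_le[OF z v(1)]) (meson order_trans)
  qed
qed

lemma ex_rank_eq:
  assumes "unit_steps CARD('n) r" "r CARD('n) = a"
  obtains z where "z \<in> carrier SL \<times> carrier SL" "\<And>j. j \<in> J \<Longrightarrow> rank z j = r j"
proof -
  obtain X :: "complex^'n^'n" where X: "det X = 1" "\<And>j. j \<le> CARD('n) \<Longrightarrow> rel_pos X a (mat 1) j = r j"
    using ex_matrix_with_rel_pos[OF assms] by metis
  show thesis
  proof (rule that)
    show "(X ** matrix_inv Wp, matrix_inv Wq) \<in> carrier SL \<times> carrier SL"
      by (simp add: det_mul X(1) det_Wp det_Wq)
    show "rank (X ** matrix_inv Wp, matrix_inv Wq) j = r j" if "j \<in> J" for j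
      using J that X(2)[of j] by (auto simp: rank_def matrix_mul_rassoc det_Wp det_Wq)
  qed
qed

lemma lattice_orbit_closures: "lattice \<lparr>carrier = orbit_closures P Q, eq = (=), le = (\<subseteq>)\<rparr>"
  unfolding orbit_closures_eq_image
proof (rule lattice_of_order_embedding[where J = J and r = rank])
  fix z w :: "(complex^'n^'n) \<times> (complex^'n^'n)"
  assume zw: "z \<in> carrier SL \<times> carrier SL" "w \<in> carrier SL \<times> carrier SL"
  show "orbit_closure z \<subseteq> orbit_closure w \<longleftrightarrow> (\<forall>j\<in>J. rank w j \<le> rank z j)"
    by (rule orbit_closure_subset_iff[OF zw(2,1)])
  have steps: "unit_steps CARD('n) (rank v)" "rank v CARD('n) = a"
    if "v \<in> carrier SL \<times> carrier SL" for v
    using that unit_steps_rel_pos[of "fst v ** Wp" "snd v ** Wq" a] a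
    by (auto simp: rank_def[abs_def] det_mul det_Wp det_Wq)
  show "\<exists>v\<in>carrier SL \<times> carrier SL. \<forall>j\<in>J. rank v j = inf (rank z j) (rank w j)"
    using ex_rank_eq[OF unit_steps_min[OF steps(1)[OF zw(1)] steps(1)[OF zw(2)]]] steps(2)[OF zw(1)]
      steps(2)[OF zw(2)]
    by (metis inf_min min.idem)
  show "\<exists>v\<in>carrier SL \<times> carrier SL. \<forall>j\<in>J. rank v j = sup (rank z j) (rank w j)"
    using ex_rank_eq[OF unit_steps_max[OF steps(1)[OF zw(1)] steps(1)[OF zw(2)]]] steps(2)[OF zw(1)]
      steps(2)[OF zw(2)]
    by (metis sup_max max.idem)
qed

end

section \<open>Minors as semi-invariants of block triangular matrices\<close>

definition minor_matrix :: "('n \<Rightarrow> 'n) \<Rightarrow> 'n set \<Rightarrow> 'a::comm_ring_1^'n^'n \<Rightarrow> 'a^'n^'n" where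
  "minor_matrix \<pi> S m = (\<chi> r c. if c \<in> S then m $ r $ c else if r = \<pi> c then 1 else 0)"

definition row_matching :: "'n set \<Rightarrow> 'n set \<Rightarrow> 'n \<Rightarrow> 'n" where
  "row_matching R S = (SOME \<pi>. bij \<pi> \<and> \<pi> ` S = R)"

text \<open>If \<open>R\<close> and \<open>S\<close> have the same size then, up to sign, this is the usual minor with rows \<open>R\<close> and
  columns \<open>S\<close>.\<close>

definition minor :: "'n set \<Rightarrow> 'n set \<Rightarrow> 'a::comm_ring_1^'n^'n \<Rightarrow> 'a" where
  "minor R S m = det (minor_matrix (row_matching R S) S m)"

lemma minor_matrix_nth [simp]:
  "minor_matrix \<pi> S m $ r $ c = (if c \<in> S then m $ r $ c else if r = \<pi> c then 1 else 0)"
  by (simp add: minor_matrix_def)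

lemma ex_nested_bijection:
  fixes S S' R R' :: "'n::finite set"
  assumes "S \<subseteq> S'" "R \<subseteq> R'" "card S = card R" "card S' = card R'"
  obtains \<sigma> where "bij \<sigma>" "\<sigma> ` S = R" "\<sigma> ` S' = R'"
proof -
  obtain f where f: "bij_betw f S R" using finite_same_card_bij[of S R] assms by auto
  have "card (S' - S) = card (R' - R)" using assms by (simp add: card_Diff_subset)
  then obtain g where g: "bij_betw g (S' - S) (R' - R)"
    using finite_same_card_bij[of "S' - S" "R' - R"] by auto
  have "card (- S') = card (- R')" using assms by (simp add: Compl_eq_Diff_UNIV card_Diff_subset)
  then obtain h where h: "bij_betw h (- S') (- R')"
    using finite_same_card_bij[of "- S'" "- R'"] by auto
  have fg: "bij_betw (\<lambda>c. if c \<in> S then f c else g c) (S \<union> (S' - S)) (R \<union> (R' - R))"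
    using f g by (intro bij_betw_disjoint_Un) auto
  define \<sigma> where "\<sigma> c = (if c \<in> S \<union> (S' - S) then if c \<in> S then f c else g c else h c)" for c
  have "bij_betw \<sigma> ((S \<union> (S' - S)) \<union> - S') ((R \<union> (R' - R)) \<union> - R')"
    unfolding \<sigma>_def by (rule bij_betw_disjoint_Un[OF fg h]) (use assms in auto)
  moreover have "S \<union> (S' - S) \<union> - S' = UNIV" "R \<union> (R' - R) \<union> - R' = UNIV" by auto
  ultimately have "bij \<sigma>" by simp
  moreover have "\<sigma> ` S = R" using f by (auto simp: \<sigma>_def bij_betw_def)
  moreover have "\<sigma> ` S' = R'"
  proof -
    have "\<sigma> ` S' = (\<lambda>c. if c \<in> S then f c else g c) ` (S \<union> (S' - S))"
      using assms(1) by (intro image_cong) (auto simp: \<sigma>_def)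
    then show ?thesis using fg assms(2) by (auto simp: bij_betw_def)
  qed
  ultimately show thesis by (rule that)
qed

lemma row_matching:
  fixes R S :: "'n::finite set"
  assumes "card R = card S"
  shows "bij (row_matching R S)" "row_matching R S ` S = R"
proof -
  have "\<exists>\<pi>. bij \<pi> \<and> \<pi> ` S = R"
    by (rule ex_nested_bijection[of S S R R]) (use assms in \<open>simp_all, blast\<close>)
  then have "bij (row_matching R S) \<and> row_matching R S ` S = R"
    unfolding row_matching_def by (rule someI_ex)
  then show "bij (row_matching R S)" "row_matching R S ` S = R" by blast+
qed

lemma minor_matrix_mult_right:
  assumes "\<And>r c. r \<notin> S \<Longrightarrow> c \<in> S \<Longrightarrow> q $ r $ c = 0"
  shows "minor_matrix \<pi> S (m ** q) = minor_matrix \<pi> S m ** minor_matrix id S q"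
proof -
  have "(minor_matrix \<pi> S m ** minor_matrix id S q) $ r $ c
    = minor_matrix \<pi> S (m ** q) $ r $ c" for r c
  proof (cases "c \<in> S")
    case True
    have "minor_matrix \<pi> S m $ r $ k * minor_matrix id S q $ k $ c = m $ r $ k * q $ k $ c" for k
      using assms[of k c] True by simp
    then show ?thesis using True by (simp add: matrix_matrix_mult_def del: minor_matrix_nth) simp
  next
    case False
    then show ?thesis
      by (simp add: matrix_matrix_mult_def if_distrib[of "\<lambda>x. _ * x"] cong: if_cong)
  qed
  then show ?thesis by (simp add: vec_eq_iff del: minor_matrix_nth)
qed

lemma minor_mult_right:
  assumes "\<And>r c. r \<notin> S \<Longrightarrow> c \<in> S \<Longrightarrow> q $ r $ c = 0"
  shows "minor R S (m ** q) = minor R S m * det (minor_matrix id S q)"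
  by (simp add: minor_def minor_matrix_mult_right[OF assms] det_mul)

lemma det_minor_matrix_mult_left:
  fixes \<kappa> m :: "'a::field^'n^'n"
  assumes \<pi>: "bij \<pi>" and \<kappa>: "upper \<kappa>" "\<And>r s. r \<in> \<pi> ` S \<Longrightarrow> s \<notin> \<pi> ` S \<Longrightarrow> \<kappa> $ r $ s = 0"
  shows "det (minor_matrix \<pi> S (\<kappa> ** m)) * (\<Prod>r\<in>- \<pi> ` S. \<kappa> $ r $ r)
    = det \<kappa> * det (minor_matrix \<pi> S m)"
proof -
  define D :: "'a^'n^'n" where
    "D = (\<chi> r c. if c \<in> S then (if r = c then 1 else 0) else if r \<in> S then 0 else \<kappa> $ \<pi> r $ \<pi> c)"
  have mem: "\<pi> c \<in> \<pi> ` S \<longleftrightarrow> c \<in> S" for c by (rule inj_image_mem_iff[OF bij_is_inj[OF \<pi>]])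
  have "(minor_matrix \<pi> S (\<kappa> ** m) ** D) $ r $ c = (\<kappa> ** minor_matrix \<pi> S m) $ r $ c" for r c
  proof (cases "c \<in> S")
    case True
    then show ?thesis
      by (simp add: matrix_matrix_mult_def D_def if_distrib[of "\<lambda>x. _ * x"] cong: if_cong)
  next
    case False
    obtain s where s: "r = \<pi> s" using \<pi> by (metis bij_pointE)
    have "(minor_matrix \<pi> S (\<kappa> ** m) ** D) $ r $ c
      = (\<Sum>k\<in>UNIV. minor_matrix \<pi> S (\<kappa> ** m) $ r $ k * D $ k $ c)"
      by (simp add: matrix_matrix_mult_def[of _ D] del: minor_matrix_nth)
    also have "\<dots> = (\<Sum>k\<in>UNIV. if k = s then (if s \<in> S then 0 else \<kappa> $ r $ \<pi> c) else 0)"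
      using False bij_is_inj[OF \<pi>] by (intro sum.cong refl) (auto simp: D_def s inj_eq)
    also have "\<dots> = \<kappa> $ r $ \<pi> c" using \<kappa>(2)[of r "\<pi> c"] False by (simp add: s mem)
    also have "\<dots> = (\<kappa> ** minor_matrix \<pi> S m) $ r $ c"
      using False by (simp add: matrix_matrix_mult_def if_distrib[of "\<lambda>x. _ * x"] cong: if_cong)
    finally show ?thesis .
  qed
  then have "minor_matrix \<pi> S (\<kappa> ** m) ** D = \<kappa> ** minor_matrix \<pi> S m" by (simp add: vec_eq_iff)
  then have "det (minor_matrix \<pi> S (\<kappa> ** m)) * det D = det \<kappa> * det (minor_matrix \<pi> S m)"
    by (metis det_mul)
  moreover have "det D = (\<Prod>c\<in>UNIV. if c \<in> S then 1 else \<kappa> $ \<pi> c $ \<pi> c)"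
  proof -
    have "inj (idx \<circ> \<pi>)" using inj_idx bij_is_inj[OF \<pi>] by (rule inj_compose)
    then have "det D = (\<Prod>c\<in>UNIV. D $ c $ c)"
      by (rule det_triangular) (use \<kappa>(1) in \<open>auto simp: D_def upper_def\<close>)
    then show ?thesis by (simp add: D_def cong: if_cong)
  qed
  moreover have "\<dots> = (\<Prod>r\<in>UNIV. if r \<in> \<pi> ` S then 1 else \<kappa> $ r $ r)"
    using prod.reindex_bij_betw[OF \<pi>, of "\<lambda>r. if r \<in> \<pi> ` S then 1 else \<kappa> $ r $ r"]
    by (simp add: mem)
  moreover have "\<dots> = (\<Prod>r\<in>- \<pi> ` S. \<kappa> $ r $ r)" by (simp add: prod.If_cases)
  ultimately show ?thesis by simp
qed

lemma minor_mult_left: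
  fixes \<kappa> m :: "'a::field^'n^'n"
  assumes "card R = card S" and \<kappa>: "upper \<kappa>" "det \<kappa> \<noteq> 0"
    and zero: "\<And>r s. r \<in> R \<Longrightarrow> s \<notin> R \<Longrightarrow> \<kappa> $ r $ s = 0"
  shows "minor R S (\<kappa> ** m) = (\<Prod>r\<in>R. \<kappa> $ r $ r) * minor R S m"
proof -
  let ?w = "\<lambda>R. \<Prod>r\<in>R. \<kappa> $ r $ r"
  have "minor R S (\<kappa> ** m) * ?w (- R) = det \<kappa> * minor R S m"
    using det_minor_matrix_mult_left[OF row_matching(1)[OF assms(1)] \<kappa>(1), of S m] zero
    by (simp add: minor_def row_matching(2)[OF assms(1)])
  also have det: "det \<kappa> = ?w R * ?w (- R)"
    using prod.union_disjoint[of R "- R" "\<lambda>r. \<kappa> $ r $ r"]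
    by (simp add: det_upper[OF \<kappa>(1)] Compl_partition)
  finally have "minor R S (\<kappa> ** m) * ?w (- R) = (?w R * minor R S m) * ?w (- R)" by simp
  moreover have "?w (- R) \<noteq> 0" using det \<kappa>(2) by auto
  ultimately show ?thesis by simp
qed

lemma poly_funs_minor: "minor R S \<in> poly_funs mat_coords"
proof -
  have "(\<lambda>m. minor_matrix (row_matching R S) S m $ r $ c) \<in> poly_funs mat_coords" for r c
    by (cases "c \<in> S") (simp_all add: poly_funs_mat_coord poly_funs.const)
  from poly_funs_det[OF this] show ?thesis by (simp add: minor_def[abs_def])
qed

lemma minor_eq_0_of_zero_row:
  fixes m :: "'a::field^'n^'n"
  assumes "card R = card S" "r \<in> R" "\<And>c. c \<in> S \<Longrightarrow> m $ r $ c = 0"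
  shows "minor R S m = 0"
proof -
  have "r \<noteq> row_matching R S c" if "c \<notin> S" for c
    using assms(2) that row_matching[OF assms(1)]
      inj_image_mem_iff[OF bij_is_inj, of "row_matching R S" c S]
    by auto
  then have "row r (minor_matrix (row_matching R S) S m) = 0"
    using assms(3) by (simp add: row_def vec_eq_iff)
  then show ?thesis unfolding minor_def by (rule det_zero_row)
qed

lemma det_permutation_plus_entry_nonzero:
  fixes M :: "'a::field^'n^'n"
  assumes \<theta>: "inj \<theta>" and "r0 \<noteq> \<theta> c0"
    and M: "\<And>r c. M $ r $ c = (if r = \<theta> c \<or> r = r0 \<and> c = c0 then 1 else 0)"
  shows "det M \<noteq> 0"
proof -
  have "v = 0" if "M *v v = 0" for v
  proof -
    have row: "(M *v v) $ (\<theta> k) = v $ k + (if \<theta> k = r0 then v $ c0 else 0)" for k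
    proof -
      have "(\<Sum>c\<in>UNIV. M $ \<theta> k $ c * v $ c)
          = (\<Sum>c\<in>UNIV. (if c = k then v $ k else 0) + (if c = c0 then
            (if \<theta> k = r0 then v $ c0 else 0) else 0))"
        by (intro sum.cong refl) (use assms in \<open>auto simp: M inj_eq\<close>)
      then show ?thesis by (simp add: matrix_vector_mult_def sum.distrib)
    qed
    have "v $ c0 = 0" using row[of c0] assms(2) that by simp
    then have "v $ k = 0" for k using row[of k] that by (simp split: if_splits)
    then show ?thesis by (simp add: vec_eq_iff)
  qed
  then show ?thesis using det_eq_0_iff_kernel by blast
qed

lemma ex_permutation_plus_entry:
  assumes "inj \<theta>" "r0 \<noteq> \<theta> c0"
  obtains m :: "'a::field^'n^'n" where "det m = 1"
    "\<And>r c. c \<noteq> d \<Longrightarrow> m $ r $ c = (if r = \<theta> c \<or> r = r0 \<and> c = c0 then 1 else 0)"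
proof -
  define M :: "'a^'n^'n" where "M = (\<chi> r c. if r = \<theta> c \<or> r = r0 \<and> c = c0 then 1 else 0)"
  have "det M \<noteq> 0" by (rule det_permutation_plus_entry_nonzero[OF assms]) (simp add: M_def)
  then show thesis using that[of "scale_column d (inverse (det M)) M"] by (simp add: M_def)
qed

lemma minor_permutation_plus_entry_nonzero:
  fixes m :: "'a::field^'n^'n"
  assumes f: "inj_on f S" "f ` S = R" and "c0 \<in> S" "r0 \<noteq> f c0"
    and m: "\<And>r c. c \<in> S \<Longrightarrow> m $ r $ c = (if r = f c \<or> r = r0 \<and> c = c0 then 1 else 0)"
  shows "minor R S m \<noteq> 0"
proof -
  let ?\<pi> = "row_matching R S"
  let ?\<theta> = "\<lambda>c. if c \<in> S then f c else ?\<pi> c"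
  have "card R = card S" using card_image[OF f(1)] f(2) by simp
  note \<pi> = row_matching[OF this]
  have "bij_betw ?\<pi> (- S) (- R)"
    using bij_image_Compl_eq[OF \<pi>(1), of S] \<pi>
    by (auto simp: bij_betw_def intro: inj_on_subset)
  then have "bij_betw ?\<theta> (S \<union> - S) (R \<union> - R)"
    using f by (intro bij_betw_disjoint_Un) (auto simp: bij_betw_def)
  then have "inj ?\<theta>" by (simp add: Compl_partition bij_is_inj)
  then show ?thesis
    unfolding minor_def
    by (rule det_permutation_plus_entry_nonzero[where ?r0.0 = r0 and ?c0.0 = c0])
      (use assms in auto)
qed

text \<open>On permutation matrices the two nonvanishing conditions are incompatible, since \<open>insert \<rho>' N\<close>
  is not contained in \<open>insert \<rho> (N \<union> T)\<close>; one additional entry in the row of some \<open>t \<in> T\<close>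
  repairs this.\<close>

lemma ex_separating_matrix:
  fixes N T :: "'n::finite set"
  assumes S: "S1 \<subseteq> S2" "S2 \<noteq> UNIV"
    and disjoint: "N \<inter> T = {}" "\<rho> \<notin> N \<union> T" "\<rho>' \<notin> N \<union> T" "\<rho> \<noteq> \<rho>'" and T: "T \<noteq> {}"
    and card: "card S1 = card N + 1" "card S2 = card N + card T + 1"
  obtains m :: "'a::field^'n^'n" where "det m = 1" "minor (insert \<rho>' N) S1 m \<noteq> 0"
    "minor (insert \<rho> (N \<union> T)) S2 m \<noteq> 0" "minor (insert \<rho> N) S1 m = 0"
proof -
  obtain t where t: "t \<in> T" using T by blast
  have neq: "t \<noteq> \<rho>'" "t \<noteq> \<rho>" "t \<notin> N" using disjoint t by auto
  let ?R1 = "insert \<rho>' N" and ?R2 = "insert \<rho> (insert \<rho>' (N \<union> (T - {t})))"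
  have card_R1: "card ?R1 = card S1" using disjoint card by simp
  have "card (N \<union> (T - {t})) = card N + (card T - 1)"
    using disjoint(1) t by (subst card_Un_disjoint) auto
  then have card_R2: "card S2 = card ?R2" using disjoint card T by (simp add: card_gt_0_iff)
  obtain \<sigma> where \<sigma>: "bij \<sigma>" "\<sigma> ` S1 = ?R1" "\<sigma> ` S2 = ?R2"
    by (rule ex_nested_bijection[of S1 S2 ?R1 ?R2]) (use S card_R1 card_R2 in auto)
  then have inj: "inj \<sigma>" by (simp add: bij_is_inj)
  obtain c where c: "c \<in> S1" "\<sigma> c = \<rho>'" using \<sigma>(2) by (metis imageE insertI1)
  obtain d where d: "d \<notin> S2" using S(2) by blast
  obtain m :: "'a^'n^'n" where m: "det m = 1"
    "\<And>r k. k \<noteq> d \<Longrightarrow> m $ r $ k = (if r = \<sigma> k \<or> r = t \<and> k = c then 1 else 0)"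
    using ex_permutation_plus_entry[OF inj, of t c] c(2) neq(1) by metis
  have m_S2: "m $ r $ k = (if r = \<sigma> k \<or> r = t \<and> k = c then 1 else 0)" if "k \<in> S2" for r k
    using m(2)[of k r] that d by blast
  have "minor ?R1 S1 m \<noteq> 0"
    using \<sigma>(2) c neq S(1) inj_on_subset[OF inj]
    by (intro minor_permutation_plus_entry_nonzero[of \<sigma> S1 _ c t]) (auto simp: m_S2 subset_iff)
  moreover have "minor (insert \<rho> (N \<union> T)) S2 m \<noteq> 0"
  proof (rule minor_permutation_plus_entry_nonzero[of "\<sigma>(c := t)" S2 _ c \<rho>'])
    have "(\<sigma>(c := t)) ` S2 = insert t (?R2 - {\<rho>'})"
      using c S(1) \<sigma>(3) image_set_diff[OF inj, of S2 "{c}"] by (auto simp: fun_upd_image)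
    also have "\<dots> = insert \<rho> (N \<union> T)" using disjoint t by auto
    finally show image: "(\<sigma>(c := t)) ` S2 = insert \<rho> (N \<union> T)" .
    have "card (insert \<rho> (N \<union> T)) = card S2" using disjoint card by (simp add: card_Un_disjoint)
    then show "inj_on (\<sigma>(c := t)) S2" using image by (intro eq_card_imp_inj_on) auto
    show "c \<in> S2" using c(1) S(1) by blast
    show "\<rho>' \<noteq> (\<sigma>(c := t)) c" using neq(1) by simp
    show "m $ r $ k = (if r = (\<sigma>(c := t)) k \<or> r = \<rho>' \<and> k = c then 1 else 0)" if "k \<in> S2" for r k
      unfolding m_S2[OF that] by (cases "k = c") (simp_all add: c(2) disj_commute)
  qed
  moreover have "minor (insert \<rho> N) S1 m = 0"
  proof (rule minor_eq_0_of_zero_row)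
    show "m $ \<rho> $ k = 0" if "k \<in> S1" for k
    proof -
      have "\<sigma> k \<in> ?R1" using that \<sigma>(2) by blast
      then have "\<rho> \<noteq> \<sigma> k" using disjoint(2,4) by blast
      then show ?thesis using neq(2) m_S2[of k \<rho>] that S(1) by auto
    qed
  qed (use disjoint card in auto)
  ultimately show thesis using that m(1) by blast
qed

definition block_terminal :: "('n::finite \<Rightarrow> 'b) \<Rightarrow> 'n set \<Rightarrow> bool" where
  "block_terminal bl R \<longleftrightarrow> (\<forall>r\<in>R. \<forall>s. idx r \<le> idx s \<longrightarrow> bl r = bl s \<longrightarrow> s \<in> R)"

definition block_upper :: "('n \<Rightarrow> 'b) \<Rightarrow> 'a::zero^'n^'n \<Rightarrow> bool" where
  "block_upper bl \<kappa> \<longleftrightarrow> upper \<kappa> \<and> (\<forall>r s. \<kappa> $ r $ s \<noteq> 0 \<longrightarrow> bl r = bl s)"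

lemma block_upper_eq_0:
  assumes "block_upper bl \<kappa>" "block_terminal bl R" "r \<in> R" "s \<notin> R"
  shows "\<kappa> $ r $ s = 0"
proof (rule ccontr)
  assume nz: "\<kappa> $ r $ s \<noteq> 0"
  then have "bl r = bl s" using assms(1) by (auto simp: block_upper_def)
  moreover have "idx r \<le> idx s" using nz assms(1) upperD[of \<kappa> s r] by (force simp: block_upper_def)
  ultimately show False using assms(2-4) by (auto simp: block_terminal_def)
qed

definition terminal :: "('n::finite \<Rightarrow> 'b) \<Rightarrow> 'b \<Rightarrow> nat \<Rightarrow> 'n set" where
  "terminal bl l c = {r. bl r = l \<and> card {s. bl s = l} \<le> count_below {s. bl s = l} (idx r) + c}"

lemma terminal_subset_block: "terminal bl l c \<subseteq> {r. bl r = l}"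
  by (auto simp: terminal_def)

lemma terminal_mono: "c \<le> d \<Longrightarrow> terminal bl l c \<subseteq> terminal bl l d"
  by (auto simp: terminal_def)

lemma card_terminal:
  assumes "c \<le> card {s. bl s = l}"
  shows "card (terminal bl l c) = c"
proof -
  let ?X = "{s. bl s = l}"
  let ?pos = "\<lambda>i. count_below ?X (idx i)"
  have bij: "bij_betw ?pos ?X {..<card ?X}" by (rule bij_betw_count_below)
  have pos_less: "?pos i < card ?X" if "bl i = l" for i using bij_betwE[OF bij] that by auto
  have "terminal bl l c = {i \<in> ?X. ?pos i \<in> {card ?X - c..<card ?X}}"
    using pos_less by (auto simp: terminal_def)
  also have "?pos ` \<dots> = ?pos ` ?X \<inter> {card ?X - c..<card ?X}" by blast
  also have "\<dots> = {card ?X - c..<card ?X}" using bij_betw_imp_surj_on[OF bij] by auto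
  finally have "?pos ` terminal bl l c = {card ?X - c..<card ?X}" .
  moreover have "inj_on ?pos (terminal bl l c)"
    by (rule inj_on_subset[OF bij_betw_imp_inj_on[OF bij] terminal_subset_block])
  ultimately have "card (terminal bl l c) = card {card ?X - c..<card ?X}" by (metis card_image)
  then show ?thesis using assms by simp
qed

lemma terminal_Suc:
  assumes "c < card {s. bl s = l}"
  obtains r where "r \<notin> terminal bl l c" "bl r = l"
    "terminal bl l (Suc c) = insert r (terminal bl l c)"
proof -
  have "card (terminal bl l (Suc c) - terminal bl l c) = 1"
    using assms terminal_mono[of c "Suc c" bl l] by (simp add: card_Diff_subset card_terminal)
  then obtain r where r: "terminal bl l (Suc c) - terminal bl l c = {r}" by (rule card_1_singletonE)
  then have "terminal bl l (Suc c) = insert r (terminal bl l c)"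
    using terminal_mono[of c "Suc c" bl l] by auto
  then show thesis using that r terminal_subset_block[of bl l "Suc c"] by blast
qed

lemma block_terminal_terminal: "block_terminal bl (terminal bl l c)"
proof -
  have "count_below X (idx r) \<le> count_below X (idx s)"
    if "idx r \<le> idx s" for r s :: 'a and X :: "'a set"
    using that by (rule count_below_mono)
  then show ?thesis unfolding block_terminal_def terminal_def by (fastforce intro: order_trans)
qed

lemma block_terminal_Un: "block_terminal bl R \<Longrightarrow> block_terminal bl R' \<Longrightarrow> block_terminal bl (R \<union> R')"
  unfolding block_terminal_def by blast

lemma ex_block_shares:
  fixes p q s d b :: nat
  assumes "0 < p" "0 < q" "d \<le> s" "0 < b" "b + d < p + q + s"
  obtains u v w where "u < p" "v < q" "w + d \<le> s" "Suc (u + v + w) = b"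
proof -
  define v where "v = min (b - 1) (q - 1)"
  define u where "u = min (b - 1 - v) (p - 1)"
  have uv: "v \<le> b - 1" "v \<le> q - 1" "u \<le> b - 1 - v" "u \<le> p - 1"
    "v = b - 1 \<or> v = q - 1" "u = b - 1 - v \<or> u = p - 1"
    by (auto simp: u_def v_def min_def)
  show thesis by (rule that[of u v "b - 1 - v - u"]) (use assms uv in linarith)+
qed

lemma card_three_blocks:
  fixes bl :: "'n::finite \<Rightarrow> 'b"
  assumes "\<And>r. bl r \<in> {i, j, k}" "i \<noteq> j" "i \<noteq> k" "j \<noteq> k"
  shows "card {r. bl r = i} + card {r. bl r = j} + card {r. bl r = k} = CARD('n)"
proof -
  have "card ({r. bl r = i} \<union> {r. bl r = j} \<union> {r. bl r = k})
    = card {r. bl r = i} + card {r. bl r = j} + card {r. bl r = k}"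
    using assms(2-4) by (subst card_Un_disjoint, auto)+
  moreover have "{r. bl r = i} \<union> {r. bl r = j} \<union> {r. bl r = k} = UNIV" using assms(1) by auto
  ultimately show ?thesis by simp
qed

lemma ex_terminal_row_sets:
  fixes bl :: "'n::finite \<Rightarrow> 'b"
  assumes bl: "\<And>r. bl r \<in> {i, j, k}" "i \<noteq> j" "i \<noteq> k" "j \<noteq> k"
    and nonempty: "{r. bl r = i} \<noteq> {}" "{r. bl r = j} \<noteq> {}"
    and b: "0 < b1" "b1 < b2" "b2 < CARD('n)" and big: "b2 - b1 \<le> card {r. bl r = k}"
  obtains N T :: "'n set" and \<rho> \<rho>' where "N \<inter> T = {}" "\<rho> \<notin> N \<union> T" "\<rho>' \<notin> N \<union> T" "\<rho> \<noteq> \<rho>'"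
    "Suc (card N) = b1" "card T = b2 - b1"
    "block_terminal bl (insert \<rho> N)" "block_terminal bl (insert \<rho>' N)"
    "block_terminal bl (insert \<rho> (N \<union> T))" "block_terminal bl (insert \<rho>' (N \<union> T))"
proof -
  let ?X = "\<lambda>l. {r. bl r = l}"
  have pos: "0 < card (?X i)" "0 < card (?X j)" using nonempty by (simp_all add: card_gt_0_iff)
  have total: "b1 + (b2 - b1) < card (?X i) + card (?X j) + card (?X k)"
    using b card_three_blocks[of bl, OF bl] by simp
  obtain u v w where uvw: "u < card (?X i)" "v < card (?X j)"
    "w + (b2 - b1) \<le> card (?X k)" "Suc (u + v + w) = b1"
    by (rule ex_block_shares[OF pos big b(1) total])
  let ?t = "terminal bl"
  obtain \<rho> where \<rho>: "\<rho> \<notin> ?t i u" "bl \<rho> = i" "?t i (Suc u) = insert \<rho> (?t i u)"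
    using terminal_Suc[of u bl i] uvw(1) by auto
  obtain \<rho>' where \<rho>': "\<rho>' \<notin> ?t j v" "bl \<rho>' = j" "?t j (Suc v) = insert \<rho>' (?t j v)"
    using terminal_Suc[of v bl j] uvw(2) by auto
  define N where "N = ?t i u \<union> ?t j v \<union> ?t k w"
  define T where "T = ?t k (w + (b2 - b1)) - ?t k w"
  have disj: "?t l c \<inter> ?t l' d = {}" if "l \<noteq> l'" for l l' c d
    using that terminal_subset_block[of bl l c] terminal_subset_block[of bl l' d] by blast
  have terminal: "block_terminal bl (?t i c \<union> ?t j d \<union> ?t k e)" for c d e
    by (intro block_terminal_Un block_terminal_terminal)
  have N_T: "N \<union> T = ?t i u \<union> ?t j v \<union> ?t k (w + (b2 - b1))"
    using terminal_mono[of w "w + (b2 - b1)" bl k] by (auto simp: N_def T_def)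
  have outside: "\<rho> \<notin> N \<union> T" "\<rho>' \<notin> N \<union> T"
    unfolding N_T using \<rho>(1,2) \<rho>'(1,2) bl(2-4) terminal_subset_block by fastforce+
  show thesis
  proof (rule that[OF _ outside])
    show "N \<inter> T = {}" using disj[OF bl(3)] disj[OF bl(4)] unfolding N_def T_def by blast
    show "\<rho> \<noteq> \<rho>'" using \<rho>(2) \<rho>'(2) bl(2) by auto
    have "card N = u + v + w"
      using uvw bl(2-4)
      by (simp add: N_def card_Un_disjoint Int_Un_distrib2 disj card_terminal)
    then show "Suc (card N) = b1" using uvw(4) by simp
    show "card T = b2 - b1"
      using uvw(3) terminal_mono[of w "w + (b2 - b1)" bl k]
      by (simp add: T_def card_Diff_subset card_terminal)
    show "block_terminal bl (insert \<rho> N)" using terminal[of "Suc u" v w] by (simp add: N_def \<rho>(3))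
    show "block_terminal bl (insert \<rho>' N)" using terminal[of u "Suc v" w] by (simp add: N_def \<rho>'(3))
    show "block_terminal bl (insert \<rho> (N \<union> T))"
      using terminal[of "Suc u" v "w + (b2 - b1)"] unfolding N_T by (simp add: \<rho>(3))
    show "block_terminal bl (insert \<rho>' (N \<union> T))"
      using terminal[of u "Suc v" "w + (b2 - b1)"] unfolding N_T by (simp add: \<rho>'(3))
  qed
qed

definition crossed_minors ::
    "'n set \<Rightarrow> 'n set \<Rightarrow> 'n set \<Rightarrow> 'n set \<Rightarrow> 'n \<Rightarrow> 'n \<Rightarrow> 'a::comm_ring_1^'n^'n \<Rightarrow> 'a" where
  "crossed_minors S1 S2 N T \<rho> \<rho>' m = minor (insert \<rho>' N) S1 m * minor (insert \<rho> (N \<union> T)) S2 m"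

text \<open>The factor on the right is symmetric in \<open>\<rho>\<close> and \<open>\<rho>'\<close>, whereas \<open>crossed_minors\<close> is not.\<close>

lemma crossed_minors_mult:
  fixes \<kappa> m q :: "'a::field^'n^'n"
  assumes card: "card S1 = Suc (card N)" "card S2 = Suc (card (N \<union> T))"
    and \<rho>: "\<rho> \<notin> N \<union> T" "\<rho>' \<notin> N \<union> T"
    and terminal: "block_terminal bl (insert \<rho>' N)" "block_terminal bl (insert \<rho> (N \<union> T))"
    and \<kappa>: "block_upper bl \<kappa>" "det \<kappa> \<noteq> 0"
    and q: "\<forall>S\<in>{S1, S2}. (*v) q ` coord_space S \<subseteq> coord_space S"
  shows "crossed_minors S1 S2 N T \<rho> \<rho>' (\<kappa> ** m ** q) =
    (\<kappa> $ \<rho> $ \<rho> * \<kappa> $ \<rho>' $ \<rho>' * (\<Prod>r\<in>N. \<kappa> $ r $ r) * (\<Prod>r\<in>N \<union> T. \<kappa> $ r $ r) *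
      det (minor_matrix id S1 q) * det (minor_matrix id S2 q)) * crossed_minors S1 S2 N T \<rho> \<rho>' m"
proof -
  have upper: "upper \<kappa>" using \<kappa>(1) by (simp add: block_upper_def)
  have minor: "minor R S (\<kappa> ** m ** q)
    = (\<Prod>r\<in>R. \<kappa> $ r $ r) * det (minor_matrix id S q) * minor R S m"
    if "S \<in> {S1, S2}" "card R = card S" "block_terminal bl R" for R S
  proof -
    have "minor R S (\<kappa> ** m ** q) = minor R S (\<kappa> ** m) * det (minor_matrix id S q)"
      using q that(1)
      unfolding matrix_image_coord_space_subset_iff by (blast intro: minor_mult_right)
    moreover have "minor R S (\<kappa> ** m) = (\<Prod>r\<in>R. \<kappa> $ r $ r) * minor R S m"
      by (rule minor_mult_left[OF that(2) upper \<kappa>(2)]) (rule block_upper_eq_0[OF \<kappa>(1) that(3)])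
    ultimately show ?thesis by simp
  qed
  have "card (insert \<rho>' N) = card S1" "card (insert \<rho> (N \<union> T)) = card S2" using \<rho> card by simp_all
  then show ?thesis
    unfolding crossed_minors_def
    using minor[of S1 "insert \<rho>' N"] minor[of S2 "insert \<rho> (N \<union> T)"] terminal \<rho>
    by simp
qed

lemma crossed_minors_proportional:
  fixes \<kappa> m q :: "'a::field^'n^'n"
  assumes card: "card S1 = Suc (card N)" "card S2 = Suc (card (N \<union> T))"
    and \<rho>: "\<rho> \<notin> N \<union> T" "\<rho>' \<notin> N \<union> T"
    and terminal: "block_terminal bl (insert \<rho> N)" "block_terminal bl (insert \<rho>' N)"
      "block_terminal bl (insert \<rho> (N \<union> T))" "block_terminal bl (insert \<rho>' (N \<union> T))"
    and \<kappa>: "block_upper bl \<kappa>" "det \<kappa> \<noteq> 0"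
    and q: "\<forall>S\<in>{S1, S2}. (*v) q ` coord_space S \<subseteq> coord_space S"
  shows "crossed_minors S1 S2 N T \<rho> \<rho>' m * crossed_minors S1 S2 N T \<rho>' \<rho> (\<kappa> ** m ** q) =
    crossed_minors S1 S2 N T \<rho> \<rho>' (\<kappa> ** m ** q) * crossed_minors S1 S2 N T \<rho>' \<rho> m"
  unfolding crossed_minors_mult[OF card \<rho> terminal(2,3) \<kappa> q]
    crossed_minors_mult[OF card \<rho>(2,1) terminal(1,4) \<kappa> q]
  by (simp add: mult_ac)

lemma poly_funs_crossed_minors: "crossed_minors S1 S2 N T \<rho> \<rho>' \<in> poly_funs mat_coords"
  unfolding crossed_minors_def[abs_def] by (intro poly_funs.mult poly_funs_minor)

lemma ex_crossed_minors_not_proportional: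
  fixes N T :: "'n::finite set"
  assumes S: "S1 \<subseteq> S2" "S2 \<noteq> UNIV"
    and disjoint: "N \<inter> T = {}" "\<rho> \<notin> N \<union> T" "\<rho>' \<notin> N \<union> T" "\<rho> \<noteq> \<rho>'" and T: "T \<noteq> {}"
    and card: "card S1 = card N + 1" "card S2 = card N + card T + 1"
  obtains m m' :: "'a::field^'n^'n" where "det m = 1" "det m' = 1"
    "crossed_minors S1 S2 N T \<rho> \<rho>' m * crossed_minors S1 S2 N T \<rho>' \<rho> m' \<noteq>
     crossed_minors S1 S2 N T \<rho> \<rho>' m' * crossed_minors S1 S2 N T \<rho>' \<rho> m"
proof -
  note separating = ex_separating_matrix[OF S disjoint(1) _ _ _ T card]
  obtain m :: "'a^'n^'n" where m: "det m = 1" "minor (insert \<rho>' N) S1 m \<noteq> 0"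
    "minor (insert \<rho> (N \<union> T)) S2 m \<noteq> 0" "minor (insert \<rho> N) S1 m = 0"
    by (rule separating[OF disjoint(2-4)])
  obtain m' :: "'a^'n^'n" where m': "det m' = 1" "minor (insert \<rho> N) S1 m' \<noteq> 0"
    "minor (insert \<rho>' (N \<union> T)) S2 m' \<noteq> 0" "minor (insert \<rho>' N) S1 m' = 0"
    by (rule separating[OF disjoint(3,2) disjoint(4)[symmetric]])
  show thesis by (rule that[OF m(1) m'(1)]) (use m m' in \<open>simp add: crossed_minors_def\<close>)
qed

lemma no_transitive_block_action:
  fixes U :: "(complex^'n^'n) set" and bl :: "'n \<Rightarrow> 'b"
  assumes U: "openin SL_topology U" "U \<noteq> {}"
    and b: "0 < b1" "b1 < b2" "b2 < CARD('n)"
    and bl: "\<And>r. bl r \<in> {i, j, k}" "i \<noteq> j" "i \<noteq> k" "j \<noteq> k" "{r. bl r = i} \<noteq> {}" "{r. bl r = j} \<noteq> {}"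
    and big: "b2 - b1 \<le> card {r. bl r = k}"
    and transitive: "\<And>m m'. m \<in> U \<Longrightarrow> m' \<in> U \<Longrightarrow> \<exists>\<kappa> q. block_upper bl \<kappa> \<and> det \<kappa> = 1 \<and>
      (\<forall>l\<in>{b1, b2}. flag_space q l \<subseteq> std_flag l) \<and> m' = \<kappa> ** m ** q"
  shows False
proof -
  obtain N T :: "'n set" and \<rho> \<rho>' where disjoint: "N \<inter> T = {}" "\<rho> \<notin> N \<union> T" "\<rho>' \<notin> N \<union> T" "\<rho> \<noteq> \<rho>'"
    and card: "Suc (card N) = b1" "card T = b2 - b1"
    and terminal: "block_terminal bl (insert \<rho> N)" "block_terminal bl (insert \<rho>' N)"
      "block_terminal bl (insert \<rho> (N \<union> T))" "block_terminal bl (insert \<rho>' (N \<union> T))"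
    by (rule ex_terminal_row_sets[OF bl b big])
  define S1 S2 :: "'n set" where "S1 = {c. idx c < b1}" and "S2 = {c. idx c < b2}"
  have card_S: "card S1 = b1" "card S2 = b2" using b by (simp_all add: S1_def S2_def)
  have "S1 \<subseteq> S2" using b by (auto simp: S1_def S2_def)
  moreover have "S2 \<noteq> UNIV" using card_S(2) b(3) by auto
  ultimately have S: "S1 \<subseteq> S2" "S2 \<noteq> UNIV" .
  have "card (N \<union> T) = card N + card T" using disjoint(1) by (simp add: card_Un_disjoint)
  then have card_rows: "card S1 = Suc (card N)" "card S2 = Suc (card (N \<union> T))"
    "card S1 = card N + 1" "card S2 = card N + card T + 1" using card card_S b by auto
  let ?f = "crossed_minors S1 S2 N T \<rho> \<rho>'" and ?g = "crossed_minors S1 S2 N T \<rho>' \<rho>"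
  have on_U: "?f m * ?g m' = ?f m' * ?g m" if m: "m \<in> U" "m' \<in> U" for m m'
  proof -
    obtain \<kappa> q where \<kappa>: "block_upper bl \<kappa>" "det \<kappa> = 1"
      and q: "\<forall>l\<in>{b1, b2}. flag_space q l \<subseteq> std_flag l" and m': "m' = \<kappa> ** m ** q"
      using transitive[OF m] by blast
    have "\<forall>S\<in>{S1, S2}. (*v) q ` coord_space S \<subseteq> coord_space S"
      using q by (simp add: flag_space_def std_flag_def S1_def S2_def)
    then show ?thesis
      unfolding m' using \<kappa>
      by (intro crossed_minors_proportional[OF card_rows(1,2) disjoint(2,3) terminal]) simp_all
  qed
  have proportional: "?f m * ?g m' = ?f m' * ?g m"
    if "det m = 1" "det m' = 1" for m m' :: "complex^'n^'n"
  proof (rule proportional_of_proportional_on_open)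
    show "irreduciblein (subtopology (zariski mat_coords) (carrier SL))
        (carrier SL :: (complex^'n^'n) set)"
      using irreduciblein_SL by (simp only: SL_topology_def)
    show "openin (subtopology (zariski mat_coords) (carrier SL)) U"
      using U(1) by (simp only: SL_topology_def)
  qed (use U(2) on_U that in \<open>auto intro: poly_funs_crossed_minors\<close>)
  have "T \<noteq> {}" using card(2) b(2) by auto
  obtain m m' :: "complex^'n^'n" where "det m = 1" "det m' = 1" "?f m * ?g m' \<noteq> ?f m' * ?g m"
    by (rule ex_crossed_minors_not_proportional[OF S disjoint \<open>T \<noteq> {}\<close> card_rows(3,4)])
  then show False using proportional by blast
qed

section \<open>Two flags with two steps each are never spherical\<close>

definition opposite :: "'a::field^'n^'n \<Rightarrow> nat \<Rightarrow> 'a^'n^'n \<Rightarrow> bool" where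
  "opposite X l Y \<longleftrightarrow> rel_pos X l Y (CARD('n) - l) = 0"

lemma openin_opposite:
  fixes W W' :: "complex^'n^'n"
  assumes W: "det W = 1" "det W' = 1" and l: "l \<le> CARD('n)"
  shows "openin SL_topology {x. det x = 1 \<and> opposite (x ** W) l W'}"
proof -
  have "openin SL_topology {x. (x, mat 1) \<in>
      {z \<in> carrier SL \<times> carrier SL. rel_pos (fst z ** W) l (snd z ** W') (CARD('n) - l) \<le> 0}}"
    by (rule openin_SL_slice(1)[OF openin_rel_pos_le[OF assms]]) simp
  then show ?thesis by (simp add: opposite_def)
qed

lemma ex_opposite:
  fixes W W' :: "complex^'n^'n"
  assumes W: "det W = 1" "det W' = 1" and l: "l \<le> CARD('n)"
  obtains x where "det x = 1" "opposite (x ** W) l W'"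
proof (rule ex_matrix_with_rel_pos[of "\<lambda>j. j - (CARD('n) - l)" l, where 'n = 'n and 'a = complex])
  show "unit_steps CARD('n) (\<lambda>j. j - (CARD('n) - l))" by (auto simp: unit_steps_def)
  show "CARD('n) - (CARD('n) - l) = l" using l by simp
  fix X :: "complex^'n^'n"
  assume X: "det X = 1" "\<And>j. j \<le> CARD('n) \<Longrightarrow> rel_pos X l (mat 1) j = j - (CARD('n) - l)"
  have "(W' ** X ** matrix_inv W) ** W = W' ** X" using W by (simp add: matrix_mul_rassoc)
  moreover have "rel_pos (W' ** X) l W' (CARD('n) - l) = 0"
    using X(2)[of "CARD('n) - l"] rel_pos_mult[of W' X l "mat 1" "CARD('n) - l"] W by simp
  ultimately show thesis
    using that[of "W' ** X ** matrix_inv W"] W X(1) by (simp add: opposite_def det_mul)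
qed

lemma ex_opposite_frame:
  fixes X Y :: "'a::field^'n^'n"
  assumes det: "det X \<noteq> 0" "det Y \<noteq> 0"
    and L: "L \<subseteq> {..CARD('n)}" "\<And>l. l \<in> L \<Longrightarrow> opposite X l Y"
  obtains Z where "det Z = det Y" "\<And>j. flag_space Z j = flag_space Y j"
    "\<And>l. l \<in> L \<Longrightarrow> flag_space X l = (*v) Z ` coord_space {i. CARD('n) - l \<le> idx i}"
proof -
  obtain Z and \<tau> :: "'n \<Rightarrow> 'n" where Z: "det Z = det Y" "bij \<tau>" "\<And>j. flag_space Z j = flag_space Y j"
    "\<And>a. flag_space X a = (*v) Z ` coord_space (\<tau> ` {i. idx i < a})"
    using ex_common_frame_flags[OF det] by metis
  have "flag_space X l = (*v) Z ` coord_space {i. CARD('n) - l \<le> idx i}" if "l \<in> L" for l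
  proof -
    have l: "l \<le> CARD('n)" using that L(1) by auto
    have "count_below (\<tau> ` {i. idx i < l}) (CARD('n) - l) = 0"
      using L(2)[OF that] det(2) Z rel_pos_eq_count_below[OF _ Z(3,4)] by (simp add: opposite_def)
    then have "\<tau> ` {i. idx i < l} \<subseteq> {i. CARD('n) - l \<le> idx i}"
      by (auto simp: count_below_def not_less)
    then have "\<tau> ` {i. idx i < l} = {i. CARD('n) - l \<le> idx i}"
      using l by (intro card_subset_eq) (auto simp: card_image_idx_less[OF Z(2)] card_le_idx)
    then show ?thesis using Z(4) by simp
  qed
  then show thesis using that Z(1,3) by blast
qed

definition opposite_block :: "nat \<Rightarrow> nat \<Rightarrow> 'n::finite \<Rightarrow> nat" where
  "opposite_block a1 a2 r
    = (if idx r < CARD('n) - a2 then 0 else if idx r < CARD('n) - a1 then 1 else 2)"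

lemma opposite_block_nonempty:
  assumes "0 < a1" "a1 \<le> a2" "a2 < CARD('n)"
  shows "{r::'n::finite. opposite_block a1 a2 r = 0} \<noteq> {}"
    "{r::'n. opposite_block a1 a2 r = 2} \<noteq> {}"
proof -
  obtain r :: 'n where "idx r = 0" by (rule idx_surj[of 0]) simp
  then have "opposite_block a1 a2 r = 0" using assms(3) by (simp add: opposite_block_def)
  then show "{r::'n. opposite_block a1 a2 r = 0} \<noteq> {}" by blast
  obtain s :: 'n where "idx s = CARD('n) - 1"
    using idx_surj[of "CARD('n) - 1"] zero_less_card_finite by (metis diff_less zero_less_one)
  then have "opposite_block a1 a2 s = 2" using assms by (auto simp: opposite_block_def)
  then show "{r::'n. opposite_block a1 a2 r = 2} \<noteq> {}" by blast
qed

lemma card_opposite_block_1: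
  assumes "a1 \<le> a2" "a2 \<le> CARD('n)"
  shows "card {r::'n::finite. opposite_block a1 a2 r = 1} = a2 - a1"
proof -
  have "{r::'n. opposite_block a1 a2 r = 1}
    = {r. idx r < CARD('n) - a1} - {r. idx r < CARD('n) - a2}"
    using assms by (auto simp: opposite_block_def)
  moreover have "{r::'n. idx r < CARD('n) - a2} \<subseteq> {r. idx r < CARD('n) - a1}" using assms by auto
  ultimately show ?thesis using assms by (simp add: card_Diff_subset)
qed

lemma block_upper_opposite_block:
  fixes \<kappa> :: "'a::field^'n^'n"
  assumes "upper \<kappa>" and \<kappa>: "\<And>l. l \<in> {a1, a2} \<Longrightarrow>
    (*v) \<kappa> ` coord_space {i. CARD('n) - l \<le> idx i} \<subseteq> coord_space {i. CARD('n) - l \<le> idx i}"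
  shows "block_upper (opposite_block a1 a2) \<kappa>"
  unfolding block_upper_def
proof (intro conjI allI impI)
  fix r s assume nz: "\<kappa> $ r $ s \<noteq> 0"
  have "idx r \<le> idx s" using nz upperD[OF assms(1), of s r] by force
  moreover have "CARD('n) - l \<le> idx s \<Longrightarrow> CARD('n) - l \<le> idx r" if "l \<in> {a1, a2}" for l
    using nz \<kappa>[OF that] unfolding matrix_image_coord_space_subset_iff by blast
  from this[of a1] this[of a2] have "CARD('n) - a1 \<le> idx s \<Longrightarrow> CARD('n) - a1 \<le> idx r"
    "CARD('n) - a2 \<le> idx s \<Longrightarrow> CARD('n) - a2 \<le> idx r" by simp_all
  ultimately show "opposite_block a1 a2 r = opposite_block a1 a2 s"
    unfolding opposite_block_def by (smt (verit) leI le_less_trans less_le_not_le)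
qed fact

lemma block_upper_conj_of_opposite_frame:
  fixes X Y Z h :: "complex^'n^'n"
  assumes Z: "det Z = 1" "\<And>j. flag_space Z j = flag_space Y j"
    "\<And>l. l \<in> {a1, a2} \<Longrightarrow> flag_space X l = (*v) Z ` coord_space {i. CARD('n) - l \<le> idx i}"
    and h: "h \<in> flag_stabilizer Y UNIV"
      "\<And>l. l \<in> {a1, a2} \<Longrightarrow> (*v) h ` flag_space X l = flag_space X l"
  shows "block_upper (opposite_block a1 a2) (matrix_inv Z ** h ** Z)"
proof (rule block_upper_opposite_block)
  have "h \<in> flag_stabilizer Z UNIV" using h(1) Z(2) by (simp add: flag_stabilizer_def)
  then show "upper (matrix_inv Z ** h ** Z)" using mem_flag_stabilizer_UNIV_iff[OF Z(1)] by simp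
  show "(*v) (matrix_inv Z ** h ** Z) ` coord_space {i. CARD('n) - l \<le> idx i}
    \<subseteq> coord_space {i. CARD('n) - l \<le> idx i}"
    if "l \<in> {a1, a2}" for l
    using h(2)[OF that] Z(1) by (simp add: matrix_image_mult Z(3)[OF that])
qed

lemma ex_block_upper_factorization:
  fixes X Y Z h m m' :: "complex^'n^'n"
  assumes det_m: "det m = 1" and Z: "det Z = 1" "\<And>j. flag_space Z j = flag_space Y j"
    "\<And>l. l \<in> {a1, a2} \<Longrightarrow> flag_space X l = (*v) Z ` coord_space {i. CARD('n) - l \<le> idx i}"
    and h: "h \<in> flag_stabilizer Y UNIV"
      "\<And>l. l \<in> {a1, a2} \<Longrightarrow> (*v) h ` flag_space X l = flag_space X l"
      "\<And>l. l \<in> L \<Longrightarrow> flag_space (h ** Z ** m) l = flag_space (Z ** m') l"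
  shows "\<exists>\<kappa> q. block_upper (opposite_block a1 a2) \<kappa> \<and> det \<kappa> = 1 \<and>
    (\<forall>l\<in>L. flag_space q l \<subseteq> std_flag l) \<and> m' = \<kappa> ** m ** q"
proof (intro exI conjI ballI)
  define \<kappa> where "\<kappa> = matrix_inv Z ** h ** Z"
  have "det h = 1" using h(1) by (simp add: flag_stabilizer_def)
  then show det_\<kappa>: "det \<kappa> = 1" using Z(1) by (simp add: \<kappa>_def det_mul)
  show "block_upper (opposite_block a1 a2) \<kappa>"
    unfolding \<kappa>_def using block_upper_conj_of_opposite_frame[OF Z h(1,2)] .
  show "m' = \<kappa> ** m ** (matrix_inv (\<kappa> ** m) ** m')"
    using det_\<kappa> det_m matrix_inv_cancel(1)[of "\<kappa> ** m" m'] by (simp add: det_mul)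
  fix l assume "l \<in> L"
  then have "flag_space (matrix_inv Z ** (h ** Z ** m)) l
    = flag_space (matrix_inv Z ** (Z ** m')) l"
    using h(3) by (simp only: flag_space_mult[of "matrix_inv Z"])
  then have "flag_space m' l = flag_space (\<kappa> ** m) l"
    using Z(1) by (simp add: \<kappa>_def matrix_mul_rassoc)
  then have "flag_space (matrix_inv (\<kappa> ** m) ** m') l
    = flag_space (matrix_inv (\<kappa> ** m) ** (\<kappa> ** m)) l"
    by (simp only: flag_space_mult[of "matrix_inv (\<kappa> ** m)"])
  also have "\<dots> = std_flag l" using det_\<kappa> det_m by (simp add: det_mul)
  finally show "flag_space (matrix_inv (\<kappa> ** m) ** m') l \<subseteq> std_flag l" by simp
qed

lemma coset_pair_mult: "coset_pair P Q (g ** x, g ** y) = diag_act g (coset_pair P Q (x, y))"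
  by (simp add: coset_pair_def diag_act_cosets)

lemma mem_own_orbit:
  assumes "subgroup H SL" "w \<in> double_flag P Q"
  shows "w \<in> orbit (SL\<lparr>carrier := H\<rparr>) diag_act w"
proof -
  obtain x y where w: "w = coset_pair P Q (x, y)"
    using assms(2) by (auto simp: double_flag_eq_image)
  have "mat 1 \<in> H" using subgroup.one_closed[OF assms(1)] by simp
  then show ?thesis unfolding w orbit_coset_pair by (intro image_eqI[of _ _ "mat 1"]) simp_all
qed

lemma ex_translation_in_orbit:
  fixes H :: "(complex^'n^'n) set"
  assumes H: "subgroup H SL"
    and z: "coset_pair P Q z \<in> orbit (SL\<lparr>carrier := H\<rparr>) diag_act w"
      "coset_pair P Q z' \<in> orbit (SL\<lparr>carrier := H\<rparr>) diag_act w"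
    and w: "w \<in> double_flag P Q"
  obtains h where "h \<in> H" "coset_pair P Q (h ** fst z, h ** snd z) = coset_pair P Q z'"
proof -
  obtain x y where w_eq: "w = coset_pair P Q (x, y)" using w by (auto simp: double_flag_eq_image)
  obtain g g' where g: "g \<in> H" "coset_pair P Q z = coset_pair P Q (g ** x, g ** y)"
    and g': "g' \<in> H" "coset_pair P Q z' = coset_pair P Q (g' ** x, g' ** y)"
    using z unfolding w_eq orbit_coset_pair by (elim imageE)
  have "det g = 1" using subgroup.mem_carrier[OF H g(1)] by simp
  have "coset_pair P Q (g' ** matrix_inv g ** fst z, g' ** matrix_inv g ** snd z)
      = coset_pair P Q (g' ** matrix_inv g ** (g ** x), g' ** matrix_inv g ** (g ** y))"
    unfolding coset_pair_mult[of _ _ "g' ** matrix_inv g"] using g(2) by simp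
  also have "\<dots> = coset_pair P Q z'" using g'(2) \<open>det g = 1\<close> by (simp add: matrix_mul_rassoc)
  finally have "coset_pair P Q (g' ** matrix_inv g ** fst z, g' ** matrix_inv g ** snd z)
    = coset_pair P Q z'" .
  moreover have "g' ** matrix_inv g \<in> H"
    using subgroup.m_closed[OF H g'(1) subgroup.m_inv_closed[OF H g(1)]] \<open>det g = 1\<close> by simp
  ultimately show thesis using that by blast
qed

lemma spherical_double_flag_imp_transitive_open:
  fixes Wp Wq :: "complex^'n^'n"
  assumes "spherical_double_flag (flag_stabilizer Wp Jp) (flag_stabilizer Wq Jq)"
  obtains Wb :: "complex^'n^'n" and Y where "det Wb = 1" "openin SL_pairs Y" "Y \<noteq> {}"
    "\<forall>z\<in>Y. \<forall>z'\<in>Y. \<exists>h\<in>flag_stabilizer Wb UNIV.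
       (\<forall>l\<in>Jp. flag_space (h ** fst z ** Wp) l = flag_space (fst z' ** Wp) l) \<and>
       (\<forall>l\<in>Jq. flag_space (h ** snd z ** Wq) l = flag_space (snd z' ** Wq) l)"
proof -
  let ?P = "flag_stabilizer Wp Jp" and ?Q = "flag_stabilizer Wq Jq"
  obtain B V where B: "borel_subgroup B"
    and V: "V \<in> orbits (SL\<lparr>carrier := B\<rparr>) (double_flag ?P ?Q) diag_act"
    "openin (double_flag_topology ?P ?Q) V" using assms by (auto simp: spherical_double_flag_def)
  obtain Wb :: "complex^'n^'n" where Wb: "det Wb = 1" "B = flag_stabilizer Wb UNIV"
    using borel_subgroup_eq_flag_stabilizer[OF B] by metis
  have B_subgroup: "subgroup B SL" unfolding Wb(2) by (rule subgroup_flag_stabilizer)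
  obtain w where w: "w \<in> double_flag ?P ?Q" "V = orbit (SL\<lparr>carrier := B\<rparr>) diag_act w"
    using V(1) by (auto simp: orbits_eq_image)
  define Y where "Y = {z \<in> carrier SL \<times> carrier SL. coset_pair ?P ?Q z \<in> V}"
  have "openin SL_pairs Y" using V(2) unfolding openin_double_flag_topology Y_def by blast
  moreover have "w \<in> V" unfolding w(2) by (rule mem_own_orbit[OF B_subgroup w(1)])
  then have "Y \<noteq> {}" using w(1) unfolding Y_def double_flag_eq_image by blast
  moreover have "\<exists>h\<in>flag_stabilizer Wb UNIV.
       (\<forall>l\<in>Jp. flag_space (h ** fst z ** Wp) l = flag_space (fst z' ** Wp) l) \<and>
       (\<forall>l\<in>Jq. flag_space (h ** snd z ** Wq) l = flag_space (snd z' ** Wq) l)"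
    if "z \<in> Y" "z' \<in> Y" for z z'
  proof -
    have z: "z \<in> carrier SL \<times> carrier SL" "z' \<in> carrier SL \<times> carrier SL"
      using that by (simp_all add: Y_def)
    have in_orbit: "coset_pair ?P ?Q z \<in> orbit (SL\<lparr>carrier := B\<rparr>) diag_act w"
      "coset_pair ?P ?Q z' \<in> orbit (SL\<lparr>carrier := B\<rparr>) diag_act w"
      using that by (simp_all add: Y_def w(2))
    obtain h where h: "h \<in> B" "coset_pair ?P ?Q (h ** fst z, h ** snd z) = coset_pair ?P ?Q z'"
      by (rule ex_translation_in_orbit[OF B_subgroup in_orbit w(1)])
    have "det h = 1" using subgroup.mem_carrier[OF B_subgroup h(1)] by simp
    then have "(h ** fst z, h ** snd z) \<in> carrier SL \<times> carrier SL"
      using z(1) by (auto simp: det_mul)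
    then show ?thesis
      using h z(2) unfolding Wb(2)
      by (intro bexI[of _ h]) (simp add: coset_pair_flag_stabilizer_eq_iff)
  qed
  ultimately show thesis using that Wb(1) by blast
qed

lemma ex_generic_first_flag:
  fixes Wp Wb :: "complex^'n^'n"
  assumes Y: "openin SL_pairs Y" "Y \<noteq> {}" and W: "det Wp = 1" "det Wb = 1"
    and a: "a1 \<le> CARD('n)" "a2 \<le> CARD('n)"
  obtains x y Z where "(x, y) \<in> Y" "det Z = 1" "\<And>j. flag_space Z j = flag_space Wb j"
    "\<And>l. l \<in> {a1, a2} \<Longrightarrow> flag_space (x ** Wp) l = (*v) Z ` coord_space {i. CARD('n) - l \<le> idx i}"
proof -
  have Y_sub: "Y \<subseteq> carrier SL \<times> carrier SL" using openin_subset[OF Y(1)] by simp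
  obtain x0 y where y: "(x0, y) \<in> Y" using Y(2) by auto
  define U where "U l = {x. det x = 1 \<and> opposite (x ** Wp) l Wb}" for l
  have U: "openin SL_topology (U l)" "U l \<noteq> {}" if "l \<le> CARD('n)" for l
    using openin_opposite[OF W that] ex_opposite[OF W that] by (auto simp: U_def)
  have slice: "openin SL_topology {x. (x, y) \<in> Y}" "{x. (x, y) \<in> Y} \<noteq> {}"
    using y Y_sub openin_SL_slice(1)[OF Y(1), of y] by auto
  have U12: "openin SL_topology (U a1 \<inter> U a2)" "U a1 \<inter> U a2 \<noteq> {}"
    by (intro openin_Int SL_open_Int_nonempty U a)+
  have "{x. (x, y) \<in> Y} \<inter> (U a1 \<inter> U a2) \<noteq> {}"
    by (rule SL_open_Int_nonempty[OF slice(1) U12(1) slice(2) U12(2)])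
  then obtain x
    where x: "(x, y) \<in> Y" "det x = 1" "opposite (x ** Wp) a1 Wb" "opposite (x ** Wp) a2 Wb"
    by (auto simp: U_def)
  then have det: "det (x ** Wp) \<noteq> 0" "det Wb \<noteq> 0" using W by (simp_all add: det_mul)
  have L: "{a1, a2} \<subseteq> {..CARD('n)}" "\<And>l. l \<in> {a1, a2} \<Longrightarrow> opposite (x ** Wp) l Wb"
    using a x(3,4) by auto
  obtain Z where Z: "det Z = det Wb" "\<And>j. flag_space Z j = flag_space Wb j"
    "\<And>l. l \<in> {a1, a2} \<Longrightarrow> flag_space (x ** Wp) l = (*v) Z ` coord_space {i. CARD('n) - l \<le> idx i}"
    using ex_opposite_frame[OF det L] by metis
  show thesis by (rule that[OF x(1) _ Z(2,3)]) (simp_all add: Z(1) W(2))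
qed

lemma openin_SL_sandwich_preimage:
  fixes x y :: "complex^'n^'n"
  assumes "openin SL_topology V" "det x = 1" "det y = 1"
  shows "openin SL_topology {m. det m = 1 \<and> x ** m ** y \<in> V}"
  using openin_continuous_map_preimage[OF continuous_map_SL_sandwich[OF assms(2,3)] assms(1)]
  by simp

lemma openin_nonempty_second_flag_in_frame:
  fixes Z W x y :: "complex^'n^'n"
  assumes Y: "openin SL_pairs Y" "(x, y) \<in> Y" and det: "det Z = 1" "det W = 1"
  shows "openin SL_topology {m. det m = 1 \<and> (x, Z ** m ** matrix_inv W) \<in> Y}"
    and "{m. det m = 1 \<and> (x, Z ** m ** matrix_inv W) \<in> Y} \<noteq> {}"
proof -
  have det_xy: "det x = 1" "det y = 1" using Y(2) openin_subset[OF Y(1)] by auto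
  then show "openin SL_topology {m. det m = 1 \<and> (x, Z ** m ** matrix_inv W) \<in> Y}"
    using openin_SL_sandwich_preimage[OF openin_SL_slice(2)[OF Y(1)], of x Z "matrix_inv W"] det
    by simp
  have "matrix_inv Z ** y ** W \<in> {m. det m = 1 \<and> (x, Z ** m ** matrix_inv W) \<in> Y}"
    using Y(2) det_xy det by (simp add: det_mul matrix_mul_rassoc)
  then show "{m. det m = 1 \<and> (x, Z ** m ** matrix_inv W) \<in> Y} \<noteq> {}" by blast
qed

lemma not_spherical_of_wider_middle_step:
  fixes Wp Wq :: "complex^'n^'n"
  assumes W: "det Wp = 1" "det Wq = 1"
    and a: "0 < a1" "a1 < a2" "a2 < CARD('n)" "a1 \<in> Jp" "a2 \<in> Jp"
    and b: "0 < b1" "b1 < b2" "b2 < CARD('n)" "b1 \<in> Jq" "b2 \<in> Jq"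
    and wider: "b2 - b1 \<le> a2 - a1"
  shows "\<not> spherical_double_flag (flag_stabilizer Wp Jp) (flag_stabilizer Wq Jq)"
proof
  assume "spherical_double_flag (flag_stabilizer Wp Jp) (flag_stabilizer Wq Jq)"
  from spherical_double_flag_imp_transitive_open[OF this]
  obtain Wb :: "complex^'n^'n" and Y where Wb: "det Wb = 1" and Y: "openin SL_pairs Y" "Y \<noteq> {}"
    and transitive: "\<forall>z\<in>Y. \<forall>z'\<in>Y. \<exists>h\<in>flag_stabilizer Wb UNIV.
       (\<forall>l\<in>Jp. flag_space (h ** fst z ** Wp) l = flag_space (fst z' ** Wp) l) \<and>
       (\<forall>l\<in>Jq. flag_space (h ** snd z ** Wq) l = flag_space (snd z' ** Wq) l)" .
  have a_le: "a1 \<le> CARD('n)" "a2 \<le> CARD('n)" using a by simp_all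
  obtain x y Z :: "complex^'n^'n" where xy: "(x, y) \<in> Y"
    and Z: "det Z = 1" "\<And>j. flag_space Z j = flag_space Wb j"
    "\<And>l. l \<in> {a1, a2} \<Longrightarrow> flag_space (x ** Wp) l = (*v) Z ` coord_space {i. CARD('n) - l \<le> idx i}"
    using ex_generic_first_flag[OF Y W(1) Wb a_le] by metis
  let ?U = "{m. det m = 1 \<and> (x, Z ** m ** matrix_inv Wq) \<in> Y}"
  show False
  proof (rule no_transitive_block_action[where U = ?U and bl = "opposite_block a1 a2"
        and i = 0 and j = 2 and k = 1])
    show "openin SL_topology ?U" "?U \<noteq> {}"
      by (rule openin_nonempty_second_flag_in_frame[OF Y(1) xy Z(1) W(2)])+
    show "{r::'n. opposite_block a1 a2 r = 0} \<noteq> {}" "{r::'n. opposite_block a1 a2 r = 2} \<noteq> {}"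
      by (rule opposite_block_nonempty; use a in simp)+
    show "b2 - b1 \<le> card {r::'n. opposite_block a1 a2 r = 1}"
      using wider a(2) a_le card_opposite_block_1[of a1 a2, where 'n = 'n] by linarith
    fix m m' assume m: "m \<in> ?U" "m' \<in> ?U"
    then have in_Y: "(x, Z ** m ** matrix_inv Wq) \<in> Y" "(x, Z ** m' ** matrix_inv Wq) \<in> Y"
      by simp_all
    from bspec[OF bspec[OF transitive in_Y(1)] in_Y(2)] obtain h
      where h: "h \<in> flag_stabilizer Wb UNIV"
      "\<forall>l\<in>Jp. flag_space (h ** x ** Wp) l = flag_space (x ** Wp) l"
      "\<forall>l\<in>Jq. flag_space (h ** (Z ** m ** matrix_inv Wq) ** Wq) l
        = flag_space (Z ** m' ** matrix_inv Wq ** Wq) l"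
      unfolding fst_conv snd_conv by blast
    show "\<exists>\<kappa> q. block_upper (opposite_block a1 a2) \<kappa> \<and> det \<kappa> = 1 \<and>
      (\<forall>l\<in>{b1, b2}. flag_space q l \<subseteq> std_flag l) \<and> m' = \<kappa> ** m ** q"
    proof (rule ex_block_upper_factorization[OF _ Z h(1)])
      show "det m = 1" using m by simp
      show "(*v) h ` flag_space (x ** Wp) l = flag_space (x ** Wp) l" if "l \<in> {a1, a2}" for l
        using that h(2) a by (auto simp: matrix_mul_rassoc simp flip: flag_space_mult)
      show "flag_space (h ** Z ** m) l = flag_space (Z ** m') l" if "l \<in> {b1, b2}" for l
        using that h(3) b W(2) by (auto simp: matrix_mul_rassoc)
    qed
  qed (use b in \<open>auto simp: opposite_block_def\<close>)
qed

lemma flag_stabilizer_single_step: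
  fixes W :: "complex^'n^'n"
  assumes "det W = 1" "J \<subseteq> {0<..<CARD('n)}" and single: "\<And>j k. j \<in> J \<Longrightarrow> k \<in> J \<Longrightarrow> \<not> j < k"
  obtains a where "a \<le> CARD('n)" "flag_stabilizer W J = flag_stabilizer W {a}"
proof (cases "J = {}")
  case True
  then have "flag_stabilizer W J = flag_stabilizer W {CARD('n)}"
    using flag_stabilizer_proper_steps[OF assms(1), of "{CARD('n)}"] by simp
  then show thesis using that by blast
next
  case False
  then obtain a where "a \<in> J" by blast
  then have "k = a" if "k \<in> J" for k
    using that single[of k a] single[of a k] by (meson linorder_neqE_nat)
  then have "J = {a}" using \<open>a \<in> J\<close> by blast
  then show thesis using that[of a] assms(2) by auto
qed

lemma spherical_imp_single_step:
  fixes Wp Wq :: "complex^'n^'n"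
  assumes W: "det Wp = 1" "det Wq = 1" and J: "Jp \<subseteq> {0<..<CARD('n)}" "Jq \<subseteq> {0<..<CARD('n)}"
    and spherical: "spherical_double_flag (flag_stabilizer Wp Jp) (flag_stabilizer Wq Jq)"
  obtains a where "a \<le> CARD('n)" "flag_stabilizer Wp Jp = flag_stabilizer Wp {a}"
    | a where "a \<le> CARD('n)" "flag_stabilizer Wq Jq = flag_stabilizer Wq {a}"
proof -
  have False if steps: "a1 \<in> Jp" "a2 \<in> Jp" "a1 < a2" "b1 \<in> Jq" "b2 \<in> Jq" "b1 < b2" for a1 a2 b1 b2
  proof -
    have bounds: "0 < a1" "a2 < CARD('n)" "0 < b1" "b2 < CARD('n)" using steps J by auto
    show False
    proof (cases "b2 - b1 \<le> a2 - a1")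
      case True
      then show False using not_spherical_of_wider_middle_step[OF W] bounds steps spherical by blast
    next
      case False
      then have "a2 - a1 \<le> b2 - b1" by simp
      then show False
        using not_spherical_of_wider_middle_step[OF W(2,1)] bounds steps
          spherical_double_flag_swap[OF spherical] by blast
    qed
  qed
  then consider "\<And>j k. j \<in> Jp \<Longrightarrow> k \<in> Jp \<Longrightarrow> \<not> j < k" | "\<And>j k. j \<in> Jq \<Longrightarrow> k \<in> Jq \<Longrightarrow> \<not> j < k" by blast
  then show thesis
  proof cases
    case 1
    then show thesis using flag_stabilizer_single_step[OF W(1) J(1)] that(1) by blast
  next
    case 2
    then show thesis using flag_stabilizer_single_step[OF W(2) J(2)] that(2) by blast
  qed
qed

theorem theorem1p1:
  fixes P Q :: "(complex^'n^'n) set"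
  assumes "parabolic_subgroup P" and "parabolic_subgroup Q"
    and "spherical_double_flag P Q"
  shows "lattice \<lparr>carrier = orbit_closures P Q, eq = (=), le = (\<subseteq>)\<rparr>"
proof -
  obtain Wp Jp where P: "det Wp = 1" "Jp \<subseteq> {0<..<CARD('n)}" "P = flag_stabilizer Wp Jp"
    by (rule parabolic_subgroup_eq_flag_stabilizer[OF assms(1)])
  obtain Wq Jq where Q: "det Wq = 1" "Jq \<subseteq> {0<..<CARD('n)}" "Q = flag_stabilizer Wq Jq"
    by (rule parabolic_subgroup_eq_flag_stabilizer[OF assms(2)])
  show ?thesis
  proof (rule spherical_imp_single_step[OF P(1) Q(1) P(2) Q(2) assms(3)[unfolded P(3) Q(3)]])
    fix a assume single: "a \<le> CARD('n)" "flag_stabilizer Wp Jp = flag_stabilizer Wp {a}"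
    interpret single: one_step_double_flag Wp Wq a Jq
      by unfold_locales (use P(1) Q(1,2) single(1) in auto)
    show ?thesis unfolding P(3) Q(3) single(2) by (rule single.lattice_orbit_closures)
  next
    fix a assume single: "a \<le> CARD('n)" "flag_stabilizer Wq Jq = flag_stabilizer Wq {a}"
    interpret single: one_step_double_flag Wq Wp a Jp
      by unfold_locales (use P(1,2) Q(1) single(1) in auto)
    show ?thesis
      unfolding P(3) Q(3) single(2)
      by (subst orbit_closures_swap) (rule lattice_image[OF inj_swap single.lattice_orbit_closures])
  qed
qed

end
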